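(* Let $T$ be a finite group, and for $n\in\mathbb{N}$ let $M_0^{(n)}$ be a probability on $\mathbb{Y}_n(\widehat T)$ with associated function $f_0^{(n)}(x)=\sum_{\lambda\in\mathbb{Y}_n(\widehat T)}M_0^{(n)}(\lambda)\frac{\chi^\lambda(x)}{\dim\lambda}$ on $\mathfrak{S}_n(T)$, such that the limits $$\gamma_{k+1}^\theta=\lim_{n\to\infty}n^{\frac{k-1}{2}}f_0^{(n)}\bigl(\iota_{n,k}(k)_\theta\bigr),\qquad k\in\mathbb{N},\ \theta\in[T],$$ exist. For $\zeta\in\widehat T$ define $R^\zeta_1=0$ and $$R^\zeta_{k+1}=\sum_{\theta\in[T]}\gamma^\theta_{k+1}\frac{|C_\theta|}{|T|}\,\overline{\chi^\zeta_\theta}\,(\dim\zeta)^k,\qquad k\in\mathbb{N}$$ (so that $R_2^\zeta=n^\zeta:=\lim_{n\to\infty}\mathbb{E}_{M_0^{(n)}}[|\lambda^\zeta|/n]$). Let $$a_k(t)=\frac{2}{\pi}\int_0^\infty\frac{e^{-tk^2u^2/2}}{u^2+1}\,du,\qquad k\in\mathbb{N},\ t\geq0,$$ and for $t\ge 0$ define $$R^\zeta_1(t)=0,\qquad R^\zeta_2(t)=(1-a_1(t))\frac{(\dim\zeta)^2}{|T|}+a_1(t)R^\zeta_2,\qquad R^\zeta_{k+1}(t)=a_k(t)R^\zeta_{k+1}\quad(k\geq2).$$ Assume that $(R^\zeta_j)_{j\in\mathbb{N}}$ is the free cumulant sequence of a compactly supported $\boxplus$-infinitely divisible probability $\mathfrak{m}^\zeta$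 on $\mathbb{R}$. Then, for every $t\geq0$, $(R^\zeta_j(t))_{j\in\mathbb{N}}$ is also the free cumulant sequence of a compactly supported $\boxplus$-infinitely divisible probability $\mathfrak{m}^\zeta(t)$ on $\mathbb{R}$, and Voiculescu's $R$-transform $R^\zeta(t,w)$ of $\mathfrak{m}^\zeta(t)$ is given by $$R^\zeta(t,w)=\int_{\mathbb{R}}\frac{1}{\sqrt{2\pi}}e^{-u^2/2}\Bigl\{(1-e^{-\sqrt t|u|})\frac{(\dim\zeta)^2}{|T|}w+R^\zeta(0,e^{-\sqrt t|u|}w)\Bigr\}du .$$
   Context: $\widehat{T}$ and $[T]$ are the sets of equivalence classes of irreducible representations and of conjugacy classes of the finite group $T$; $e_T$ is the identity; $C_\theta\subset T$ is the conjugacy class labelled by $\theta$; $\chi^\zeta_\theta$ is the value of the character of $\zeta$ on $\theta$. $\mathbb{Y}$ is the set of all Young diagrams (including $\varnothing$), $|\nu|$ is the number of boxes of $\nu$. $\mathfrak{S}_n(T)=T\wr\mathfrak{S}_n=T^n\rtimes\mathfrak{S}_n$. Set $$\mathbb{Y}_n(\widehat T)=\Bigl\{\lambda=(\lambda^\zeta)_{\zeta\in\widehat T}\,\Big|\,\lambda^\zeta\in\mathbb{Y},\ \sum_\zeta|\lambda^\zeta|=n\Bigr\},\quad \mathbb{Y}_n([T])=\Bigl\{\rho=(\rho_\theta)_{\theta\in[T]}\,\Big|\,\rho_\theta\in\mathbb{Y},\ \sum_\theta|\rho_\theta|=n\Bigr\}.$$ Irreducible representations of $\mathfrak{S}_n(T)$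 are parametrized in the standard way by $\lambda\in\mathbb{Y}_n(\widehat T)$, with character $\chi^\lambda$ and dimension $\dim\lambda$; conjugacy classes are parametrized in the standard way by $\mathbb{Y}_n([T])$: the rows of $\rho_\theta$ are the lengths of the cycles whose cycle product lies in $\theta$. A central function is evaluated at an element of $\mathbb{Y}_n([T])$ by taking its value on that class. For $k<n$, $\iota_{n,k}:\mathbb{Y}_k([T])\to\mathbb{Y}_n([T])$ replaces $\rho_{\{e_T\}}$ by $\rho_{\{e_T\}}\sqcup(1^{n-k})$ (adding $n-k$ rows of length 1) and leaves the other entries unchanged. $(k)_\theta\in\mathbb{Y}_k([T])$ has $\theta$-entry the one-row diagram $(k)$ and all other entries $\varnothing$. $\mathbb{E}_M$ is the expectation when $\lambda=(\lambda^\zeta)_{\zeta}$ has distribution $M$. $\boxplus$ is free additive convolution. Voiculescu's $R$-transform of a compactly supported probability $\mathfrak{m}$ with free cumulants $R_j(\mathfrak{m})$ is $R_{\mathfrak m}(w)=\sum_{k=0}^\infty R_{k+1}(\mathfrak{m})w^k$ (for $w$ near $0$). Since $a_k(0)=1$ for all $k$, $\mathfrak{m}^\zeta(0)=\mathfrak{m}^\zeta$, so $R^\zeta(0,\cdot)$ is the $R$-transform of $\mathfrak{m}^\zeta$. *)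

theory Defs
  imports
    "Jordan_Normal_Form.Matrix"
    "HOL-Probability.Probability"
    "HOL-Combinatorics.Combinatorics"
    "HOL-Library.Function_Algebras"
begin

section \<open>Finite groups: conjugacy classes and irreducible representations\<close>

definition conj_class :: "('a, 'b) monoid_scheme \<Rightarrow> 'a \<Rightarrow> 'a set" where
  "conj_class G x = {g \<otimes>\<^bsub>G\<^esub> x \<otimes>\<^bsub>G\<^esub> inv\<^bsub>G\<^esub> g | g. g \<in> carrier G}"

definition conj_classes :: "('a, 'b) monoid_scheme \<Rightarrow> 'a set set" where
  "conj_classes G = conj_class G ` carrier G"

definition matrix_rep ::
  "('a, 'b) monoid_scheme \<Rightarrow> nat \<Rightarrow> ('a \<Rightarrow> complex mat) \<Rightarrow> bool" where
  "matrix_rep G d \<rho> \<longleftrightarrow>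
     (\<forall>g\<in>carrier G. \<rho> g \<in> carrier_mat d d) \<and>
     \<rho> \<one>\<^bsub>G\<^esub> = 1\<^sub>m d \<and>
     (\<forall>g\<in>carrier G. \<forall>h\<in>carrier G. \<rho> (g \<otimes>\<^bsub>G\<^esub> h) = \<rho> g * \<rho> h)"

definition invariant_subspace ::
  "('a, 'b) monoid_scheme \<Rightarrow> nat \<Rightarrow> ('a \<Rightarrow> complex mat) \<Rightarrow> complex Matrix.vec set \<Rightarrow> bool" where
  "invariant_subspace G d \<rho> W \<longleftrightarrow>
     W \<subseteq> carrier_vec d \<and> 0\<^sub>v d \<in> W \<and>
     (\<forall>v\<in>W. \<forall>w\<in>W. v + w \<in> W) \<and> (\<forall>c. \<forall>v\<in>W. c \<cdot>\<^sub>v v \<in> W) \<and>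
     (\<forall>g\<in>carrier G. \<forall>v\<in>W. \<rho> g *\<^sub>v v \<in> W)"

definition irreps :: "('a, 'b) monoid_scheme \<Rightarrow> (nat \<times> ('a \<Rightarrow> complex mat)) set" where
  "irreps G = {(d, \<rho>). d > 0 \<and> matrix_rep G d \<rho> \<and>
     (\<forall>W. invariant_subspace G d \<rho> W \<longrightarrow> W = {0\<^sub>v d} \<or> W = carrier_vec d)}"

definition rep_equiv ::
  "('a, 'b) monoid_scheme \<Rightarrow>
     ((nat \<times> ('a \<Rightarrow> complex mat)) \<times> (nat \<times> ('a \<Rightarrow> complex mat))) set" where
  "rep_equiv G = {((d, \<rho>), (d', \<rho>')). (d, \<rho>) \<in> irreps G \<and> (d', \<rho>') \<in> irreps G \<and> d = d' \<and>
     (\<exists>P\<in>carrier_mat d d. invertible_mat P \<and> (\<forall>g\<in>carrier G. P * \<rho> g = \<rho>' g * P))}"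

type_synonym 'a irrep_class = "(nat \<times> ('a \<Rightarrow> complex mat)) set"

definition irr_classes :: "('a, 'b) monoid_scheme \<Rightarrow> 'a irrep_class set" where
  "irr_classes G = irreps G // rep_equiv G"

definition irr_dim :: "'a irrep_class \<Rightarrow> nat" where
  "irr_dim \<zeta> = fst (SOME p. p \<in> \<zeta>)"

definition irr_rep :: "'a irrep_class \<Rightarrow> 'a \<Rightarrow> complex mat" where
  "irr_rep \<zeta> = snd (SOME p. p \<in> \<zeta>)"

definition irr_char :: "'a irrep_class \<Rightarrow> 'a \<Rightarrow> complex" where
  "irr_char \<zeta> g = (\<Sum>i<irr_dim \<zeta>. irr_rep \<zeta> g $$ (i, i))"

definition irr_char_class :: "'a irrep_class \<Rightarrow> 'a set \<Rightarrow> complex" where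
  "irr_char_class \<zeta> \<theta> = irr_char \<zeta> (SOME g. g \<in> \<theta>)"

definition induced_char ::
  "('a, 'b) monoid_scheme \<Rightarrow> 'a set \<Rightarrow> ('a \<Rightarrow> complex) \<Rightarrow> 'a \<Rightarrow> complex" where
  "induced_char G H \<psi> x =
     (\<Sum>g\<in>carrier G. if inv\<^bsub>G\<^esub> g \<otimes>\<^bsub>G\<^esub> x \<otimes>\<^bsub>G\<^esub> g \<in> H
        then \<psi> (inv\<^bsub>G\<^esub> g \<otimes>\<^bsub>G\<^esub> x \<otimes>\<^bsub>G\<^esub> g) else 0) / of_nat (card H)"


section \<open>Young diagrams and Specht modules\<close>

text \<open>A Young diagram is the weakly decreasing list of its (positive) row lengths,
  so \<open>|\<nu>|\<close> is \<open>sum_list \<nu>\<close> and the empty diagram is \<open>[]\<close>.\<close>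

definition young :: "nat list set" where
  "young = {\<nu>. sorted_wrt (\<ge>) \<nu> \<and> 0 \<notin> set \<nu>}"

definition young_families :: "'i set \<Rightarrow> nat \<Rightarrow> ('i \<Rightarrow> nat list) set" where
  "young_families I n = {\<Lambda> \<in> I \<rightarrow>\<^sub>E young. (\<Sum>i\<in>I. sum_list (\<Lambda> i)) = n}"

definition boxes :: "nat list \<Rightarrow> (nat \<times> nat) set" where
  "boxes \<nu> = {(i, j). i < length \<nu> \<and> j < \<nu> ! i}"

text \<open>Tableaux are filled with the elements of an arbitrary finite set \<open>B\<close> with \<open>|\<nu>|\<close>
  elements; the resulting module carries an action of the permutations of \<open>B\<close>.\<close>

definition tableaux :: "nat list \<Rightarrow> nat set \<Rightarrow> (nat \<times> nat \<Rightarrow> nat) set" where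
  "tableaux \<nu> B = {t. bij_betw t (boxes \<nu>) B}"

definition tabloid :: "nat list \<Rightarrow> nat set \<Rightarrow> (nat \<times> nat \<Rightarrow> nat) \<Rightarrow> nat \<Rightarrow> nat" where
  "tabloid \<nu> B t = (\<lambda>b\<in>B. fst (inv_into (boxes \<nu>) t b))"

definition column_stabilizer ::
  "nat list \<Rightarrow> nat set \<Rightarrow> (nat \<times> nat \<Rightarrow> nat) \<Rightarrow> (nat \<Rightarrow> nat) set" where
  "column_stabilizer \<nu> B t = {\<pi>. \<pi> permutes B \<and>
     (\<forall>b\<in>B. snd (inv_into (boxes \<nu>) t (\<pi> b)) = snd (inv_into (boxes \<nu>) t b))}"

definition polytabloid ::
  "nat list \<Rightarrow> nat set \<Rightarrow> (nat \<times> nat \<Rightarrow> nat) \<Rightarrow> (nat \<Rightarrow> nat) \<Rightarrow> complex" where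
  "polytabloid \<nu> B t = (\<lambda>w. \<Sum>\<pi>\<in>column_stabilizer \<nu> B t.
     of_int (sign \<pi>) * (if w = tabloid \<nu> B (\<pi> \<circ> t) then 1 else 0))"

interpretation cfun: vector_space "\<lambda>(c::complex) (f :: 'x \<Rightarrow> complex) x. c * f x"
  by unfold_locales (auto simp: fun_eq_iff algebra_simps)

text \<open>The trace of an endomorphism \<open>A\<close> of a finite-dimensional space \<open>V\<close> of functions.\<close>

definition trace_on ::
  "('x \<Rightarrow> complex) set \<Rightarrow> (('x \<Rightarrow> complex) \<Rightarrow> ('x \<Rightarrow> complex)) \<Rightarrow> complex" where
  "trace_on V A =
     (let B = (SOME B. cfun.independent B \<and> cfun.span B = V)
      in \<Sum>b\<in>B. cfun.representation B (A b) b)"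

definition specht_module :: "nat list \<Rightarrow> nat set \<Rightarrow> ((nat \<Rightarrow> nat) \<Rightarrow> complex) set" where
  "specht_module \<nu> B = cfun.span (polytabloid \<nu> B ` tableaux \<nu> B)"

text \<open>A permutation \<open>\<sigma>\<close> of \<open>B\<close> sends the tabloid \<open>w\<close> (a map from entries to rows) to
  \<open>w \<circ> \<sigma>\<inverse>\<close>, hence the function \<open>f\<close> on tabloids to \<open>w \<mapsto> f (w \<circ> \<sigma>)\<close>.\<close>

definition specht_char :: "nat list \<Rightarrow> nat set \<Rightarrow> (nat \<Rightarrow> nat) \<Rightarrow> complex" where
  "specht_char \<nu> B \<sigma> = trace_on (specht_module \<nu> B) (\<lambda>f w. f (w \<circ> \<sigma>))"


section \<open>The wreath product of a finite group with a symmetric group\<close>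

definition wreath ::
  "('a, 'b) monoid_scheme \<Rightarrow> nat \<Rightarrow> ((nat \<Rightarrow> 'a) \<times> (nat \<Rightarrow> nat)) monoid" where
  "wreath T n = \<lparr>
     carrier = ({..<n} \<rightarrow>\<^sub>E carrier T) \<times> {\<sigma>. \<sigma> permutes {..<n}},
     monoid.mult = (\<lambda>(s, \<sigma>) (t, \<tau>).
       (\<lambda>i\<in>{..<n}. s i \<otimes>\<^bsub>T\<^esub> t (inv_into UNIV \<sigma> i), \<sigma> \<circ> \<tau>)),
     one = (\<lambda>i\<in>{..<n}. \<one>\<^bsub>T\<^esub>, id)\<rparr>"

text \<open>The product \<open>t(\<sigma>\<^sup>l\<^sup>-\<^sup>1 j) \<cdots> t(\<sigma> j) t(j)\<close> along the cycle of \<open>\<sigma>\<close> ending at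
  \<open>i = \<sigma>\<^sup>l\<^sup>-\<^sup>1 j\<close>; its conjugacy class does not depend on the chosen point of the cycle.\<close>

definition cycle_product ::
  "('a, 'b) monoid_scheme \<Rightarrow> (nat \<Rightarrow> 'a) \<Rightarrow> (nat \<Rightarrow> nat) \<Rightarrow> nat \<Rightarrow> 'a" where
  "cycle_product T t \<sigma> i =
     foldr (\<lambda>k y. t ((inv_into UNIV \<sigma> ^^ k) i) \<otimes>\<^bsub>T\<^esub> y) [0..<card (orbit \<sigma> i)] \<one>\<^bsub>T\<^esub>"

definition wreath_type ::
  "('a, 'b) monoid_scheme \<Rightarrow> nat \<Rightarrow> (nat \<Rightarrow> 'a) \<times> (nat \<Rightarrow> nat) \<Rightarrow> 'a set \<Rightarrow> nat list" where
  "wreath_type T n = (\<lambda>(t, \<sigma>). \<lambda>\<theta>\<in>conj_classes T.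
     rev (sorted_list_of_multiset
       (image_mset card (mset_set {orbit \<sigma> i | i. i < n \<and> cycle_product T t \<sigma> i \<in> \<theta>}))))"

text \<open>Value of a central function on the class labelled by \<open>\<rho>\<close>.\<close>

definition class_value ::
  "('a, 'b) monoid_scheme \<Rightarrow> nat \<Rightarrow> ((nat \<Rightarrow> 'a) \<times> (nat \<Rightarrow> nat) \<Rightarrow> complex) \<Rightarrow>
     ('a set \<Rightarrow> nat list) \<Rightarrow> complex" where
  "class_value T n f \<rho> = f (SOME x. x \<in> carrier (wreath T n) \<and> wreath_type T n x = \<rho>)"

definition iota ::
  "('a, 'b) monoid_scheme \<Rightarrow> nat \<Rightarrow> nat \<Rightarrow> ('a set \<Rightarrow> nat list) \<Rightarrow> 'a set \<Rightarrow> nat list" where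
  "iota T n k \<rho> =
     \<rho>(conj_class T \<one>\<^bsub>T\<^esub> := \<rho> (conj_class T \<one>\<^bsub>T\<^esub>) @ replicate (n - k) 1)"

definition one_row ::
  "('a, 'b) monoid_scheme \<Rightarrow> nat \<Rightarrow> 'a set \<Rightarrow> 'a set \<Rightarrow> nat list" where
  "one_row T k \<theta> = (\<lambda>\<theta>'\<in>conj_classes T. if \<theta>' = \<theta> then [k] else [])"

text \<open>
  The irreducible representation labelled by \<open>\<lambda> = (\<lambda>\<^sup>\<zeta>)\<close>: distribute the points \<open>{..<n}\<close> into blocks
  \<open>B\<^sub>\<zeta>\<close> with \<open>|B\<^sub>\<zeta>| = |\<lambda>\<^sup>\<zeta>|\<close>, and induce from the stabilizer of the blocks,
  which is the product of the wreath products of \<open>T\<close> with the symmetric groups on the \<open>B\<^sub>\<zeta>\<close>,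
  the tensor product over \<open>\<zeta>\<close> of (the tensor power of \<open>\<zeta>\<close> over the points of \<open>B\<^sub>\<zeta>\<close>,
  on which \<open>(t, \<sigma>)\<close> acts by \<open>\<Otimes>\<^sub>i v\<^sub>i \<mapsto> \<Otimes>\<^sub>i t(i) v(\<sigma>\<inverse> i)\<close>)
  \<open>\<otimes>\<close> (the Specht module of \<open>\<lambda>\<^sup>\<zeta>\<close> on \<open>B\<^sub>\<zeta>\<close>).
\<close>

definition block_assignment ::
  "('a, 'b) monoid_scheme \<Rightarrow> nat \<Rightarrow> ('a irrep_class \<Rightarrow> nat list) \<Rightarrow> nat \<Rightarrow> 'a irrep_class" where
  "block_assignment T n \<Lambda> = (SOME b. b \<in> {..<n} \<rightarrow>\<^sub>E irr_classes T \<and>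
     (\<forall>\<zeta>\<in>irr_classes T. card {i. i < n \<and> b i = \<zeta>} = sum_list (\<Lambda> \<zeta>)))"

definition block_stabilizer ::
  "('a, 'b) monoid_scheme \<Rightarrow> nat \<Rightarrow> (nat \<Rightarrow> 'a irrep_class) \<Rightarrow>
     ((nat \<Rightarrow> 'a) \<times> (nat \<Rightarrow> nat)) set" where
  "block_stabilizer T n b = {(t, \<sigma>) \<in> carrier (wreath T n). \<forall>i<n. b (\<sigma> i) = b i}"

text \<open>Trace of \<open>(t, \<sigma>)\<close> on the tensor product over \<open>i < n\<close> of the spaces of \<open>b i\<close>:
  the sum of the diagonal entries in the basis of the tensors of standard basis vectors.\<close>

definition tensor_char ::
  "nat \<Rightarrow> (nat \<Rightarrow> 'a irrep_class) \<Rightarrow> (nat \<Rightarrow> 'a) \<times> (nat \<Rightarrow> nat) \<Rightarrow> complex" where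
  "tensor_char n b = (\<lambda>(t, \<sigma>). \<Sum>j\<in>(\<Pi>\<^sub>E i\<in>{..<n}. {..<irr_dim (b i)}).
     \<Prod>i<n. irr_rep (b i) (t i) $$ (j i, j (inv_into UNIV \<sigma> i)))"

definition block_char ::
  "('a, 'b) monoid_scheme \<Rightarrow> nat \<Rightarrow> (nat \<Rightarrow> 'a irrep_class) \<Rightarrow> ('a irrep_class \<Rightarrow> nat list) \<Rightarrow>
     (nat \<Rightarrow> 'a) \<times> (nat \<Rightarrow> nat) \<Rightarrow> complex" where
  "block_char T n b \<Lambda> x = tensor_char n b x *
     (\<Prod>\<zeta>\<in>irr_classes T.
        let B = {i. i < n \<and> b i = \<zeta>} in specht_char (\<Lambda> \<zeta>) B (perm_restrict (snd x) B))"

definition wreath_char ::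
  "('a, 'b) monoid_scheme \<Rightarrow> nat \<Rightarrow> ('a irrep_class \<Rightarrow> nat list) \<Rightarrow>
     (nat \<Rightarrow> 'a) \<times> (nat \<Rightarrow> nat) \<Rightarrow> complex" where
  "wreath_char T n \<Lambda> =
     (let b = block_assignment T n \<Lambda>
      in induced_char (wreath T n) (block_stabilizer T n b) (block_char T n b \<Lambda>))"

definition wreath_dim ::
  "('a, 'b) monoid_scheme \<Rightarrow> nat \<Rightarrow> ('a irrep_class \<Rightarrow> nat list) \<Rightarrow> complex" where
  "wreath_dim T n \<Lambda> = wreath_char T n \<Lambda> \<one>\<^bsub>wreath T n\<^esub>"

definition associated_function ::
  "('a, 'b) monoid_scheme \<Rightarrow> nat \<Rightarrow> ('a irrep_class \<Rightarrow> nat list) pmf \<Rightarrow>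
     (nat \<Rightarrow> 'a) \<times> (nat \<Rightarrow> nat) \<Rightarrow> complex" where
  "associated_function T n M x = (\<Sum>\<Lambda>\<in>young_families (irr_classes T) n.
     of_real (pmf M \<Lambda>) * (wreath_char T n \<Lambda> x / wreath_dim T n \<Lambda>))"


section \<open>Free probability\<close>

definition compactly_supported_prob :: "real measure \<Rightarrow> bool" where
  "compactly_supported_prob \<mu> \<longleftrightarrow>
     real_distribution \<mu> \<and> (\<exists>K. compact K \<and> (AE x in \<mu>. x \<in> K))"

definition moment :: "real measure \<Rightarrow> nat \<Rightarrow> real" where
  "moment \<mu> n = (LINT x|\<mu>. x ^ n)"

definition noncrossing_partitions :: "nat \<Rightarrow> nat set set set" where
  "noncrossing_partitions n = {\<pi>. partition_on {..<n} \<pi> \<and>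
     (\<forall>B\<in>\<pi>. \<forall>C\<in>\<pi>. \<forall>a\<in>B. \<forall>b\<in>C. \<forall>c\<in>B. \<forall>d\<in>C. a < b \<and> b < c \<and> c < d \<longrightarrow> B = C)}"

text \<open>Free cumulants of a moment sequence, obtained by solving the moment-cumulant formula
  (lemma \<open>moment_cumulant\<close>) recursively. The test \<open>card B < n\<close> holds for all blocks that
  occur and only serves termination. The value at \<open>0\<close> is irrelevant.\<close>

function cumulant_of_moments :: "(nat \<Rightarrow> real) \<Rightarrow> nat \<Rightarrow> real" where
  "cumulant_of_moments m n = m n -
     (\<Sum>\<pi>\<in>noncrossing_partitions n - {{{..<n}}}.
        \<Prod>B\<in>\<pi>. if card B < n then cumulant_of_moments m (card B) else 0)"
  by pat_completeness auto
termination by (relation "Wellfounded.measure snd") auto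

declare cumulant_of_moments.simps [simp del]

definition free_cumulant :: "real measure \<Rightarrow> nat \<Rightarrow> real" where
  "free_cumulant \<mu> = cumulant_of_moments (moment \<mu>)"

lemma finite_noncrossing_partitions: "finite (noncrossing_partitions n)"
proof (rule finite_subset)
  show "noncrossing_partitions n \<subseteq> Pow (Pow {..<n})"
    by (auto simp: noncrossing_partitions_def partition_on_def)
qed simp

lemma moment_cumulant:
  assumes "n \<ge> 1"
  shows "moment \<mu> n = (\<Sum>\<pi>\<in>noncrossing_partitions n. \<Prod>B\<in>\<pi>. free_cumulant \<mu> (card B))"
proof -
  let ?k = "cumulant_of_moments (moment \<mu>)"
  have "0 \<in> {..<n}" using assms by simp
  then have "{..<n} \<noteq> {}" by blast
  then have top: "{{..<n}} \<in> noncrossing_partitions n"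
    by (simp add: noncrossing_partitions_def partition_on_def)
  have small: "card B < n" if "\<pi> \<in> noncrossing_partitions n - {{{..<n}}}" "B \<in> \<pi>" for \<pi> B
  proof -
    have part: "\<Union>\<pi> = {..<n}" "disjoint \<pi>" "{} \<notin> \<pi>" and ne: "\<pi> \<noteq> {{..<n}}"
      using that(1) by (simp_all add: noncrossing_partitions_def partition_on_def)
    have sub: "B \<subseteq> {..<n}" using part(1) that(2) by blast
    have "B \<noteq> {..<n}"
    proof
      assume B: "B = {..<n}"
      have "C = B" if "C \<in> \<pi>" for C
      proof -
        have "C \<subseteq> B" unfolding B using part(1) that by blast
        moreover have "C \<noteq> {}" using part(3) that by blast
        ultimately have "C \<inter> B \<noteq> {}" by blast
        then show ?thesis using disjointD[OF part(2) that \<open>B \<in> \<pi>\<close>] by blast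
      qed
      then have "\<pi> = {B}" using \<open>B \<in> \<pi>\<close> by blast
      then show False using ne B by blast
    qed
    then have "B \<subset> {..<n}" using sub by blast
    then have "card B < card {..<n}" by (rule psubset_card_mono[OF finite_lessThan])
    then show ?thesis by simp
  qed
  have "(\<Sum>\<pi>\<in>noncrossing_partitions n. \<Prod>B\<in>\<pi>. ?k (card B)) =
      (\<Prod>B\<in>{{..<n}}. ?k (card B)) +
      (\<Sum>\<pi>\<in>noncrossing_partitions n - {{{..<n}}}. \<Prod>B\<in>\<pi>. ?k (card B))"
    by (rule sum.remove[OF finite_noncrossing_partitions top])
  also have "(\<Sum>\<pi>\<in>noncrossing_partitions n - {{{..<n}}}. \<Prod>B\<in>\<pi>. ?k (card B)) =
      (\<Sum>\<pi>\<in>noncrossing_partitions n - {{{..<n}}}. \<Prod>B\<in>\<pi>. if card B < n then ?k (card B) else 0)"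
  proof (intro sum.cong prod.cong refl)
    fix \<pi> B assume "\<pi> \<in> noncrossing_partitions n - {{{..<n}}}" "B \<in> \<pi>"
    then have "card B < n" by (rule small)
    then show "?k (card B) = (if card B < n then ?k (card B) else 0)" by (simp only: if_True)
  qed
  also have "\<dots> = moment \<mu> n - ?k n"
    using cumulant_of_moments.simps[of "moment \<mu>" n] by linarith
  finally show ?thesis by (simp add: free_cumulant_def)
qed

definition R_transform :: "real measure \<Rightarrow> complex \<Rightarrow> complex" where
  "R_transform \<mu> w = (\<Sum>k. of_real (free_cumulant \<mu> (k + 1)) * w ^ k)"

text \<open>The joint distribution of two noncommutative random variables \<open>x\<^bsub>False\<^esub>\<close>, \<open>x\<^bsub>True\<^esub>\<close>
  is a unital linear functional on the free algebra generated by two letters. It is given by its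
  values \<open>\<phi>\<close> on words. \<open>word_ev \<phi> u [(i\<^sub>1, p\<^sub>1), \<dots>, (i\<^sub>k, p\<^sub>k)]\<close> is the value of the
  functional on \<open>u p\<^sub>1(x\<^bsub>i\<^sub>1\<^esub>) \<cdots> p\<^sub>k(x\<^bsub>i\<^sub>k\<^esub>)\<close>.\<close>

fun word_ev ::
  "('i list \<Rightarrow> complex) \<Rightarrow> 'i list \<Rightarrow> ('i \<times> complex poly) list \<Rightarrow> complex" where
  "word_ev \<phi> u [] = \<phi> u"
| "word_ev \<phi> u ((i, p) # ps) =
     (\<Sum>e\<le>degree p. coeff p e * word_ev \<phi> (u @ replicate e i) ps)"

definition free_variables :: "('i list \<Rightarrow> complex) \<Rightarrow> bool" where
  "free_variables \<phi> \<longleftrightarrow> (\<forall>ps. ps \<noteq> [] \<and> successively (\<noteq>) (map fst ps) \<and>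
     (\<forall>q\<in>set ps. word_ev \<phi> [] [q] = 0) \<longrightarrow> word_ev \<phi> [] ps = 0)"

text \<open>\<open>\<rho> = \<mu> \<boxplus> \<nu>\<close>: the law of the sum of two free variables with laws \<open>\<mu>\<close> and \<open>\<nu>\<close>.
  A compactly supported law is determined by its moments, and the conditions on \<open>\<phi>\<close>
  determine \<open>\<phi>\<close>, so this relation is functional.\<close>

definition is_free_convolution :: "real measure \<Rightarrow> real measure \<Rightarrow> real measure \<Rightarrow> bool" where
  "is_free_convolution \<mu> \<nu> \<rho> \<longleftrightarrow>
     compactly_supported_prob \<mu> \<and> compactly_supported_prob \<nu> \<and> compactly_supported_prob \<rho> \<and>
     (\<exists>\<phi> :: bool list \<Rightarrow> complex. \<phi> [] = 1 \<and> free_variables \<phi> \<and>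
        (\<forall>k. \<phi> (replicate k False) = of_real (moment \<mu> k)) \<and>
        (\<forall>k. \<phi> (replicate k True) = of_real (moment \<nu> k)) \<and>
        (\<forall>k. of_real (moment \<rho> k) = (\<Sum>w | length w = k. \<phi> w)))"

fun is_free_power :: "nat \<Rightarrow> real measure \<Rightarrow> real measure \<Rightarrow> bool" where
  "is_free_power 0 \<nu> \<mu> \<longleftrightarrow> \<mu> = return borel 0"
| "is_free_power (Suc n) \<nu> \<mu> \<longleftrightarrow> (\<exists>\<rho>. is_free_power n \<nu> \<rho> \<and> is_free_convolution \<rho> \<nu> \<mu>)"

text \<open>For compactly supported \<open>\<mu>\<close> the roots \<open>\<nu>\<close> are automatically compactly supported, so it
  suffices to have the convolution for compactly supported laws.\<close>

definition freely_infinitely_divisible :: "real measure \<Rightarrow> bool" where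
  "freely_infinitely_divisible \<mu> \<longleftrightarrow>
     (\<forall>n\<ge>1. \<exists>\<nu>. compactly_supported_prob \<nu> \<and> is_free_power n \<nu> \<mu>)"


section \<open>Initial and time-evolved cumulants\<close>

definition initial_cumulant ::
  "('a, 'b) monoid_scheme \<Rightarrow> ('a set \<Rightarrow> nat \<Rightarrow> complex) \<Rightarrow> 'a irrep_class \<Rightarrow> nat \<Rightarrow> complex" where
  "initial_cumulant T \<gamma> \<zeta> j = (if j \<le> 1 then 0 else
     \<Sum>\<theta>\<in>conj_classes T. \<gamma> \<theta> j * (of_nat (card \<theta>) / of_nat (card (carrier T))) *
       cnj (irr_char_class \<zeta> \<theta>) * of_nat (irr_dim \<zeta>) ^ (j - 1))"

definition a_coeff :: "nat \<Rightarrow> real \<Rightarrow> real" where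
  "a_coeff k t = 2 / pi *
     (LBINT u:{0..}. exp (- t * (real k)\<^sup>2 * u\<^sup>2 / 2) / (u\<^sup>2 + 1))"

definition evolved_cumulant ::
  "('a, 'b) monoid_scheme \<Rightarrow> ('a set \<Rightarrow> nat \<Rightarrow> complex) \<Rightarrow> 'a irrep_class \<Rightarrow> real \<Rightarrow> nat \<Rightarrow>
     complex" where
  "evolved_cumulant T \<gamma> \<zeta> t j =
     (if j \<le> 1 then 0
      else if j = 2 then
        of_real ((1 - a_coeff 1 t) * (real (irr_dim \<zeta>))\<^sup>2 / real (card (carrier T))) +
        of_real (a_coeff 1 t) * initial_cumulant T \<gamma> \<zeta> 2
      else of_real (a_coeff (j - 1) t) * initial_cumulant T \<gamma> \<zeta> j)"

end

theory Submission
  imports Defs "Jordan_Normal_Form.Spectral_Radius" "Jordan_Normal_Form.Schur_Decomposition"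
begin

text \<open>
  The two assertions have separate proofs.

  \<^emph>\<open>The limit of the mean proportions.\<close> Let \<open>x\<close> be an element of the wreath product with
  trivial permutation part whose only nontrivial base coordinate is \<open>h\<close>. In the induced
  character \<open>\<chi>\<^sup>\<lambda>(x)\<close> each conjugate of \<open>x\<close> again lies in the base group, so the Specht factors
  contribute only their dimensions, and the conjugation moves \<open>h\<close> to a uniformly distributed
  position. Hence \<open>\<chi>\<^sup>\<lambda>(x) / dim \<lambda> = \<Sum>\<^sub>\<zeta> (|\<lambda>\<^sup>\<zeta>| / n) \<chi>\<^sup>\<zeta>(h) / dim \<zeta>\<close>
  (\<open>normalized_wreath_char_one_point\<close>). The elements of type \<open>(1)\<^sub>\<theta>\<close> are of this kind, and
  orthogonality of irreducible characters solves this linear relation for the mean of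
  \<open>|\<lambda>\<^sup>\<zeta>| / n\<close> already at finite \<open>n\<close> (\<open>expected_proportion_eq\<close>); then \<open>n \<rightarrow> \<infinity>\<close>.

  \<^emph>\<open>The evolved laws.\<close> Write \<open>\<kappa>\<^sub>j\<close> for the free cumulants of a compactly supported law. The law
  is infinitely divisible for free convolution iff \<open>(\<kappa>\<^sub>j\<^sub>+\<^sub>2)\<^sub>j\<close> is a moment sequence of a finite
  positive measure. The evolution replaces \<open>\<kappa>\<^sub>j\<^sub>+\<^sub>2\<close> by \<open>a\<^sub>j\<^sub>+\<^sub>1(t) \<kappa>\<^sub>j\<^sub>+\<^sub>2\<close>, plus a nonnegative
  constant at \<open>j = 0\<close>. Since \<open>a\<^sub>k(t)\<close> is the mean of \<open>exp (- k \<surd>t |N|)\<close> for a standard normal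
  \<open>N\<close> (\<open>a_coeff_eq_gauss\<close>), \<open>(a\<^sub>j\<^sub>+\<^sub>1(t))\<^sub>j\<close> is itself a moment sequence, and the entrywise
  product of two moment sequences is one; the constant is a mass at \<open>0\<close>. So the criterion is
  preserved (\<open>evolved_law\<close>), and the formula for the \<open>R\<close>-transform is termwise integration of
  its power series against the normal density.

  The criterion is used in the form of the positivity condition \<open>hadamard_psd\<close>, which never
  mentions the representing measure. It holds for an infinitely divisible law because \<open>\<kappa>\<^sub>k\<close> is
  the limit of \<open>n\<close> times the \<open>k\<close>-th moment of the \<open>n\<close>-th root
  (\<open>freely_infinitely_divisible_hadamard_psd\<close>). Conversely, for a sequence \<open>\<kappa>\<close> that satisfies
  it and grows at most exponentially, an operator on a Fock space shows that the moments
  belonging to \<open>\<kappa>\<close> are positive definite (\<open>stack_moment_psd\<close>), and the moment problem on a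
  compact interval gives a law with free cumulants \<open>\<kappa>\<close> (\<open>exists_prob_with_cumulants\<close>). Applied
  to multiples of \<open>\<kappa>\<close> this also produces the roots (\<open>freely_infinitely_divisibleI\<close>). Both
  directions rest on a recursion that turns sums over noncrossing partitions into the action
  of a single operator (\<open>sum_noncrossing_partitions\<close>) and on the additivity of free cumulants
  (\<open>free_cumulant_free_convolution\<close>, \<open>is_free_convolutionI\<close>).
\<close>

section \<open>Free cumulants as weights of a stack machine\<close>

text \<open>
  Voiculescu's canonical model: on the free vector space with basis \<open>e\<^sub>0, e\<^sub>1, \<dots>\<close> the operator
  \<open>a e\<^sub>j = e\<^sub>j\<^sub>+\<^sub>1 + \<Sum>\<^sub>k \<kappa>\<^sub>k\<^sub>+\<^sub>1 e\<^sub>j\<^sub>-\<^sub>k\<close> has \<open>stack_moment \<kappa> n j\<close> as the \<open>e\<^sub>0\<close>-coefficient of \<open>a\<^sup>n e\<^sub>j\<close>.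
  Read as a stack machine, each of \<open>n\<close> new points is either pushed on a stack of height \<open>j\<close> or
  closes a block consisting of itself and the top \<open>k\<close> stack entries.
\<close>

fun stack_moment :: "(nat \<Rightarrow> real) \<Rightarrow> nat \<Rightarrow> nat \<Rightarrow> real" where
  "stack_moment \<kappa> 0 j = (if j = 0 then 1 else 0)"
| "stack_moment \<kappa> (Suc n) j =
     stack_moment \<kappa> n (Suc j) + (\<Sum>k\<le>j. \<kappa> (Suc k) * stack_moment \<kappa> n (j - k))"

text \<open>
  The partitions counted by the machine with \<open>j\<close> points on the stack: a stack entry still has
  to be closed by a later point, so no block lies inside the first \<open>j\<close> points.
\<close>

definition noncrossing_above :: "nat \<Rightarrow> nat \<Rightarrow> nat set set set" where
  "noncrossing_above j n = {\<pi> \<in> noncrossing_partitions (j + n). \<forall>B\<in>\<pi>. \<not> B \<subseteq> {..<j}}"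

lemma finite_noncrossing_above: "finite (noncrossing_above j n)"
  using finite_noncrossing_partitions by (simp add: noncrossing_above_def)

lemma noncrossing_partitionsD:
  assumes "\<pi> \<in> noncrossing_partitions n"
  shows "\<Union>\<pi> = {..<n}" "disjoint \<pi>" "{} \<notin> \<pi>" "finite \<pi>"
    "\<And>B. B \<in> \<pi> \<Longrightarrow> finite B"
    "\<And>B C a b c d. B \<in> \<pi> \<Longrightarrow> C \<in> \<pi> \<Longrightarrow> a \<in> B \<Longrightarrow> c \<in> B \<Longrightarrow> b \<in> C \<Longrightarrow> d \<in> C \<Longrightarrow>
       a < b \<Longrightarrow> b < c \<Longrightarrow> c < d \<Longrightarrow> B = C"
proof -
  show U: "\<Union>\<pi> = {..<n}" "disjoint \<pi>" "{} \<notin> \<pi>"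
    using assms by (auto simp: noncrossing_partitions_def partition_on_def)
  show "finite \<pi>" using U(1) by (metis finite_UnionD finite_lessThan)
  show "\<And>B. B \<in> \<pi> \<Longrightarrow> finite B" using U(1) by (metis Union_upper finite_lessThan finite_subset)
  show "\<And>B C a b c d. B \<in> \<pi> \<Longrightarrow> C \<in> \<pi> \<Longrightarrow> a \<in> B \<Longrightarrow> c \<in> B \<Longrightarrow> b \<in> C \<Longrightarrow> d \<in> C \<Longrightarrow>
       a < b \<Longrightarrow> b < c \<Longrightarrow> c < d \<Longrightarrow> B = C"
    using assms unfolding noncrossing_partitions_def by blast
qed

lemma noncrossing_partitionsI:
  assumes "\<Union>\<pi> = {..<n}" "\<And>B C. B \<in> \<pi> \<Longrightarrow> C \<in> \<pi> \<Longrightarrow> B \<noteq> C \<Longrightarrow> B \<inter> C = {}" "{} \<notin> \<pi>"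
    "\<And>B C a b c d. B \<in> \<pi> \<Longrightarrow> C \<in> \<pi> \<Longrightarrow> a \<in> B \<Longrightarrow> c \<in> B \<Longrightarrow> b \<in> C \<Longrightarrow> d \<in> C \<Longrightarrow>
       a < b \<Longrightarrow> b < c \<Longrightarrow> c < d \<Longrightarrow> B = C"
  shows "\<pi> \<in> noncrossing_partitions n"
  using assms unfolding noncrossing_partitions_def partition_on_def disjoint_def by blast

lemma noncrossing_same_block:
  assumes "\<pi> \<in> noncrossing_partitions n" "B \<in> \<pi>" "C \<in> \<pi>" "x \<in> B" "x \<in> C" shows "B = C"
  using noncrossing_partitionsD(2)[OF assms(1)] assms by (auto simp: disjoint_def)

text \<open>
  The increasing enumeration of the naturals outside the interval \<open>{a..a + k}\<close>. Deleting an
  interval block from a partition, or inserting one, relabels the other points by this map.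
\<close>

definition gap :: "nat \<Rightarrow> nat \<Rightarrow> nat \<Rightarrow> nat" where
  "gap a k x = (if x < a then x else x + Suc k)"

lemma inj_gap: "inj (gap a k)" by (auto simp: inj_def gap_def split: if_splits)

lemma gap_less_iff: "gap a k x < gap a k y \<longleftrightarrow> x < y"
  by (auto simp: gap_def)

lemma gap_not_in: "gap a k x \<notin> {a..a + k}" by (auto simp: gap_def)

lemma range_gap:
  assumes "x \<notin> {a..a + k}" shows "x \<in> range (gap a k)"
proof (cases "x < a")
  case True
  then have "gap a k x = x" by (simp add: gap_def)
  then show ?thesis by (metis rangeI)
next
  case False
  then have "gap a k (x - Suc k) = x" using assms by (auto simp: gap_def)
  then show ?thesis by (metis rangeI)
qed

lemma image_gap: "gap a k ` {..<a + m} = {..<a + Suc k + m} - {a..a + k}"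
proof
  show "gap a k ` {..<a + m} \<subseteq> {..<a + Suc k + m} - {a..a + k}" by (auto simp: gap_def)
  show "{..<a + Suc k + m} - {a..a + k} \<subseteq> gap a k ` {..<a + m}"
  proof
    fix x assume x: "x \<in> {..<a + Suc k + m} - {a..a + k}"
    then obtain y where y: "x = gap a k y" using range_gap[of x a k] by blast
    then have "y < a + m" using x by (auto simp: gap_def split: if_splits)
    then show "x \<in> gap a k ` {..<a + m}" using y by blast
  qed
qed

definition insert_interval :: "nat \<Rightarrow> nat \<Rightarrow> nat set set \<Rightarrow> nat set set" where
  "insert_interval a k \<pi> = insert {a..a + k} ((`) (gap a k) ` \<pi>)"

lemma interval_notin:
  assumes "{} \<notin> \<pi>" shows "{a..a + k} \<notin> (`) (gap a k) ` \<pi>"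
proof
  assume "{a..a + k} \<in> (`) (gap a k) ` \<pi>"
  then obtain B where B: "B \<in> \<pi>" "{a..a + k} = gap a k ` B" by blast
  have "a \<in> {a..a+k}" by simp
  then have "a \<in> gap a k ` B" using B(2) by simp
  then obtain b where "a = gap a k b" by blast
  then show False using gap_not_in[of a k b] by simp
qed

lemma inj_on_insert_interval:
  "inj_on (insert_interval a k) {\<pi>. {} \<notin> \<pi>}"
proof (rule inj_onI)
  fix \<pi> \<pi>' :: "nat set set" assume "\<pi> \<in> {\<pi>. {} \<notin> \<pi>}" "\<pi>' \<in> {\<pi>. {} \<notin> \<pi>}"
    and eq: "insert_interval a k \<pi> = insert_interval a k \<pi>'"
  then have "{a..a + k} \<notin> (`) (gap a k) ` \<pi>" "{a..a + k} \<notin> (`) (gap a k) ` \<pi>'"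
    using interval_notin by auto
  then have "(`) (gap a k) ` \<pi> = (`) (gap a k) ` \<pi>'"
    using eq unfolding insert_interval_def by (metis insert_ident)
  then show "\<pi> = \<pi>'"
    using inj_image_eq_iff[of "(`) (gap a k)"] inj_image_eq_iff[OF inj_gap]
    by (metis injI)
qed

text \<open>
  An interval block crosses no other block, and the relabelling is increasing, so no new
  crossing can arise. The blocks of \<open>\<pi>\<close> reach beyond \<open>a\<close>, hence after relabelling beyond
  \<open>a + k\<close>.
\<close>

lemma insert_interval_noncrossing:
  assumes "\<pi> \<in> noncrossing_above a n"
  shows "insert_interval a k \<pi> \<in> noncrossing_above (a + k) (Suc n)"
proof -
  have \<pi>: "\<pi> \<in> noncrossing_partitions (a + n)" and above: "\<And>B. B \<in> \<pi> \<Longrightarrow> \<not> B \<subseteq> {..<a}"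
    using assms by (auto simp: noncrossing_above_def)
  note D = noncrossing_partitionsD[OF \<pi>]
  let ?I = "{a..a + k}" and ?g = "gap a k"
  have Ig: "?I \<inter> ?g ` B = {}" for B using gap_not_in by fastforce
  have "insert_interval a k \<pi> \<in> noncrossing_partitions (a + k + Suc n)"
  proof (rule noncrossing_partitionsI)
    have "\<Union> (insert_interval a k \<pi>) = ?I \<union> ?g ` \<Union>\<pi>"
      by (auto simp: insert_interval_def)
    also have "\<dots> = {..<a + k + Suc n}"
      unfolding D(1) image_gap by auto
    finally show "\<Union> (insert_interval a k \<pi>) = {..<a + k + Suc n}" .
    show "{} \<notin> insert_interval a k \<pi>" using D(3) by (auto simp: insert_interval_def)
    fix B C assume BC: "B \<in> insert_interval a k \<pi>" "C \<in> insert_interval a k \<pi>"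
    { assume "B \<noteq> C"
      then show "B \<inter> C = {}"
      proof (cases "B = ?I \<or> C = ?I")
        case True
        then show ?thesis using BC Ig \<open>B \<noteq> C\<close> unfolding insert_interval_def by blast
      next
        case False
        then obtain B' C' where BC': "B' \<in> \<pi>" "B = ?g ` B'" "C' \<in> \<pi>" "C = ?g ` C'"
          using BC unfolding insert_interval_def by auto
        then have "B' \<inter> C' = {}" using \<open>B \<noteq> C\<close> noncrossing_same_block[OF \<pi>] by blast
        then show ?thesis unfolding BC' by (metis image_Int image_empty inj_gap)
      qed }
    fix w x y z assume *: "w \<in> B" "y \<in> B" "x \<in> C" "z \<in> C" "w < x" "x < y" "y < z"
    show "B = C"
    proof (cases "B = ?I")
      case True
      then have "x \<in> ?I" using * by auto
      then have "C = ?I" using BC(2) *(3) Ig unfolding insert_interval_def by blast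
      with True show ?thesis by simp
    next
      case False
      then obtain B' where B': "B' \<in> \<pi>" "B = ?g ` B'" using BC(1) unfolding insert_interval_def
        by auto
      show ?thesis
      proof (cases "C = ?I")
        case True
        then have "y \<in> ?I" using * by auto
        then show ?thesis using B'(2) *(2) Ig by blast
      next
        case False
        then obtain C' where C': "C' \<in> \<pi>" "C = ?g ` C'" using BC(2) unfolding insert_interval_def
          by auto
        obtain w' x' y' z' where "w' \<in> B'" "y' \<in> B'" "x' \<in> C'" "z' \<in> C'"
           "w = ?g w'" "x = ?g x'" "y = ?g y'" "z = ?g z'" using * B' C' by blast
        then have "B' = C'" using D(6)[OF B'(1) C'(1)] *(5-7) by (auto simp: gap_less_iff)
        then show ?thesis using B' C' by simp
      qed
    qed
  qed
  moreover have "\<not> B \<subseteq> {..<a + k}" if BI: "B \<in> insert_interval a k \<pi>" for B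
  proof (cases "B = ?I")
    case True then show ?thesis by auto
  next
    case False
    then obtain B' where B': "B' \<in> \<pi>" "B = ?g ` B'" using BI False unfolding insert_interval_def
      by blast
    then obtain x where "x \<in> B'" "a \<le> x" using above[OF B'(1)]
      by (meson lessThan_iff not_less subsetI)
    then have "?g x \<in> B" "?g x \<ge> a + k" using B' by (auto simp: gap_def)
    then show ?thesis by (metis lessThan_iff not_less subsetD)
  qed
  ultimately show ?thesis by (simp add: noncrossing_above_def)
qed

text \<open>
  Look at the block of the point \<open>j\<close>. If it reaches beyond \<open>j\<close>, the point was pushed.
  Otherwise \<open>j\<close> is its maximum, and the block is an interval: a point skipped by it would lie
  in a block that must reach beyond \<open>j\<close> and would therefore cross it.
\<close>

lemma noncrossing_above_Suc:
  "noncrossing_above j (Suc n) = noncrossing_above (Suc j) n \<union>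
     (\<Union>k\<le>j. insert_interval (j - k) k ` noncrossing_above (j - k) n)" (is "?L = ?R1 \<union> ?R2")
proof
  have "?R1 \<subseteq> ?L"
  proof
    fix \<pi> assume p: "\<pi> \<in> ?R1"
    have "\<not> B \<subseteq> {..<j}" if "B \<in> \<pi>" for B
    proof
      assume "B \<subseteq> {..<j}"
      then have "B \<subseteq> {..<Suc j}" by auto
      then show False using p that by (simp add: noncrossing_above_def)
    qed
    then show "\<pi> \<in> ?L" using p by (auto simp: noncrossing_above_def)
  qed
  moreover have "?R2 \<subseteq> ?L"
  proof -
    have "insert_interval (j - k) k \<pi> \<in> ?L" if "k \<le> j" "\<pi> \<in> noncrossing_above (j - k) n" for k \<pi>
      using insert_interval_noncrossing[OF that(2), of k] that(1) by simp
    then show ?thesis by blast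
  qed
  ultimately show "?R1 \<union> ?R2 \<subseteq> ?L" by simp
  show "?L \<subseteq> ?R1 \<union> ?R2"
  proof
    fix \<pi> assume "\<pi> \<in> ?L"
    then have \<pi>: "\<pi> \<in> noncrossing_partitions (j + Suc n)" and above: "\<And>B. B \<in> \<pi> \<Longrightarrow> \<not> B \<subseteq> {..<j}"
      by (auto simp: noncrossing_above_def)
    note D = noncrossing_partitionsD[OF \<pi>]
    show "\<pi> \<in> ?R1 \<union> ?R2"
    proof (cases "\<forall>B\<in>\<pi>. \<not> B \<subseteq> {..<Suc j}")
      case True
      then show ?thesis using \<pi> by (auto simp: noncrossing_above_def)
    next
      case False
      then obtain A where A: "A \<in> \<pi>" "A \<subseteq> {..<Suc j}" by blast
      then have jA: "j \<in> A" using above[OF A(1)] by (auto simp: subset_eq less_Suc_eq)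
      define a where "a = Min A"
      define k where "k = j - a"
      have finA: "finite A" using A(1) D(5) by blast
      have aA: "a \<in> A" unfolding a_def using finA jA by (intro Min_in) auto
      have aj: "a \<le> j" unfolding a_def using finA jA by simp
      have "A = {a..j}"
      proof
        show "A \<subseteq> {a..j}" using A(2) finA unfolding a_def by auto
        show "{a..j} \<subseteq> A"
        proof
          fix x assume x: "x \<in> {a..j}"
          show "x \<in> A"
          proof (rule ccontr)
            assume xA: "x \<notin> A"
            then have ax: "a < x" "x < j" using x aA jA by (auto simp: order_less_le)
            have "x \<in> \<Union>\<pi>" using D(1) ax by auto
            then obtain C where C: "C \<in> \<pi>" "x \<in> C" by blast
            obtain y where y: "y \<in> C" "j \<le> y" using above[OF C(1)]
              by (meson lessThan_iff not_less subsetI)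
            have "C \<noteq> A" using xA C by blast
            then have "y \<noteq> j" using noncrossing_same_block[OF \<pi> C(1) A(1) y(1)] jA by blast
            then have "A = C" using D(6)[OF A(1) C(1) aA jA C(2) y(1)] ax y by auto
            with \<open>C \<noteq> A\<close> show False by simp
          qed
        qed
      qed
      then have Aeq: "A = {a..a + k}" using aj k_def by simp
      have ak: "a = j - k" "k \<le> j" using aj k_def by auto
      let ?g = "gap a k"
      define \<rho> where "\<rho> = (\<lambda>B. ?g -` B) ` (\<pi> - {A})"
      have img: "?g ` (?g -` B) = B" if "B \<in> \<pi> - {A}" for B
      proof -
        have "B \<subseteq> range ?g"
        proof
          fix x assume "x \<in> B"
          then have "x \<notin> A" using noncrossing_same_block[OF \<pi>, of B A x] that A(1) by blast
          then show "x \<in> range ?g" using range_gap Aeq by blast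
        qed
        then show ?thesis by blast
      qed
      have "insert_interval a k \<rho> = \<pi>"
      proof -
        have "(`) ?g ` \<rho> = (\<lambda>B. B) ` (\<pi> - {A})"
          unfolding \<rho>_def image_image by (rule image_cong[OF refl img])
        then show ?thesis unfolding insert_interval_def using A(1) Aeq by auto
      qed
      moreover have "\<rho> \<in> noncrossing_above a n"
      proof -
        have "\<rho> \<in> noncrossing_partitions (a + n)"
        proof (rule noncrossing_partitionsI)
          have "?g -` A = {}" using Aeq gap_not_in[of a k] by blast
          then have "\<Union>\<rho> = ?g -` \<Union>\<pi>" unfolding \<rho>_def by blast
          also have "\<dots> = {..<a + n}" unfolding D(1) using ak
            by (auto simp: gap_def split: if_splits)
          finally show "\<Union>\<rho> = {..<a + n}" .
          show "{} \<notin> \<rho>"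
          proof
            assume "{} \<in> \<rho>"
            then obtain B where B: "B \<in> \<pi> - {A}" "?g -` B = {}" unfolding \<rho>_def by blast
            then have "B = {}" using img[OF B(1)] by simp
            then show False using B(1) D(3) by blast
          qed
          fix B C assume "B \<in> \<rho>" "C \<in> \<rho>"
          then obtain B' C' where B': "B' \<in> \<pi> - {A}" "B = ?g -` B'" and C': "C' \<in> \<pi> - {A}" "C
            = ?g -` C'"
            unfolding \<rho>_def by blast
          { assume "B \<noteq> C"
            then show "B \<inter> C = {}" using B' C' noncrossing_same_block[OF \<pi>] by blast }
          fix w x y z assume *: "w \<in> B" "y \<in> B" "x \<in> C" "z \<in> C" "w < x" "x < y" "y < z"
          have "B' = C'"
          proof (rule D(6))
            show "B' \<in> \<pi>" "C' \<in> \<pi>" using B' C' by simp_all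
            show "?g w \<in> B'" "?g y \<in> B'" "?g x \<in> C'" "?g z \<in> C'" using * B' C' by simp_all
            show "?g w < ?g x" "?g x < ?g y" "?g y < ?g z" using * by (simp_all add: gap_less_iff)
          qed
          then show "B = C" using B' C' by simp
        qed
        moreover have "\<not> B \<subseteq> {..<a}" if "B \<in> \<rho>" for B
        proof -
          from \<open>B \<in> \<rho>\<close> obtain B' where B': "B' \<in> \<pi> - {A}" "B = ?g -` B'" unfolding \<rho>_def by blast
          then obtain y where y: "y \<in> B'" "j \<le> y" using above[of B'] B'(1)
            by (meson DiffD1 lessThan_iff not_less subsetI)
          from y(1) have "y \<in> ?g ` B" using img[OF B'(1)] B'(2) by simp
          then obtain x where x: "x \<in> B" "y = ?g x" by blast
          then have "\<not> x < a" using y ak by (auto simp: gap_def split: if_splits)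
          then show ?thesis using x by blast
        qed
        ultimately show ?thesis by (simp add: noncrossing_above_def)
      qed
      ultimately have "\<pi> \<in> insert_interval (j - k) k ` noncrossing_above (j - k) n"
        unfolding ak(1)[symmetric] by (metis image_eqI)
      then show ?thesis using ak(2) by (intro UnI2 UN_I[of k]) auto
    qed
  qed
qed

lemma noncrossing_above_0: "noncrossing_above j 0 = (if j = 0 then {{}} else {})"
proof -
  have "\<pi> = {}" if p: "\<pi> \<in> noncrossing_above j 0" for \<pi>
  proof (rule equals0I)
    fix B assume "B \<in> \<pi>"
    then have "\<not> B \<subseteq> {..<j}" using p by (auto simp: noncrossing_above_def)
    moreover have "\<Union>\<pi> = {..<j}" using p noncrossing_partitionsD(1)[of \<pi> j]
      by (simp add: noncrossing_above_def)
    ultimately show False using \<open>B \<in> \<pi>\<close> by blast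
  qed
  moreover have "{} \<in> noncrossing_above j 0 \<longleftrightarrow> j = 0"
    by (auto simp: noncrossing_above_def noncrossing_partitions_def partition_on_def)
  ultimately show ?thesis by auto
qed

lemma prod_insert_interval:
  assumes "finite \<pi>" "{} \<notin> \<pi>"
  shows "(\<Prod>B\<in>insert_interval a k \<pi>. \<kappa> (card B)) = \<kappa> (Suc k) * (\<Prod>B\<in>\<pi>. \<kappa> (card B) :: real)"
proof -
  have inj: "inj_on ((`) (gap a k)) \<pi>"
    by (auto intro!: inj_onI simp: inj_image_eq_iff[OF inj_gap])
  have "(\<Prod>B\<in>insert_interval a k \<pi>. \<kappa> (card B)) =
      \<kappa> (card {a..a + k}) * (\<Prod>B\<in>(`) (gap a k) ` \<pi>. \<kappa> (card B))"
    unfolding insert_interval_def using interval_notin[OF assms(2)] assms(1)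
      by (subst prod.insert) auto
  also have "(\<Prod>B\<in>(`) (gap a k) ` \<pi>. \<kappa> (card B)) = (\<Prod>B\<in>\<pi>. \<kappa> (card B))"
    by (subst prod.reindex[OF inj]) (simp add: card_image[OF inj_on_subset[OF inj_gap subset_UNIV]])
  finally show ?thesis by simp
qed

text \<open>
  The case distinction of \<open>noncrossing_above_Suc\<close> is disjoint, because different \<open>k\<close> produce
  different blocks containing \<open>j\<close>; so the weighted sums satisfy the recursion of the machine.
\<close>

lemma sum_noncrossing_above:
  "(\<Sum>\<pi>\<in>noncrossing_above j n. \<Prod>B\<in>\<pi>. \<kappa> (card B)) = stack_moment \<kappa> n j"
proof (induction n arbitrary: j)
  case 0
  then show ?case by (simp add: noncrossing_above_0)
next
  case (Suc n)
  let ?w = "\<lambda>\<pi>. \<Prod>B\<in>\<pi>. \<kappa> (card B)"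
  let ?P = "\<lambda>k. insert_interval (j - k) k ` noncrossing_above (j - k) n"
  have part: "\<pi> \<in> noncrossing_partitions (a + n)" "finite \<pi>" "{} \<notin> \<pi>"
    if "\<pi> \<in> noncrossing_above a n" for a \<pi> n
    using that noncrossing_partitionsD[of \<pi> "a + n"] by (simp_all add: noncrossing_above_def)
  have block: "{j - k..j} \<in> \<pi>" if "k \<le> j" "\<pi> \<in> ?P k" for k \<pi>
    using that by (auto simp: insert_interval_def)
  have sub: "?P k \<subseteq> noncrossing_above j (Suc n)" if "k \<le> j" for k
    using that noncrossing_above_Suc by blast
  have disj1: "noncrossing_above (Suc j) n \<inter> (\<Union>k\<le>j. ?P k) = {}"
  proof (rule equals0I)
    fix \<pi> assume "\<pi> \<in> noncrossing_above (Suc j) n \<inter> (\<Union>k\<le>j. ?P k)"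
    then obtain k where "k \<le> j" "\<pi> \<in> ?P k" "\<pi> \<in> noncrossing_above (Suc j) n" by blast
    then have "{j - k..j} \<in> \<pi>" "\<And>B. B \<in> \<pi> \<Longrightarrow> \<not> B \<subseteq> {..<Suc j}"
      using block by (auto simp: noncrossing_above_def)
    then show False by (metis atLeastAtMost_iff lessThan_Suc_atMost atMost_iff subsetI)
  qed
  have disj2: "?P k \<inter> ?P l = {}" if "k \<le> j" "l \<le> j" "k \<noteq> l" for k l
  proof (rule equals0I)
    fix \<pi> assume \<pi>: "\<pi> \<in> ?P k \<inter> ?P l"
    then have b: "{j - k..j} \<in> \<pi>" "{j - l..j} \<in> \<pi>" using block that by blast+
    have "\<pi> \<in> noncrossing_partitions (j + Suc n)"
      using sub[OF that(1)] \<pi> by (auto simp: noncrossing_above_def)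
    then have "{j - k..j} = {j - l..j}" using b by (rule noncrossing_same_block[where x = j]) auto
    then have "j - k = j - l" by (simp add: Icc_eq_Icc)
    then show False using that by simp
  qed
  have "(\<Sum>\<pi>\<in>noncrossing_above j (Suc n). ?w \<pi>) =
      (\<Sum>\<pi>\<in>noncrossing_above (Suc j) n. ?w \<pi>) + (\<Sum>\<pi>\<in>(\<Union>k\<le>j. ?P k). ?w \<pi>)"
    unfolding noncrossing_above_Suc
    by (rule sum.union_disjoint) (use disj1 finite_noncrossing_above in auto)
  also have "(\<Sum>\<pi>\<in>(\<Union>k\<le>j. ?P k). ?w \<pi>) = (\<Sum>k\<le>j. \<Sum>\<pi>\<in>?P k. ?w \<pi>)"
    by (rule sum.UNION_disjoint) (use disj2 finite_noncrossing_above in auto)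
  also have "\<dots> = (\<Sum>k\<le>j. \<kappa> (Suc k) * stack_moment \<kappa> n (j - k))"
  proof (rule sum.cong[OF refl])
    fix k
    have "inj_on (insert_interval (j - k) k) (noncrossing_above (j - k) n)"
      by (rule inj_on_subset[OF inj_on_insert_interval]) (use part in auto)
    then have "(\<Sum>\<pi>\<in>?P k. ?w \<pi>) = (\<Sum>\<pi>\<in>noncrossing_above (j - k) n. ?w (insert_interval (j - k) k \<pi>))"
      by (simp add: sum.reindex)
    also have "\<dots> = (\<Sum>\<pi>\<in>noncrossing_above (j - k) n. \<kappa> (Suc k) * ?w \<pi>)"
      by (rule sum.cong[OF refl], rule prod_insert_interval) (use part in simp_all)
    finally show "(\<Sum>\<pi>\<in>?P k. ?w \<pi>) = \<kappa> (Suc k) * stack_moment \<kappa> n (j - k)"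
      by (simp add: sum_distrib_left[symmetric] Suc.IH)
  qed
  finally show ?case by (simp add: Suc.IH)
qed

lemma sum_noncrossing_partitions:
  "(\<Sum>\<pi>\<in>noncrossing_partitions n. \<Prod>B\<in>\<pi>. \<kappa> (card B)) = stack_moment \<kappa> n 0"
proof -
  have "noncrossing_above 0 n = noncrossing_partitions n"
    using noncrossing_partitionsD(3) by (fastforce simp: noncrossing_above_def)
  then show ?thesis using sum_noncrossing_above[of \<kappa> 0 n] by simp
qed

lemma noncrossing_top: "n \<ge> 1 \<Longrightarrow> {{..<n}} \<in> noncrossing_partitions n"
  by (auto simp: noncrossing_partitions_def partition_on_def lessThan_empty_iff dest: sym)

lemma noncrossing_nontop_card:
  assumes "\<pi> \<in> noncrossing_partitions n" "\<pi> \<noteq> {{..<n}}" "B \<in> \<pi>"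
  shows "card B < n" "\<exists>C\<in>\<pi>. C \<noteq> B"
proof -
  note D = noncrossing_partitionsD[OF assms(1)]
  show ex: "\<exists>C\<in>\<pi>. C \<noteq> B"
  proof (rule ccontr)
    assume "\<not> ?thesis"
    then have "\<pi> = {B}" using assms(3) by blast
    then show False using D(1) assms(2) by simp
  qed
  then obtain C where C: "C \<in> \<pi>" "C \<noteq> B" by blast
  obtain x where x: "x \<in> C" using C D(3) by (metis equals0I)
  then have "x \<notin> B" "x \<in> {..<n}" using noncrossing_same_block[OF assms(1) C(1) assms(3)] C D(1)
    by auto
  then have "B \<subset> {..<n}" using D(1) assms(3) by blast
  then have "card B < card {..<n}" by (rule psubset_card_mono[OF finite_lessThan])
  then show "card B < n" by simp
qed

lemma moment_eq_stack_moment: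
  assumes "n \<ge> 1" shows "moment \<mu> n = stack_moment (free_cumulant \<mu>) n 0"
  using moment_cumulant[OF assms] sum_noncrossing_partitions by metis

lemma sum_noncrossing_split:
  assumes "n \<ge> 1"
  shows "stack_moment \<kappa> n 0 = \<kappa> n + (\<Sum>\<pi>\<in>noncrossing_partitions n - {{{..<n}}}. \<Prod>B\<in>\<pi>. \<kappa> (card B))"
  unfolding sum_noncrossing_partitions[symmetric]
  by (subst sum.remove[OF finite_noncrossing_partitions noncrossing_top[OF assms]]) simp

text \<open>
  The one-block partition contributes \<open>\<kappa> n\<close> to the \<open>n\<close>-th moment, and all other partitions
  involve only earlier cumulants.
\<close>

lemma stack_moment_determines:
  assumes eq: "\<And>n. n \<ge> 1 \<Longrightarrow> stack_moment \<kappa> n 0 = stack_moment \<kappa>' n 0" and "n \<ge> 1"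
  shows "\<kappa> n = \<kappa>' n"
  using \<open>n \<ge> 1\<close>
proof (induction n rule: less_induct)
  case (less n)
  have "(\<Sum>\<pi>\<in>noncrossing_partitions n - {{{..<n}}}. \<Prod>B\<in>\<pi>. \<kappa> (card B)) =
        (\<Sum>\<pi>\<in>noncrossing_partitions n - {{{..<n}}}. \<Prod>B\<in>\<pi>. \<kappa>' (card B))"
  proof (intro sum.cong prod.cong refl)
    fix \<pi> B assume p: "\<pi> \<in> noncrossing_partitions n - {{{..<n}}}" "B \<in> \<pi>"
    then have "card B < n" using noncrossing_nontop_card(1) by blast
    moreover have "B \<noteq> {}" "finite B" using p noncrossing_partitionsD(3,5) by blast+
    then have "card B \<ge> 1" by (simp add: Suc_leI card_gt_0_iff)
    ultimately show "\<kappa> (card B) = \<kappa>' (card B)" using less.IH by blast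
  qed
  then show ?case using sum_noncrossing_split[OF less.prems] eq[OF less.prems] by simp
qed

lemma free_cumulant_eqI:
  assumes "\<And>n. n \<ge> 1 \<Longrightarrow> moment \<mu> n = stack_moment \<kappa> n 0" "n \<ge> 1"
  shows "free_cumulant \<mu> n = \<kappa> n"
  by (rule stack_moment_determines[OF _ assms(2)]) (metis moment_eq_stack_moment assms(1))

lemma stack_moment_cong:
  assumes "\<And>n. n \<ge> 1 \<Longrightarrow> \<kappa> n = \<kappa>' n"
  shows "stack_moment \<kappa> n j = stack_moment \<kappa>' n j"
  by (induction n arbitrary: j) (auto simp: assms)

lemma stack_moment_Suc_0: "stack_moment \<kappa> (Suc 0) j = \<kappa> (Suc j)"
proof -
  have "(\<Sum>k\<le>j. \<kappa> (Suc k) * (if j - k = 0 then 1 else 0)) = (\<Sum>k\<in>{j}. \<kappa> (Suc k) * (if j - k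
    = 0 then 1 else 0))"
    by (rule sum.mono_neutral_right) auto
  then show ?thesis by simp
qed

section \<open>Exponential bounds for moments and free cumulants\<close>

text \<open>
  With stack weight \<open>2 C\<close> per entry the pops from height \<open>j\<close> form a geometric series of ratio
  \<open>1/2\<close>, so pushing and popping each cost at most \<open>2 C\<close>.
\<close>

lemma stack_moment_bound:
  assumes \<kappa>: "\<And>n. n \<ge> 1 \<Longrightarrow> \<bar>\<kappa> n\<bar> \<le> C ^ n" and C: "C > 0"
  shows "\<bar>stack_moment \<kappa> n j\<bar> \<le> (4 * C) ^ n * (2 * C) ^ j"
proof (induction n arbitrary: j)
  case 0
  then show ?case using C by auto
next
  case (Suc n)
  let ?A = "(4 * C) ^ n"
  have "\<bar>\<Sum>k\<le>j. \<kappa> (Suc k) * stack_moment \<kappa> n (j - k)\<bar> \<le>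
      (\<Sum>k\<le>j. \<bar>\<kappa> (Suc k)\<bar> * \<bar>stack_moment \<kappa> n (j - k)\<bar>)"
    by (rule order_trans[OF sum_abs]) (simp add: abs_mult)
  also have "\<dots> \<le> (\<Sum>k\<le>j. C ^ Suc k * (?A * (2 * C) ^ (j - k)))"
    by (intro sum_mono mult_mono Suc.IH \<kappa>) (use C in auto)
  also have "\<dots> = (\<Sum>k\<le>j. ?A * C * (2 * C) ^ j * (1 / 2) ^ k)"
  proof (rule sum.cong[OF refl])
    fix k assume "k \<in> {..j}"
    then have "(2 * C) ^ j = (2 * C) ^ (j - k) * (2 * C) ^ k"
      using power_add[of "2 * C" "j - k" k] by simp
    moreover have "C ^ k = (2 * C) ^ k * (1 / 2) ^ k" unfolding power_mult_distrib[symmetric]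
      by simp
    ultimately show "C ^ Suc k * (?A * (2 * C) ^ (j - k)) = ?A * C * (2 * C) ^ j * (1 / 2) ^ k"
      by (simp only: power_Suc mult_ac)
  qed
  also have "\<dots> = ?A * C * (2 * C) ^ j * (\<Sum>k\<le>j. (1 / 2) ^ k)" by (simp add: sum_distrib_left)
  also have "\<dots> \<le> ?A * C * (2 * C) ^ j * 2"
  proof (rule mult_left_mono)
    have "(\<Sum>k\<le>j. (1 / 2) ^ k :: real) = 2 - (1/2) ^ j" by (induction j) auto
    then show "(\<Sum>k\<le>j. (1 / 2) ^ k :: real) \<le> 2" by simp
  qed (use C in auto)
  finally have "\<bar>stack_moment \<kappa> (Suc n) j\<bar> \<le> ?A * (2 * C) ^ Suc j + ?A * C * (2 * C) ^ j * 2"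
    using Suc.IH[of "Suc j"] abs_triangle_ineq[of "stack_moment \<kappa> n (Suc j)"]
    unfolding stack_moment.simps by (meson add_mono order_trans)
  also have "\<dots> = (4 * C) ^ Suc n * (2 * C) ^ j" by (simp add: algebra_simps)
  finally show ?case .
qed

lemma sum_inverse_square_le: "(\<Sum>k\<le>n. 1 / (real k + 1)\<^sup>2) \<le> 2 - 1 / (real n + 1)"
proof (induction n)
  case (Suc n)
  have "1 / (real n + 2)\<^sup>2 \<le> 1 / (real n + 1) - 1 / (real n + 2)"
  proof -
    have "1 / (real n + 2)\<^sup>2 \<le> 1 / ((real n + 1) * (real n + 2))"
      by (rule divide_left_mono) (auto simp: power2_eq_square intro!: mult_right_mono)
    also have "\<dots> = 1 / (real n + 1) - 1 / (real n + 2)" by (simp add: field_simps)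
    finally show ?thesis .
  qed
  then show ?case using Suc by (simp add: add.commute)
qed simp

text \<open>
  The sequence \<open>1 / (k + 1)\<^sup>2\<close> is, up to a constant, stable under convolution. This replaces
  the generating function of the Catalan numbers in \<open>cumulant_bound\<close>.
\<close>

lemma convolution_inverse_square_le:
  "(\<Sum>k\<le>n. 1 / (real k + 1)\<^sup>2 * (1 / (real (n - k) + 1)\<^sup>2)) \<le> 8 / (real n + 2)\<^sup>2"
proof -
  let ?f = "\<lambda>k. 1 / (real k + 1)\<^sup>2"
  have "?f k * ?f (n - k) \<le> 2 / (real n + 2)\<^sup>2 * (?f k + ?f (n - k))" if "k \<le> n" for k
  proof -
    define x y where "x = 1 / (real k + 1)" and "y = 1 / (real (n - k) + 1)"
    have "x * y * (real n + 2) = x + y"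
      using that by (simp add: x_def y_def of_nat_diff field_simps)
    then have "x\<^sup>2 * y\<^sup>2 * (real n + 2)\<^sup>2 = (x + y)\<^sup>2"
      by (metis power_mult_distrib)
    also have "\<dots> \<le> 2 * (x\<^sup>2 + y\<^sup>2)" using zero_le_power2[of "x - y"]
      by (simp add: power2_eq_square algebra_simps)
    finally have "x\<^sup>2 * y\<^sup>2 \<le> 2 / (real n + 2)\<^sup>2 * (x\<^sup>2 + y\<^sup>2)"
      by (simp add: field_simps)
    then show ?thesis by (simp add: x_def y_def power_divide)
  qed
  then have "(\<Sum>k\<le>n. ?f k * ?f (n - k)) \<le> (\<Sum>k\<le>n. 2 / (real n + 2)\<^sup>2 * (?f k + ?f (n - k)))"
    by (intro sum_mono) auto
  also have "\<dots> = 2 / (real n + 2)\<^sup>2 * ((\<Sum>k\<le>n. ?f k) + (\<Sum>k\<le>n. ?f (n - k)))"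
    unfolding sum_distrib_left[symmetric] sum.distrib ..
  also have "(\<Sum>k\<le>n. ?f (n - k)) = (\<Sum>k\<le>n. ?f k)"
    by (rule sum.reindex_bij_witness[of _ "\<lambda>k. n - k" "\<lambda>k. n - k"]) auto
  also have "2 / (real n + 2)\<^sup>2 * ((\<Sum>k\<le>n. ?f k) + (\<Sum>k\<le>n. ?f k)) \<le> 2 / (real n + 2)\<^sup>2 * (2 + 2)"
  proof (intro mult_left_mono add_mono)
    have "(\<Sum>k\<le>n. ?f k) \<le> 2" using sum_inverse_square_le[of n] by (rule order_trans) simp
    then show "(\<Sum>k\<le>n. ?f k) \<le> 2" "(\<Sum>k\<le>n. ?f k) \<le> 2" by auto
  qed simp
  finally show ?thesis by simp
qed

text \<open>
  The recursion of \<open>stack_moment\<close> can be solved for the value at height \<open>j + 1\<close>, and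
  \<open>\<kappa> (j + 1)\<close> is the value with \<open>n = 1\<close> at height \<open>j\<close>. So bounds for the values at heights up
  to \<open>j\<close> propagate upwards together with bounds for the cumulants; the resulting quadratic
  recursion has the majorant \<open>(16 K)\<^sup>j / (j + 1)\<^sup>2\<close>.
\<close>

lemma cumulant_bound:
  assumes m: "\<And>n. n \<ge> 1 \<Longrightarrow> \<bar>stack_moment \<kappa> n 0\<bar> \<le> K ^ n" and K: "K \<ge> 1"
  shows "n \<ge> 1 \<Longrightarrow> \<bar>\<kappa> n\<bar> \<le> (16 * K\<^sup>2) ^ n"
proof -
  \<comment> \<open>\<open>16 K\<close> is the factor \<open>8\<close> of the convolution bound, times \<open>2 K\<close> from the recursion\<close>
  define q where "q j = (16 * K) ^ j / (real j + 1)\<^sup>2" for j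
  have q0: "q j \<ge> 0" for j using K by (simp add: q_def)
  have main: "\<bar>stack_moment \<kappa> n j\<bar> \<le> q j * K ^ n" for n j
  proof (induction j arbitrary: n rule: less_induct)
    case (less j)
    show ?case
    proof (cases j)
      case 0
      show ?thesis
      proof (cases n)
        case 0
        then show ?thesis using \<open>j = 0\<close> by (simp add: q_def)
      next
        case (Suc n')
        then show ?thesis using m[of n] \<open>j = 0\<close> by (simp add: q_def)
      qed
    next
      case (Suc i)
      have \<kappa>: "\<bar>\<kappa> (Suc k)\<bar> \<le> K * q k" if "k \<le> i" for k
        using less.IH[of k "Suc 0"] that Suc by (simp only: stack_moment_Suc_0) (simp add:
          mult.commute)
      have "stack_moment \<kappa> n j = stack_moment \<kappa> (Suc n) i - (\<Sum>k\<le>i. \<kappa> (Suc k) * stack_moment \<kappa> n (i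
        - k))"
        by (simp add: Suc)
      then have "\<bar>stack_moment \<kappa> n j\<bar> \<le> \<bar>stack_moment \<kappa> (Suc n) i\<bar> +
          \<bar>\<Sum>k\<le>i. \<kappa> (Suc k) * stack_moment \<kappa> n (i - k)\<bar>" by linarith
      also have "\<dots> \<le> q i * K ^ Suc n + (\<Sum>k\<le>i. (K * q k) * (q (i - k) * K ^ n))"
      proof (rule add_mono)
        show "\<bar>stack_moment \<kappa> (Suc n) i\<bar> \<le> q i * K ^ Suc n" using less.IH[of i "Suc n"] Suc by simp
        have "\<bar>\<Sum>k\<le>i. \<kappa> (Suc k) * stack_moment \<kappa> n (i - k)\<bar> \<le>
          (\<Sum>k\<le>i. \<bar>\<kappa> (Suc k)\<bar> * \<bar>stack_moment \<kappa> n (i - k)\<bar>)"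
          by (rule order_trans[OF sum_abs]) (simp add: abs_mult)
        also have "\<dots> \<le> (\<Sum>k\<le>i. (K * q k) * (q (i - k) * K ^ n))"
          by (intro sum_mono mult_mono less.IH \<kappa>) (use K q0 Suc in auto)
        finally show "\<bar>\<Sum>k\<le>i. \<kappa> (Suc k) * stack_moment \<kappa> n (i - k)\<bar> \<le> (\<Sum>k\<le>i. (K * q k) * (q (i - k)
          * K ^ n))" .
      qed
      also have "\<dots> = K ^ Suc n * (q i + (\<Sum>k\<le>i. q k * q (i - k)))"
        by (simp add: sum_distrib_left algebra_simps)
      also have "\<dots> \<le> K ^ Suc n * (2 * (\<Sum>k\<le>i. q k * q (i - k)))"
      proof (rule mult_left_mono)
        have "q i = q 0 * q (i - 0)" by (simp add: q_def)
        also have "\<dots> \<le> (\<Sum>k\<le>i. q k * q (i - k))"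
          by (rule member_le_sum) (use q0 in auto)
        finally show "q i + (\<Sum>k\<le>i. q k * q (i - k)) \<le> 2 * (\<Sum>k\<le>i. q k * q (i - k))" by simp
      qed (use K in auto)
      also have "(\<Sum>k\<le>i. q k * q (i - k)) =
          (16 * K) ^ i * (\<Sum>k\<le>i. 1 / (real k + 1)\<^sup>2 * (1 / (real (i - k) + 1)\<^sup>2))"
        unfolding sum_distrib_left q_def by (rule sum.cong) (auto simp flip: power_add simp:
          field_simps)
      also have "K ^ Suc n * (2 * \<dots>) \<le> K ^ Suc n * (2 * ((16 * K) ^ i * (8 / (real i + 2)\<^sup>2)))"
        by (intro mult_left_mono convolution_inverse_square_le) (use K in auto)
      also have "\<dots> = q j * K ^ n" by (simp add: q_def Suc field_simps)
      finally show ?thesis .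
    qed
  qed
  assume "n \<ge> 1"
  then obtain j where j: "n = Suc j" by (cases n) auto
  have "\<bar>\<kappa> n\<bar> \<le> q j * K" using main[of "Suc 0" j] j by (simp only: stack_moment_Suc_0) simp
  also have "\<dots> \<le> (16 * K) ^ j * K"
  proof (rule mult_right_mono)
    have "(16 * K) ^ j * 1 \<le> (16 * K) ^ j * (real j + 1)\<^sup>2"
      by (rule mult_left_mono) (use K in auto)
    then show "q j \<le> (16 * K) ^ j" by (simp add: q_def divide_le_eq)
  qed (use K in auto)
  also have "\<dots> \<le> (16 * K\<^sup>2) ^ j * (16 * K\<^sup>2)"
    using K by (intro mult_mono power_mono) (auto simp: power2_eq_square)
  finally show "\<bar>\<kappa> n\<bar> \<le> (16 * K\<^sup>2) ^ n" by (simp add: j mult.commute)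
qed

section \<open>Free pairs of variables and additivity of free cumulants\<close>

fun leading_run :: "'i \<Rightarrow> 'i list \<Rightarrow> nat" where
  "leading_run i v = length (takeWhile ((=) i) v)"

text \<open>
  The free product of copies of the canonical model, one for each letter. Its basis is indexed
  by words, letter \<open>i\<close> acts on the leading run of \<open>i\<close> only, and \<open>pair_state \<kappa> w v\<close> is the
  coefficient of the empty word after the letters of \<open>w\<close> have acted on \<open>v\<close> from left to right.
  The operators are not selfadjoint, and this makes freeness a matter of following the first
  letter of a word.
\<close>

fun pair_state :: "('i \<Rightarrow> nat \<Rightarrow> real) \<Rightarrow> 'i list \<Rightarrow> 'i list \<Rightarrow> real" where
  "pair_state \<kappa> [] v = (if v = [] then 1 else 0)"
| "pair_state \<kappa> (i # w) v =
     pair_state \<kappa> w (i # v) + (\<Sum>k\<le>leading_run i v. \<kappa> i (Suc k) * pair_state \<kappa> w (drop k v))"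

lemma leading_run_replicate_append:
  assumes "v = [] \<or> hd v \<noteq> i" shows "leading_run i (replicate k i @ v) = k"
  using assms by (induction k) (cases v; auto)+

lemma pair_state_marginal:
  "pair_state \<kappa> (replicate n i) (replicate j i) = stack_moment (\<kappa> i) n j"
proof (induction n arbitrary: j)
  case (Suc n)
  have "leading_run i (replicate j i) = j" using leading_run_replicate_append[of "[]" i j] by simp
  then show ?case using Suc[of "Suc j"] by (simp add: Suc)
qed simp

text \<open>
  The coefficient of \<open>e\<^sub>k\<close> in \<open>a\<^sup>e e\<^sub>0\<close> for the one-variable operator \<open>a\<close>. The test \<open>k \<le> e\<close>
  switches off the popping term for \<open>k = e + 1\<close>, where truncated subtraction would leave one
  summand.
\<close>

fun vacuum_coeff :: "(nat \<Rightarrow> real) \<Rightarrow> nat \<Rightarrow> nat \<Rightarrow> real" where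
  "vacuum_coeff \<kappa> 0 k = (if k = 0 then 1 else 0)"
| "vacuum_coeff \<kappa> (Suc e) k = (if k = 0 then 0 else vacuum_coeff \<kappa> e (k - 1)) +
     (\<Sum>l\<le>e - k. if k \<le> e then \<kappa> (Suc l) * vacuum_coeff \<kappa> e (k + l) else 0)"

lemma sum_triangle_flip:
  "(\<Sum>k\<le>e. \<Sum>l\<le>k. g k l) = (\<Sum>j\<le>e. \<Sum>l\<le>e - j. g (j + l) l :: 'a :: comm_monoid_add)" for e :: nat
proof -
  have "(\<Sum>k\<le>e. \<Sum>l\<le>k. g k l) = (\<Sum>(k, l)\<in>(SIGMA k:{..e}. {..k}). g k l)"
    by (rule sum.Sigma) auto
  also have "\<dots> = (\<Sum>(j, l)\<in>(SIGMA j:{..e}. {..e - j}). g (j + l) l)"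
    by (rule sum.reindex_bij_witness[of _ "\<lambda>(j, l). (j + l, l)" "\<lambda>(k, l). (k - l, l)"]) auto
  also have "\<dots> = (\<Sum>j\<le>e. \<Sum>l\<le>e - j. g (j + l) l)"
    by (rule sum.Sigma[symmetric]) auto
  finally show ?thesis .
qed

text \<open>
  A run of equal letters acting on a word that starts with another letter sees only what it
  has pushed itself, so it acts as on the vacuum.
\<close>

lemma pair_state_run:
  assumes "v = [] \<or> hd v \<noteq> i"
  shows "pair_state \<kappa> (replicate e i @ w) v =
    (\<Sum>k\<le>e. vacuum_coeff (\<kappa> i) e k * pair_state \<kappa> w (replicate k i @ v))"
proof (induction e arbitrary: w)
  case (Suc e)
  let ?c = "vacuum_coeff (\<kappa> i)" and ?f = "\<lambda>k. pair_state \<kappa> w (replicate k i @ v)"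
  have drop: "drop l (replicate k i @ v) = replicate (k - l) i @ v" if "l \<le> k" for k l
    using that by simp
  have "pair_state \<kappa> (replicate (Suc e) i @ w) v = pair_state \<kappa> (replicate e i @ (i # w)) v"
    by (metis append.assoc append_Cons append_Nil replicate_Suc replicate_append_same)
  also have "\<dots> = (\<Sum>k\<le>e. ?c e k * (?f (Suc k) + (\<Sum>l\<le>k. \<kappa> i (Suc l) * ?f (k - l))))"
    unfolding Suc.IH by (intro sum.cong refl) (simp add: leading_run_replicate_append[OF assms]
      drop del: leading_run.simps)
  also have "\<dots> = (\<Sum>k\<le>e. ?c e k * ?f (Suc k)) + (\<Sum>k\<le>e. \<Sum>l\<le>k. ?c e k * \<kappa> i (Suc l) * ?f (k - l))"
    by (simp add: distrib_left sum.distrib sum_distrib_left mult.assoc)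
  also have "(\<Sum>k\<le>e. \<Sum>l\<le>k. ?c e k * \<kappa> i (Suc l) * ?f (k - l)) =
      (\<Sum>k\<le>e. \<Sum>l\<le>e - k. ?c e (k + l) * \<kappa> i (Suc l) * ?f k)"
    by (subst sum_triangle_flip) simp
  also have "\<dots> = (\<Sum>k\<le>Suc e. (\<Sum>l\<le>e - k. if k \<le> e then \<kappa> i (Suc l) * ?c e (k + l) else 0) * ?f k)"
    by (simp add: sum_distrib_left mult_ac)
  also have "(\<Sum>k\<le>e. ?c e k * ?f (Suc k)) = (\<Sum>k\<le>Suc e. (if k = 0 then 0 else ?c e (k - 1)) * ?f k)"
    by (subst sum.atMost_Suc_shift) simp
  finally show ?case by (simp add: sum.distrib distrib_right del: sum.atMost_Suc)
qed (simp add: assms)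

lemma word_ev_shift: "word_ev \<phi> u ps = word_ev (\<lambda>w. \<phi> (u @ w)) [] ps"
proof (induction ps arbitrary: \<phi> u)
  case (Cons q ps)
  obtain i p where q: "q = (i, p)" by force
  have "word_ev \<phi> (u @ replicate e i) ps = word_ev (\<lambda>w. \<phi> (u @ w)) (replicate e i) ps" for e
    using Cons[of \<phi> "u @ replicate e i"] Cons[of "\<lambda>w. \<phi> (u @ w)" "replicate e i"] by simp
  then show ?case by (simp add: q)
qed simp

lemma word_ev_sum:
  "word_ev (\<lambda>w. \<Sum>k\<in>A. c k * f k w) u ps = (\<Sum>k\<in>A. c k * word_ev (f k) u ps)"
proof (induction ps arbitrary: u)
  case (Cons q ps)
  obtain i p where q: "q = (i, p)" by force
  show ?case
    by (simp add: q Cons sum_distrib_left mult.left_commute) (rule sum.swap)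
qed simp

lemma word_ev_diff:
  "word_ev (\<lambda>w. \<phi> w - \<psi> w) u ps = word_ev \<phi> u ps - word_ev \<psi> u ps"
  by (induction ps arbitrary: u) (auto simp: sum_subtractf right_diff_distrib)

definition pair_functional :: "('i \<Rightarrow> nat \<Rightarrow> real) \<Rightarrow> 'i list \<Rightarrow> complex" where
  "pair_functional \<kappa> w = of_real (pair_state \<kappa> w [])"

text \<open>
  A centred polynomial in letter \<open>i\<close> maps a word \<open>v\<close> that does not start with \<open>i\<close> to a
  combination of words \<open>i\<^sup>k v\<close> with \<open>k \<ge> 1\<close>, because the coefficient for \<open>k = 0\<close> is its
  expectation. In an alternating product no run is therefore ever removed completely, and the
  empty word is not reached.
\<close>

lemma pair_functional_alternating:
  assumes "successively (\<noteq>) (map fst ps)" "\<forall>q\<in>set ps. word_ev (pair_functional \<kappa>) [] [q] = 0"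
    "v = [] \<or> ps = [] \<or> hd v \<noteq> fst (hd ps)" "v \<noteq> [] \<or> ps \<noteq> []"
  shows "word_ev (\<lambda>w. of_real (pair_state \<kappa> w v)) [] ps = 0"
  using assms
proof (induction ps arbitrary: v)
  case (Cons q ps)
  obtain i p where q: "q = (i, p)" by force
  have v: "v = [] \<or> hd v \<noteq> i" using Cons.prems(3) q by simp
  let ?F = "\<lambda>k. word_ev (\<lambda>w. complex_of_real (pair_state \<kappa> w (replicate k i @ v))) [] ps"
  let ?c = "\<lambda>e k. complex_of_real (vacuum_coeff (\<kappa> i) e k)"
  have run: "word_ev (\<lambda>w. complex_of_real (pair_state \<kappa> w v)) (replicate e i) ps
    = (\<Sum>k\<le>e. ?c e k * ?F k)" for e
    by (subst word_ev_shift) (simp add: pair_state_run[OF v] flip: word_ev_sum)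
  have F0: "?F k = 0" if "k \<ge> 1" for k
  proof (rule Cons.IH)
    show "successively (\<noteq>) (map fst ps)" using Cons.prems(1) by (cases ps) auto
    show "\<forall>q\<in>set ps. word_ev (pair_functional \<kappa>) [] [q] = 0" using Cons.prems(2) by simp
    have "hd (replicate k i @ v) = i" using that by (cases k) auto
    then show "replicate k i @ v = [] \<or> ps = [] \<or> hd (replicate k i @ v) \<noteq> fst (hd ps)"
      using Cons.prems(1) q by (cases ps) auto
    show "replicate k i @ v \<noteq> [] \<or> ps \<noteq> []" using that by (cases k) auto
  qed
  have "pair_functional \<kappa> (replicate e i) = ?c e 0" for e
  proof -
    have "pair_state \<kappa> (replicate e i @ []) []
      = (\<Sum>k\<le>e. vacuum_coeff (\<kappa> i) e k * pair_state \<kappa> [] (replicate k i @ []))"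
      by (rule pair_state_run) simp
    also have "\<dots> = (\<Sum>k\<in>{0}. vacuum_coeff (\<kappa> i) e k * pair_state \<kappa> [] (replicate k i @ []))"
      by (rule sum.mono_neutral_right) auto
    finally show ?thesis by (simp add: pair_functional_def)
  qed
  then have c0: "(\<Sum>e\<le>degree p. coeff p e * ?c e 0) = 0" using Cons.prems(2) q by simp
  have "word_ev (\<lambda>w. complex_of_real (pair_state \<kappa> w v)) [] (q # ps)
    = (\<Sum>e\<le>degree p. coeff p e * (\<Sum>k\<le>e. ?c e k * ?F k))"
    by (simp add: q run)
  also have "\<dots> = (\<Sum>e\<le>degree p. coeff p e * (?c e 0 * ?F 0))"
  proof (intro sum.cong refl arg_cong2[where f = "(*)"])
    fix e
    have "(\<Sum>k\<le>e. ?c e k * ?F k) = (\<Sum>k\<in>{0}. ?c e k * ?F k)"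
      by (rule sum.mono_neutral_right) (use F0 in auto)
    then show "(\<Sum>k\<le>e. ?c e k * ?F k) = ?c e 0 * ?F 0" by simp
  qed
  also have "\<dots> = (\<Sum>e\<le>degree p. coeff p e * ?c e 0) * ?F 0"
    by (simp only: sum_distrib_right mult.assoc)
  finally show ?case using c0 by simp
qed auto

lemma free_variables_pair_functional: "free_variables (pair_functional \<kappa>)"
  unfolding free_variables_def
proof (intro allI impI)
  fix ps assume "ps \<noteq> [] \<and> successively (\<noteq>) (map fst ps) \<and> (\<forall>q\<in>set ps. word_ev (pair_functional \<kappa>)
    [] [q] = 0)"
  then have "word_ev (\<lambda>w. of_real (pair_state \<kappa> w [])) [] ps = 0"
    by (intro pair_functional_alternating) auto
  then show "word_ev (pair_functional \<kappa>) [] ps = 0" by (simp add: pair_functional_def[abs_def])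
qed

lemma finite_words: "finite {w :: bool list. length w = n}"
  using finite_lists_length_eq[of "UNIV :: bool set" n] by simp

lemma sum_words_Suc:
  "(\<Sum>w | length w = Suc n. f w) = (\<Sum>i\<in>UNIV. \<Sum>w | length w = n. f (i # w :: bool list))"
proof -
  have "(\<Sum>i\<in>UNIV. \<Sum>w | length w = n. f (i # w)) = (\<Sum>(i, w)\<in>UNIV \<times> {w. length w = n}. f (i # w))"
    by (rule sum.Sigma) (auto simp: finite_words)
  also have "\<dots> = (\<Sum>w | length w = Suc n. f w)"
    by (rule sum.reindex_bij_witness[of _ "\<lambda>w. (hd w, tl w)"
      "\<lambda>(i, w). i # w"]) (auto simp: length_Suc_conv)
  finally show ?thesis ..
qed

text \<open>
  Let \<open>S\<^sub>j\<close> be the sum of all words of length \<open>j\<close>. These vectors span a copy of the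
  one-variable model for the sum of the letters: popping \<open>k\<close> equal letters \<open>i\<close> sends \<open>S\<^sub>j\<close> to
  \<open>S\<^sub>j\<^sub>-\<^sub>k\<close>, for each of the two letters.
\<close>

lemma sum_pair_state:
  "(\<Sum>w | length w = n. \<Sum>v | length v = j. pair_state \<kappa> w v) =
     stack_moment (\<lambda>k. \<kappa> False k + \<kappa> True k) n j"
proof (induction n arbitrary: j)
  case 0
  have "{v. length v = j \<and> v = ([] :: bool list)} = (if j = 0 then {[]} else {})" by auto
  then show ?case by (auto simp: finite_words sum.If_cases)
next
  case (Suc n)
  let ?g = "stack_moment (\<lambda>k. \<kappa> False k + \<kappa> True k) n"
  have inner: "(\<Sum>v | length v = j. \<Sum>k\<le>leading_run i v. h k (drop k v)) =
      (\<Sum>k\<le>j. \<Sum>v | length v = j - k. h k v)" for i and h :: "nat \<Rightarrow> bool list \<Rightarrow> real"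
  proof -
    have le: "leading_run i v \<le> length v" for v :: "bool list" by (simp add: length_takeWhile_le)
    have rep: "replicate k i @ drop k v = v" if "k \<le> leading_run i v" for k and v :: "bool list"
    proof -
      have "take k v = take k (takeWhile ((=) i) v)"
        using that by (metis leading_run.simps takeWhile_eq_take take_take min.absorb1)
      also have "\<dots> = replicate k i"
      proof (rule replicate_eqI[symmetric, THEN sym])
        show "length (take k (takeWhile ((=) i) v)) = k" using that by simp
        fix y assume "y \<in> set (take k (takeWhile ((=) i) v))"
        then show "y = i" by (metis in_set_takeD set_takeWhileD)
      qed
      finally show ?thesis by (metis append_take_drop_id)
    qed
    have ge: "k \<le> leading_run i (replicate k i @ v)" for k v by (induction k) auto
    have "(\<Sum>v | length v = j. \<Sum>k\<le>leading_run i v. h k (drop k v)) =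
        (\<Sum>(v, k)\<in>(SIGMA v:{v. length v = j}. {..leading_run i v}). h k (drop k v))"
      by (rule sum.Sigma) (auto simp: finite_words)
    also have "\<dots> = (\<Sum>(k, v)\<in>(SIGMA k:{..j}. {v. length v = j - k}). h k v)"
      by (rule sum.reindex_bij_witness[of _ "\<lambda>(k, v). (replicate k i @ v, k)"
        "\<lambda>(v, k). (k, drop k v)"])
        (use le rep ge in \<open>auto simp del: leading_run.simps intro: order_trans\<close>)
    also have "\<dots> = (\<Sum>k\<le>j. \<Sum>v | length v = j - k. h k v)"
      by (rule sum.Sigma[symmetric]) (auto simp: finite_words)
    finally show ?thesis .
  qed
  have push: "(\<Sum>i\<in>UNIV. \<Sum>w | length w = n. \<Sum>v | length v = j. pair_state \<kappa> w (i # v)) = ?g (Suc j)"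
  proof -
    have "(\<Sum>i\<in>UNIV. \<Sum>w | length w = n. \<Sum>v | length v = j. pair_state \<kappa> w (i # v)) =
       (\<Sum>w | length w = n. \<Sum>i\<in>UNIV. \<Sum>v | length v = j. pair_state \<kappa> w (i # v))" by (rule sum.swap)
    also have "\<dots> = (\<Sum>w | length w = n. \<Sum>v | length v = Suc j. pair_state \<kappa> w v)"
      by (simp only: sum_words_Suc)
    finally show ?thesis by (simp only: Suc.IH)
  qed
  have pop: "(\<Sum>w | length w = n. \<Sum>v | length v
    = j. \<Sum>k\<le>leading_run i v. \<kappa> i (Suc k) * pair_state \<kappa> w (drop k v)) =
      (\<Sum>k\<le>j. \<kappa> i (Suc k) * ?g (j - k))" for i
  proof -
    have "(\<Sum>w | length w = n. \<Sum>v | length v = j. \<Sum>k\<le>leading_run i v. \<kappa> i (Suc k)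
      * pair_state \<kappa> w (drop k v)) =
        (\<Sum>w | length w = n. \<Sum>k\<le>j. \<Sum>v | length v = j - k. \<kappa> i (Suc k) * pair_state \<kappa> w v)"
      by (intro sum.cong refl inner[where h = "\<lambda>k v. \<kappa> i (Suc k) * pair_state \<kappa> w v" for w])
    also have "\<dots> = (\<Sum>k\<le>j. \<Sum>w | length w = n. \<Sum>v | length v = j - k. \<kappa> i (Suc k) * pair_state \<kappa> w v)"
      by (rule sum.swap)
    also have "\<dots> = (\<Sum>k\<le>j. \<kappa> i (Suc k) * ?g (j - k))"
      by (simp only: sum_distrib_left[symmetric] Suc.IH)
    finally show ?thesis .
  qed
  have "(\<Sum>w | length w = Suc n. \<Sum>v | length v = j. pair_state \<kappa> w v) =
     (\<Sum>i\<in>UNIV. \<Sum>w | length w = n. \<Sum>v | length v = j. pair_state \<kappa> w (i # v)) +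
     (\<Sum>i\<in>UNIV. \<Sum>w | length w = n. \<Sum>v | length v
         = j. \<Sum>k\<le>leading_run i v. \<kappa> i (Suc k) * pair_state \<kappa> w (drop k v))"
    by (simp add: sum_words_Suc sum.distrib del: leading_run.simps)
  also have "\<dots> = ?g (Suc j) + (\<Sum>i\<in>UNIV. \<Sum>k\<le>j. \<kappa> i (Suc k) * ?g (j - k))"
    by (simp only: push pop)
  finally show ?case by (simp add: UNIV_bool distrib_right sum.distrib)
qed

lemma sum_pair_functional:
  "(\<Sum>w | length w = n. pair_functional \<kappa> w) = of_real (stack_moment (\<lambda>k. \<kappa> False k + \<kappa> True k) n 0)"
  using sum_pair_state[where j = 0 and n = n] by (simp add: pair_functional_def flip: of_real_sum)

lemma word_ev_vanish:
  assumes "\<And>w. length w \<le> length u + (\<Sum>q\<leftarrow>ps. degree (snd q)) \<Longrightarrow> \<delta> w = 0"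
  shows "word_ev \<delta> u ps = 0"
  using assms
proof (induction ps arbitrary: u)
  case (Cons q ps)
  obtain i p where q: "q = (i, p)" by force
  have "word_ev \<delta> (u @ replicate e i) ps = 0" if "e \<le> degree p" for e
    by (rule Cons.IH, rule Cons.prems) (use that q in auto)
  then show ?case by (simp add: q)
qed auto

text \<open>
  A functional that vanishes on shorter words sees only the leading terms of monic
  polynomials.
\<close>

lemma word_ev_leading:
  assumes "\<And>w. length w < length u + (\<Sum>q\<leftarrow>ps. degree (snd q)) \<Longrightarrow> \<delta> w = 0"
    "\<And>q. q \<in> set ps \<Longrightarrow> lead_coeff (snd q) = 1"
  shows "word_ev \<delta> u ps = \<delta> (u @ concat (map (\<lambda>q. replicate (degree (snd q)) (fst q)) ps))"
  using assms
proof (induction ps arbitrary: u)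
  case (Cons q ps)
  obtain i p where q: "q = (i, p)" by force
  have "word_ev \<delta> (u @ replicate e i) ps = 0" if "e < degree p" for e
    by (rule word_ev_vanish, rule Cons.prems) (use that q in auto)
  then have "word_ev \<delta> u (q # ps) = (\<Sum>e\<in>{degree p}. coeff p e * word_ev \<delta> (u @ replicate e i) ps)"
    unfolding q word_ev.simps by (intro sum.mono_neutral_right) auto
  also have "\<dots> = word_ev \<delta> (u @ replicate (degree p) i) ps" using Cons.prems(2)[of q] q by simp
  also have "\<dots> = \<delta> ((u @ replicate (degree p) i) @ concat (map (\<lambda>q. replicate (degree (snd q))
    (fst q)) ps))"
    by (rule Cons.IH, rule Cons.prems) (use q Cons.prems(2) in auto)
  finally show ?case by (simp add: q)
qed auto

lemma word_runs:
  "\<exists>rs. successively (\<noteq>) (map fst rs) \<and> (\<forall>r\<in>set rs. snd r \<ge> 1) \<and>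
     concat (map (\<lambda>r. replicate (snd r) (fst r)) rs) = w"
proof (induction w)
  case Nil
  show ?case by (intro exI[of _ "[]"]) simp
next
  case (Cons i w)
  then obtain rs where rs: "successively (\<noteq>) (map fst rs)" "\<forall>r\<in>set rs. snd r \<ge> 1"
     "concat (map (\<lambda>r. replicate (snd r) (fst r)) rs) = w" by blast
  show ?case
  proof (cases "rs \<noteq> [] \<and> fst (hd rs) = i")
    case True
    then obtain e rs' where e: "rs = (i, e) # rs'" by (cases rs) auto
    show ?thesis using rs e by (intro exI[of _ "(i, Suc e) # rs'"]) (cases rs'; auto)
  next
    case False
    then show ?thesis using rs by (intro exI[of _ "(i, 1) # rs"]) (cases rs; auto)
  qed
qed

text \<open>
  Split \<open>w\<close> into runs and centre the corresponding powers. Freeness makes the product of the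
  centred powers vanish under both functionals; it differs from \<open>w\<close> only by combinations of
  shorter words, on which the functionals agree by induction.
\<close>

lemma free_functional_unique:
  fixes \<phi> \<psi> :: "'i list \<Rightarrow> complex"
  assumes \<phi>: "\<phi> [] = 1" "free_variables \<phi>" and \<psi>: "\<psi> [] = 1" "free_variables \<psi>"
    and eq: "\<And>i k. \<phi> (replicate k i) = \<psi> (replicate k i)"
  shows "\<phi> w = \<psi> w"
proof (induction "length w" arbitrary: w rule: less_induct)
  case less
  show ?case
  proof (cases "w = []")
    case True
    then show ?thesis using \<phi> \<psi> by simp
  next
    case False
    obtain rs where rs: "successively (\<noteq>) (map fst rs)" "\<forall>r\<in>set rs. snd r \<ge> 1"
       "concat (map (\<lambda>r. replicate (snd r) (fst r)) rs) = w" using word_runs by blast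
    \<comment> \<open>the power of a run, centred by its expectation\<close>
    define P where "P r = monom 1 (snd r) - [:\<phi> (replicate (snd r) (fst r)):]" for r :: "'i \<times> nat"
    have P: "degree (P r) = snd r" "lead_coeff (P r) = 1" if "r \<in> set rs" for r
    proof -
      have "snd r \<ge> 1" using rs(2) that by simp
      then have "degree [:- \<phi> (replicate (snd r) (fst r)):] < degree (monom 1 (snd r) :: complex
        poly)"
        by (simp add: degree_monom_eq)
      then show "degree (P r) = snd r" "lead_coeff (P r) = 1"
        unfolding P_def using \<open>snd r \<ge> 1\<close>
        by (simp_all add: degree_monom_eq diff_conv_add_uminus degree_add_eq_left
          lead_coeff_add_le coeff_pCons split: nat.split)
    qed
    have cen: "word_ev \<xi> [] [(fst r, P r)] = 0" if r: "r \<in> set rs"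
      and \<xi>: "\<xi> [] = 1" "\<And>i k. \<xi> (replicate k i) = \<phi> (replicate k i)" for r \<xi>
    proof -
      obtain i e where ie: "r = (i, e)" by force
      have e: "e \<ge> 1" using rs(2) r ie by force
      have deg: "degree (P r) = e" using P(1)[OF r] ie by simp
      have "word_ev \<xi> [] [(fst r, P r)] = (\<Sum>k\<le>e. coeff (P r) k * \<phi> (replicate k i))"
        using ie deg \<xi> by simp
      also have "\<dots> = (\<Sum>k\<in>{0, e}. coeff (P r) k * \<phi> (replicate k i))"
        by (rule sum.mono_neutral_right) (use e in \<open>auto simp: P_def ie coeff_pCons split:
          nat.split\<close>)
      also have "\<dots> = 0" using e \<phi>(1) by (auto simp: P_def ie coeff_pCons split: nat.split)
      finally show ?thesis .
    qed
    define ps where "ps = map (\<lambda>r. (fst r, P r)) rs"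
    have "rs \<noteq> []" using rs(3) False by auto
    then have ps: "ps \<noteq> []" "successively (\<noteq>) (map fst ps)" using rs(1)
      by (auto simp: ps_def comp_def)
    have zero: "word_ev \<xi> [] ps = 0" if "free_variables \<xi>" "\<xi> [] = 1" "\<And>i k. \<xi> (replicate k i)
      = \<phi> (replicate k i)" for \<xi>
    proof -
      have "\<forall>q\<in>set ps. word_ev \<xi> [] [q] = 0"
      proof
        fix q assume "q \<in> set ps"
        then obtain r where "r \<in> set rs" "q = (fst r, P r)" unfolding ps_def by auto
        then show "word_ev \<xi> [] [q] = 0" using cen[of r \<xi>] that(2,3) by simp
      qed
      then show ?thesis using that(1) ps unfolding free_variables_def by blast
    qed
    have "word_ev \<phi> [] ps = 0" "word_ev \<psi> [] ps = 0"
      using zero[of \<phi>] zero[of \<psi>] \<phi> \<psi> eq by simp_all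
    then have "word_ev (\<lambda>w. \<phi> w - \<psi> w) [] ps = 0" by (simp add: word_ev_diff)
    moreover have conc: "concat (map (\<lambda>q. replicate (degree (snd q)) (fst q)) ps) = w"
      unfolding ps_def map_map comp_def rs(3)[symmetric] using P(1)
      by (intro arg_cong[where f = concat] map_cong) auto
    moreover have len: "(\<Sum>q\<leftarrow>ps. degree (snd q)) = length w"
      unfolding conc[symmetric] by (simp add: length_concat comp_def)
    moreover have "word_ev (\<lambda>w. \<phi> w - \<psi> w) [] ps
      = \<phi> ([] @ concat (map (\<lambda>q. replicate (degree (snd q)) (fst q)) ps)) -
        \<psi> ([] @ concat (map (\<lambda>q. replicate (degree (snd q)) (fst q)) ps))"
      by (rule word_ev_leading[where \<delta> = "\<lambda>w. \<phi> w - \<psi> w"]) (use less len P in \<open>auto simp: ps_def\<close>)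
    ultimately show ?thesis by simp
  qed
qed

lemma compactly_supported_prob_moment_0:
  assumes "compactly_supported_prob \<mu>" shows "moment \<mu> 0 = 1"
proof -
  interpret real_distribution \<mu> using assms by (simp add: compactly_supported_prob_def)
  show ?thesis by (simp add: moment_def prob_space[simplified])
qed

lemma moment_eq_pair_functional:
  assumes "compactly_supported_prob \<mu>" and "\<And>n. n \<ge> 1 \<Longrightarrow> free_cumulant \<mu> n = \<kappa> i n"
  shows "of_real (moment \<mu> k) = pair_functional \<kappa> (replicate k i)"
proof -
  have "pair_functional \<kappa> (replicate k i) = of_real (stack_moment (\<kappa> i) k 0)"
    using pair_state_marginal[of \<kappa> k i 0] by (simp add: pair_functional_def)
  moreover have "moment \<mu> k = stack_moment (\<kappa> i) k 0"
  proof (cases "k = 0")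
    case False
    then show ?thesis using moment_eq_stack_moment[of k \<mu>] stack_moment_cong[of "free_cumulant \<mu>"
      "\<kappa> i"] assms(2) by simp
  qed (simp add: compactly_supported_prob_moment_0[OF assms(1)])
  ultimately show ?thesis by simp
qed

text \<open>
  By uniqueness the joint law of the free pair is the one of the model, where the cumulants of
  the sum are visible.
\<close>

lemma free_cumulant_free_convolution:
  assumes "is_free_convolution \<mu> \<nu> \<rho>" "n \<ge> 1"
  shows "free_cumulant \<rho> n = free_cumulant \<mu> n + free_cumulant \<nu> n"
proof -
  let ?\<kappa> = "\<lambda>i. if i then free_cumulant \<nu> else free_cumulant \<mu>"
  from assms(1) obtain \<phi> :: "bool list \<Rightarrow> complex" where
    csp: "compactly_supported_prob \<mu>" "compactly_supported_prob \<nu>" and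
    \<phi>: "\<phi> [] = 1" "free_variables \<phi>" "\<And>k. \<phi> (replicate k False) = of_real (moment \<mu> k)"
     "\<And>k. \<phi> (replicate k True) = of_real (moment \<nu> k)" "\<And>k. of_real (moment \<rho> k) = (\<Sum>w | length w
         = k. \<phi> w)"
    unfolding is_free_convolution_def by blast
  have "\<phi> w = pair_functional ?\<kappa> w" for w
  proof (rule free_functional_unique)
    show "pair_functional ?\<kappa> [] = 1" by (simp add: pair_functional_def)
    show "\<phi> (replicate k i) = pair_functional ?\<kappa> (replicate k i)" for i k
      using moment_eq_pair_functional[OF csp(1), of ?\<kappa> False] moment_eq_pair_functional[OF csp(2),
        of ?\<kappa> True] \<phi>(3,4)
      by (cases i) auto
  qed (use \<phi> free_variables_pair_functional in auto)
  then have "complex_of_real (moment \<rho> k) = of_real (stack_moment (\<lambda>k. ?\<kappa> False k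
    + ?\<kappa> True k) k 0)" for k
    using \<phi>(5) sum_pair_functional[of ?\<kappa> k] by simp
  then have "moment \<rho> k = stack_moment (\<lambda>k. ?\<kappa> False k + ?\<kappa> True k) k 0" for k
    by (simp only: of_real_eq_iff)
  then show ?thesis using free_cumulant_eqI[of \<rho> _ n] assms(2) by force
qed

text \<open>
  The model provides the free pair: its marginals have the moments of \<open>\<mu>\<close> and \<open>\<nu>\<close>, and its sum
  has those of \<open>\<rho>\<close>.
\<close>

lemma is_free_convolutionI:
  assumes "compactly_supported_prob \<mu>" "compactly_supported_prob \<nu>" "compactly_supported_prob \<rho>"
    and "\<And>n. n \<ge> 1 \<Longrightarrow> free_cumulant \<rho> n = free_cumulant \<mu> n + free_cumulant \<nu> n"
  shows "is_free_convolution \<mu> \<nu> \<rho>"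
proof -
  let ?\<kappa> = "\<lambda>i. if i then free_cumulant \<nu> else free_cumulant \<mu>"
  have "of_real (moment \<rho> k) = (\<Sum>w | length w = k. pair_functional ?\<kappa> w)" for k
  proof -
    have "moment \<rho> k = stack_moment (\<lambda>k. ?\<kappa> False k + ?\<kappa> True k) k 0"
    proof (cases "k = 0")
      case False
      then have "moment \<rho> k = stack_moment (free_cumulant \<rho>) k 0"
        by (simp add: moment_eq_stack_moment)
      also have "\<dots> = stack_moment (\<lambda>k. ?\<kappa> False k + ?\<kappa> True k) k 0"
        by (rule stack_moment_cong) (simp add: assms(4))
      finally show ?thesis .
    qed (simp add: compactly_supported_prob_moment_0[OF assms(3)])
    then show ?thesis by (simp only: sum_pair_functional)
  qed
  moreover have "pair_functional ?\<kappa> [] = 1" by (simp add: pair_functional_def)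
  moreover have "pair_functional ?\<kappa> (replicate k False) = of_real (moment \<mu> k)"
     "pair_functional ?\<kappa> (replicate k True) = of_real (moment \<nu> k)" for k
    using moment_eq_pair_functional[OF assms(1), of ?\<kappa> False] moment_eq_pair_functional[OF
      assms(2), of ?\<kappa> True] by simp_all
  ultimately show ?thesis
    unfolding is_free_convolution_def using assms(1-3) free_variables_pair_functional by blast
qed

section \<open>Sequences with positive semidefinite Hadamard products\<close>

definition psd_on :: "'i set \<Rightarrow> ('i \<Rightarrow> 'i \<Rightarrow> real) \<Rightarrow> bool" where
  "psd_on I K \<longleftrightarrow> (\<forall>c. 0 \<le> (\<Sum>i\<in>I. \<Sum>j\<in>I. c i * c j * K i j))"

text \<open>
  The conclusion of the Schur product theorem for the Hankel kernel of \<open>s\<close>, taken as a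
  definition. Moment sequences of positive measures have this property, and so do their
  pointwise limits, which spares the construction of a representing measure. The index type is
  the one of the basis of the Fock space below.
\<close>

definition hadamard_psd :: "(nat \<Rightarrow> real) \<Rightarrow> bool" where
  "hadamard_psd s \<longleftrightarrow> (\<forall>I (e :: nat list \<Rightarrow> nat) B. finite I \<and> psd_on I B \<longrightarrow>
     psd_on I (\<lambda>i j. s (e i + e j) * B i j))"

text \<open>
  For each fixed \<open>x\<close> the factor \<open>g x ^ e i * g x ^ e j\<close> is absorbed into the coefficients of
  the quadratic form of \<open>B\<close>.
\<close>

lemma hadamard_psd_integral:
  fixes w g :: "'x \<Rightarrow> real"
  assumes int: "\<And>n. integrable M (\<lambda>x. w x * g x ^ n)" and w: "\<And>x. w x \<ge> 0"
  shows "hadamard_psd (\<lambda>n. LINT x|M. w x * g x ^ n)"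
  unfolding hadamard_psd_def psd_on_def
proof (intro allI impI, elim conjE)
  fix I and e :: "nat list \<Rightarrow> nat" and B :: "nat list \<Rightarrow> nat list \<Rightarrow> real" and c :: "nat list \<Rightarrow> real"
  assume "finite I" and B: "\<forall>c. 0 \<le> (\<Sum>i\<in>I. \<Sum>j\<in>I. c i * c j * B i j)"
  have "(\<Sum>i\<in>I. \<Sum>j\<in>I. c i * c j * ((LINT x|M. w x * g x ^ (e i + e j)) * B i j)) =
     (\<Sum>i\<in>I. \<Sum>j\<in>I. (LINT x|M. (c i * c j * B i j) * (w x * g x ^ (e i + e j))))"
    by (intro sum.cong refl) (simp only: Bochner_Integration.integral_mult_right_zero, simp only:
      mult_ac)
  also have "\<dots> = (LINT x|M. (\<Sum>i\<in>I. \<Sum>j\<in>I. (c i * c j * B i j) * (w x * g x ^ (e i + e j))))"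
    by (simp add: int)
  also have "\<dots> = (LINT x|M. w x * (\<Sum>i\<in>I. \<Sum>j\<in>I. (c i * g x ^ e i) * (c j * g x ^ e j) * B i j))"
    by (simp add: sum_distrib_left power_add mult_ac)
  also have "\<dots> \<ge> 0"
    by (intro integral_nonneg_AE AE_I2 mult_nonneg_nonneg w B[rule_format])
  finally show "0 \<le> (\<Sum>i\<in>I. \<Sum>j\<in>I. c i * c j * ((LINT x|M. w x * g x ^ (e i + e j)) * B i j))" .
qed

lemma hadamard_psd_mult:
  assumes "hadamard_psd s" "hadamard_psd r" shows "hadamard_psd (\<lambda>n. s n * r n)"
  unfolding hadamard_psd_def
proof (intro allI impI, elim conjE)
  fix I and e :: "nat list \<Rightarrow> nat" and B :: "nat list \<Rightarrow> nat list \<Rightarrow> real" assume "finite I"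
    "psd_on I B"
  then have "psd_on I (\<lambda>i j. r (e i + e j) * B i j)" using assms(2) unfolding hadamard_psd_def
    by blast
  then have "psd_on I (\<lambda>i j. s (e i + e j) * (r (e i + e j) * B i j))"
    using assms(1) \<open>finite I\<close> unfolding hadamard_psd_def by blast
  then show "psd_on I (\<lambda>i j. s (e i + e j) * r (e i + e j) * B i j)" by (simp add: mult.assoc)
qed

lemma hadamard_psd_add:
  assumes "hadamard_psd s" "hadamard_psd r" shows "hadamard_psd (\<lambda>n. s n + r n)"
  unfolding hadamard_psd_def
proof (intro allI impI, elim conjE)
  fix I and e :: "nat list \<Rightarrow> nat" and B :: "nat list \<Rightarrow> nat list \<Rightarrow> real" assume "finite I"
    "psd_on I B"
  then have "psd_on I (\<lambda>i j. r (e i + e j) * B i j)" "psd_on I (\<lambda>i j. s (e i + e j) * B i j)"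
    using assms unfolding hadamard_psd_def by blast+
  then show "psd_on I (\<lambda>i j. (s (e i + e j) + r (e i + e j)) * B i j)"
    unfolding psd_on_def by (simp add: distrib_left distrib_right sum.distrib add_nonneg_nonneg)
qed

lemma hadamard_psd_power:
  assumes "a \<ge> 0" shows "hadamard_psd (\<lambda>n. a * x ^ n)"
proof -
  have "hadamard_psd (\<lambda>n. LINT u|count_space {()}. a * x ^ n)"
    by (rule hadamard_psd_integral) (use assms in \<open>auto intro: integrable_count_space\<close>)
  then show ?thesis by (simp add: lebesgue_integral_count_space_finite)
qed

lemma hadamard_psd_scale: "a \<ge> 0 \<Longrightarrow> hadamard_psd s \<Longrightarrow> hadamard_psd (\<lambda>n. a * s n)"
  using hadamard_psd_mult[OF hadamard_psd_power[of a 1]] by simp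

lemma hadamard_psd_delta: "a \<ge> 0 \<Longrightarrow> hadamard_psd (\<lambda>n. if n = 0 then a else 0)"
  using hadamard_psd_power[of a 0] by (simp add: power_0_left if_distrib cong: if_cong)

lemma hadamard_psd_limit:
  assumes "\<And>N. hadamard_psd (s N)" "\<And>n. (\<lambda>N. s N n) \<longlonglongrightarrow> r n"
  shows "hadamard_psd r"
  unfolding hadamard_psd_def psd_on_def
proof (intro allI impI, elim conjE)
  fix I and e :: "nat list \<Rightarrow> nat" and B :: "nat list \<Rightarrow> nat list \<Rightarrow> real" and c :: "nat list \<Rightarrow> real"
  assume "finite I" and B: "\<forall>c. 0 \<le> (\<Sum>i\<in>I. \<Sum>j\<in>I. c i * c j * B i j)"
  have "(\<lambda>N. \<Sum>i\<in>I. \<Sum>j\<in>I. c i * c j * (s N (e i + e j) * B i j)) \<longlonglongrightarrow>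
        (\<Sum>i\<in>I. \<Sum>j\<in>I. c i * c j * (r (e i + e j) * B i j))"
    by (intro tendsto_intros assms(2))
  moreover have "0 \<le> (\<Sum>i\<in>I. \<Sum>j\<in>I. c i * c j * (s N (e i + e j) * B i j))" for N
    using assms(1)[of N] \<open>finite I\<close> B unfolding hadamard_psd_def psd_on_def by blast
  ultimately show "0 \<le> (\<Sum>i\<in>I. \<Sum>j\<in>I. c i * c j * (r (e i + e j) * B i j))"
    by (meson LIMSEQ_le_const)
qed

section \<open>The Fock space model and positivity of moments\<close>

text \<open>
  The inner product of the full Fock space over polynomials, on the basis of words
  \<open>x\<^bsup>i1\<^esup> \<otimes> \<dots> \<otimes> x\<^bsup>ir\<^esup>\<close> (lists of exponents), where \<open>\<langle>x\<^sup>i, x\<^sup>j\<rangle> = s (i + j)\<close>.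
\<close>

fun fock_inner :: "(nat \<Rightarrow> real) \<Rightarrow> nat list \<Rightarrow> nat list \<Rightarrow> real" where
  "fock_inner s [] [] = 1"
| "fock_inner s (i # v) (j # w) = s (i + j) * fock_inner s v w"
| "fock_inner s _ _ = 0"

lemma psd_on_pullback:
  assumes "finite I" "psd_on (f ` I) K" shows "psd_on I (\<lambda>i j. K (f i) (f j))"
  unfolding psd_on_def
proof
  fix c :: "'a \<Rightarrow> real"
  define d where "d a = (\<Sum>i | i \<in> I \<and> f i = a. c i)" for a
  have g: "(\<Sum>i\<in>I. c i * h (f i)) = (\<Sum>a\<in>f ` I. d a * h a)" for h
  proof -
    have "(\<Sum>i\<in>I. c i * h (f i)) = (\<Sum>a\<in>f ` I. \<Sum>i | i \<in> I \<and> f i = a. c i * h (f i))"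
      by (rule sum.image_gen[OF assms(1)])
    also have "\<dots> = (\<Sum>a\<in>f ` I. d a * h a)"
      unfolding sum_distrib_right d_def by (intro sum.cong refl) auto
    finally show ?thesis .
  qed
  have "(\<Sum>i\<in>I. \<Sum>j\<in>I. c i * c j * K (f i) (f j)) = (\<Sum>i\<in>I. c i * (\<Sum>j\<in>I. c j * K (f i) (f j)))"
    by (simp add: sum_distrib_left mult.assoc)
  also have "\<dots> = (\<Sum>a\<in>f ` I. d a * (\<Sum>b\<in>f ` I. d b * K a b))"
    using g[of "\<lambda>a. \<Sum>j\<in>I. c j * K a (f j)"] g[of "K a" for a] by simp
  also have "\<dots> = (\<Sum>a\<in>f ` I. \<Sum>b\<in>f ` I. d a * d b * K a b)"
    by (simp add: sum_distrib_left mult.assoc)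
  also have "\<dots> \<ge> 0" using assms(2)[unfolded psd_on_def, rule_format, of d] .
  finally show "0 \<le> (\<Sum>i\<in>I. \<Sum>j\<in>I. c i * c j * K (f i) (f j))" .
qed

text \<open>
  The empty word is orthogonal to all others, and on these the form is the entrywise product
  of a Hankel kernel in the first letters with the form on the tails, so the Schur product
  property of \<open>s\<close> applies.
\<close>

lemma psd_on_fock_inner:
  assumes s: "hadamard_psd s" and "finite I"
  shows "psd_on I (fock_inner s)"
proof -
  have "psd_on I (fock_inner s)" if "finite I" "\<forall>w\<in>I. length w < n" for n I
    using that
  proof (induction n arbitrary: I)
    case 0
    then have "I = {}" by auto
    then show ?case by (simp add: psd_on_def)
  next
    case (Suc n)
    let ?I0 = "I \<inter> {[]}" and ?I1 = "I - {[]}"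
    have "psd_on (tl ` ?I1) (fock_inner s)"
    proof (rule Suc.IH)
      show "\<forall>w\<in>tl ` ?I1. length w < n"
      proof
        fix w assume "w \<in> tl ` ?I1"
        then obtain v where "v \<in> I" "v \<noteq> []" "w = tl v" by blast
        then show "length w < n" using Suc.prems(2) by (cases v) auto
      qed
    qed (use Suc.prems in auto)
    then have "psd_on ?I1 (\<lambda>v w. fock_inner s (tl v) (tl w))"
      by (rule psd_on_pullback[rotated]) (use Suc.prems in auto)
    then have "psd_on ?I1 (\<lambda>v w. s (hd v + hd w) * fock_inner s (tl v) (tl w))"
      using s Suc.prems(1) unfolding hadamard_psd_def by blast
    moreover have "s (hd v + hd w) * fock_inner s (tl v) (tl w) = fock_inner s v w"
      if "v \<noteq> []" "w \<noteq> []" for v w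
      using that by (cases v; cases w) auto
    ultimately have p1: "psd_on ?I1 (fock_inner s)"
      unfolding psd_on_def by (simp cong: sum.cong_simp)
    show ?case
      unfolding psd_on_def
    proof
      fix c :: "nat list \<Rightarrow> real"
      let ?g = "\<lambda>v w. c v * c w * fock_inner s v w"
      have split: "(\<Sum>w\<in>I. f w) = (\<Sum>w\<in>?I0. f w) + (\<Sum>w\<in>?I1. f w)" for f :: "nat list \<Rightarrow> real"
        by (rule sum.Int_Diff[OF Suc.prems(1)])
      have cross: "?g v w = 0" if "v \<in> ?I0 \<and> w \<in> ?I1 \<or> v \<in> ?I1 \<and> w \<in> ?I0" for v w
        using that by (cases v; cases w) auto
      have "(\<Sum>v\<in>I. \<Sum>w\<in>I. ?g v w) = (\<Sum>v\<in>?I0. \<Sum>w\<in>?I0. ?g v w) + (\<Sum>v\<in>?I1. \<Sum>w\<in>?I1. ?g v w)"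
      proof -
        have "(\<Sum>v\<in>?I0. \<Sum>w\<in>?I1. ?g v w) = 0" "(\<Sum>v\<in>?I1. \<Sum>w\<in>?I0. ?g v w) = 0"
          using cross by (intro sum.neutral ballI; blast)+
        then show ?thesis by (subst split, subst (1 2) split) (simp add: sum.distrib)
      qed
      moreover have "0 \<le> (\<Sum>v\<in>?I1. \<Sum>w\<in>?I1. ?g v w)" using p1 unfolding psd_on_def by blast
      moreover have "0 \<le> (\<Sum>v\<in>?I0. \<Sum>w\<in>?I0. ?g v w)"
        by (intro sum_nonneg) auto
      ultimately show "0 \<le> (\<Sum>v\<in>I. \<Sum>w\<in>I. ?g v w)" by simp
    qed
  qed
  from this[OF assms(2), of "Suc (Max (length ` I))"] show ?thesis
    using assms(2) by (simp add: less_Suc_eq_le)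
qed

text \<open>
  A constant instead of an abstraction, so that simplification leaves the form untouched.
\<close>

definition shift2 :: "(nat \<Rightarrow> real) \<Rightarrow> nat \<Rightarrow> real" where
  "shift2 \<kappa> j = \<kappa> (j + 2)"

text \<open>
  The selfadjoint operator with free cumulants \<open>\<kappa>\<close> on the Fock space: creation of \<open>x\<^sup>0\<close>, the
  scalar \<open>\<kappa>\<^sub>1\<close>, annihilation of the first letter \<open>x\<^sup>i\<close> with weight \<open>\<langle>x\<^sup>i, x\<^sup>0\<rangle> = \<kappa>\<^sub>i\<^sub>+\<^sub>2\<close>, and
  multiplication of the first letter by \<open>x\<close>. It is written as an operator on functions of the
  basis words, which stand for linear functionals.
\<close>

definition fock_step :: "(nat \<Rightarrow> real) \<Rightarrow> (nat list \<Rightarrow> real) \<Rightarrow> nat list \<Rightarrow> real" where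
  "fock_step \<kappa> f w = f (0 # w) + \<kappa> (Suc 0) * f w +
     (case w of [] \<Rightarrow> 0 | i # u \<Rightarrow> \<kappa> (i + 2) * f u + f (Suc i # u))"

lemma fock_step_sum:
  "fock_step \<kappa> (\<lambda>u. \<Sum>v\<in>S. a v * F u v) w = (\<Sum>v\<in>S. a v * fock_step \<kappa> (\<lambda>u. F u v) w)"
  by (cases w) (simp_all add: fock_step_def sum_distrib_left sum.distrib algebra_simps)

lemma fock_step_combination:
  "\<exists>S a. finite S \<and> (\<forall>f. fock_step \<kappa> f w = (\<Sum>u\<in>S. a u * f u))"
proof -
  have single: "\<exists>S a. finite S \<and> (\<forall>f :: nat list \<Rightarrow> real. c * f x = (\<Sum>u\<in>S. a u * f u))" for c x
    by (intro exI[of _ "{x}"] exI[of _ "\<lambda>_. c"]) simp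
  have add: "\<exists>S a. finite S \<and> (\<forall>f :: nat list \<Rightarrow> real. p f + q f = (\<Sum>u\<in>S. a u * f u))"
    if p: "\<exists>S a. finite S \<and> (\<forall>f. p f = (\<Sum>u\<in>S. a u * f u))"
      and q: "\<exists>S a. finite S \<and> (\<forall>f. q f = (\<Sum>u\<in>S. a u * f u))" for p q
  proof -
    from p obtain S a where S: "finite S" "\<And>f. p f = (\<Sum>u\<in>S. a u * f u)" by blast
    from q obtain R b where R: "finite R" "\<And>f. q f = (\<Sum>u\<in>R. b u * f u)" by blast
    have "p f + q f = (\<Sum>u\<in>S \<union> R. ((if u \<in> S then a u else 0) + (if u \<in> R then b u else 0)) * f u)"
      for f
    proof -
      have "p f = (\<Sum>u\<in>S \<union> R. (if u \<in> S then a u else 0) * f u)"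
        unfolding S(2) by (rule sum.mono_neutral_cong_left) (use S R in auto)
      moreover have "q f = (\<Sum>u\<in>S \<union> R. (if u \<in> R then b u else 0) * f u)"
        unfolding R(2) by (rule sum.mono_neutral_cong_left) (use S R in auto)
      ultimately show ?thesis by (simp add: sum.distrib distrib_right)
    qed
    then show ?thesis using S R by (intro exI[of _ "S \<union> R"] exI) auto
  qed
  show ?thesis
  proof (cases w)
    case Nil
    have "fock_step \<kappa> f w = 1 * f (0 # w) + \<kappa> (Suc 0) * f w" for f by (simp add: fock_step_def Nil)
    then show ?thesis using add[OF single[of 1 "0 # w"] single[of "\<kappa> (Suc 0)" w]] by simp
  next
    case (Cons i u)
    have "fock_step \<kappa> f w = (1 * f (0 # w) + \<kappa> (Suc 0) * f w) + (\<kappa> (i + 2) * f u + 1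
      * f (Suc i # u))" for f
      by (simp add: fock_step_def Cons)
    then show ?thesis
      using add[OF add[OF single[of 1 "0 # w"] single[of "\<kappa> (Suc 0)" w]] add[OF single[of "\<kappa> (i
        + 2)" u] single[of 1 "Suc i # u"]]]
      by simp
  qed
qed

text \<open>
  Evaluation after \<open>n\<close> steps is a finite linear combination of evaluations. This gives the
  expansion of \<open>a\<^sup>n \<Omega>\<close> in the basis and lets operators acting on different arguments commute.
\<close>

lemma fock_steps_combination:
  "\<exists>S a. finite S \<and> (\<forall>f. (fock_step \<kappa> ^^ n) f w = (\<Sum>u\<in>S. a u * f u))"
proof (induction n)
  case 0
  show ?case by (intro exI[of _ "{w}"] exI[of _ "\<lambda>_. 1"]) simp
next
  case (Suc n)
  then obtain S a where S: "finite S" "\<And>f. (fock_step \<kappa> ^^ n) f w = (\<Sum>u\<in>S. a u * f u)" by blast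
  have "\<forall>u. \<exists>R b. finite R \<and> (\<forall>f. fock_step \<kappa> f u = (\<Sum>v\<in>R. b v * f v))"
    using fock_step_combination by blast
  then obtain R b where R: "\<And>u. finite (R u)" "\<And>u f. fock_step \<kappa> f u = (\<Sum>v\<in>R u. b u v * f v)"
    by metis
  let ?U = "\<Union>u\<in>S. R u"
  have "(fock_step \<kappa> ^^ Suc n) f w = (\<Sum>v\<in>?U. (\<Sum>u\<in>S. a u * (if v \<in> R u then b u v else 0)) * f v)"
    for f
  proof -
    have "(fock_step \<kappa> ^^ Suc n) f w = (\<Sum>u\<in>S. a u * (\<Sum>v\<in>R u. b u v * f v))"
      by (simp add: funpow_swap1 S R(2) del: funpow.simps(2) add: funpow_Suc_right)
    also have "\<dots> = (\<Sum>u\<in>S. a u * (\<Sum>v\<in>?U. (if v \<in> R u then b u v else 0) * f v))"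
      by (intro sum.cong refl arg_cong2[where f
        = "(*)"] sum.mono_neutral_cong_left) (use S R in auto)
    also have "\<dots> = (\<Sum>v\<in>?U. \<Sum>u\<in>S. a u * ((if v \<in> R u then b u v else 0) * f v))"
      unfolding sum_distrib_left by (rule sum.swap)
    finally show ?thesis by (simp add: sum_distrib_right mult.assoc)
  qed
  then show ?case using S(1) R(1) by (intro exI[of _ ?U] exI[of _ "\<lambda>v. \<Sum>u\<in>S. a u
    * (if v \<in> R u then b u v else 0)"]) auto
qed

lemma fock_steps_commute:
  "(fock_step \<kappa> ^^ n) (\<lambda>v. fock_step \<kappa> (\<lambda>u. F u v) x) y
      = fock_step \<kappa> (\<lambda>u. (fock_step \<kappa> ^^ n) (\<lambda>v. F u v) y) x"
proof -
  obtain S a where S: "\<And>f. (fock_step \<kappa> ^^ n) f y = (\<Sum>v\<in>S. a v * f v)"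
    using fock_steps_combination by metis
  show ?thesis unfolding S by (simp add: fock_step_sum)
qed

lemma fock_step_symmetric:
  "fock_step \<kappa> (fock_inner (shift2 \<kappa>) v) w = fock_step \<kappa> (\<lambda>u. fock_inner (shift2 \<kappa>) u w) v"
  by (cases v; cases w) (simp_all add: fock_step_def shift2_def add.commute)

text \<open>
  Creation and annihilation are adjoint to each other and the other two parts are symmetric;
  the powers follow by moving one factor at a time to the other side.
\<close>

lemma fock_steps_symmetric:
  "(fock_step \<kappa> ^^ n) (fock_inner (shift2 \<kappa>) v) w
      = (fock_step \<kappa> ^^ n) (\<lambda>u. fock_inner (shift2 \<kappa>) u w) v"
proof (induction n arbitrary: v)
  case (Suc n)
  let ?K = "fock_inner (shift2 \<kappa>)" and ?L = "fock_step \<kappa>"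
  have sym: "?L (?K v) = (\<lambda>w. ?L (\<lambda>u. ?K u w) v)" by (rule ext) (rule fock_step_symmetric)
  have "(?L ^^ Suc n) (?K v) w = (?L ^^ n) (\<lambda>w'. ?L (\<lambda>u. ?K u w') v) w"
    unfolding funpow_Suc_right comp_def sym ..
  also have "\<dots> = ?L (\<lambda>u. (?L ^^ n) (?K u) w) v" by (rule fock_steps_commute)
  also have "\<dots> = (?L ^^ Suc n) (\<lambda>u. ?K u w) v" by (simp add: Suc)
  finally show ?case .
qed simp

text \<open>
  By symmetry the \<open>(i + j)\<close>-th vacuum moment is \<open>\<langle>a\<^sup>i \<Omega>, a\<^sup>j \<Omega>\<rangle>\<close>, a Gram matrix.
\<close>

lemma fock_vacuum_psd:
  assumes "hadamard_psd (shift2 \<kappa>)"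
  shows "psd_on {..N} (\<lambda>i j. (fock_step \<kappa> ^^ (i + j)) (\<lambda>u. if u = [] then 1 else 0) [])"
proof -
  let ?K = "fock_inner (shift2 \<kappa>)" and ?L = "fock_step \<kappa>"
  have K0: "?K u [] = (if u = [] then 1 else 0)" for u by (cases u) auto
  have "\<forall>i. \<exists>S a. finite S \<and> (\<forall>f. (?L ^^ i) f [] = (\<Sum>u\<in>S. a u * f u))"
    using fock_steps_combination by blast
  then obtain S' a' where S': "\<And>i. finite (S' i)" "\<And>i f. (?L ^^ i) f [] = (\<Sum>u\<in>S' i. a' i u * f u)"
    by metis
  define S where "S = (\<Union>i\<le>N. S' i)"
  define a where "a i u = (if u \<in> S' i then a' i u else 0)" for i u
  have finS: "finite S" using S' by (auto simp: S_def)
  have S: "(?L ^^ i) f [] = (\<Sum>u\<in>S. a i u * f u)" if "i \<le> N" for i f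
    unfolding S'(2) by (rule sum.mono_neutral_cong_left) (use finS that in \<open>auto simp: a_def S_def\<close>)
  have m: "(?L ^^ (i + j)) (\<lambda>u. if u = [] then 1 else 0) [] = (\<Sum>u\<in>S. \<Sum>v\<in>S. a i u * a j v * ?K u v)"
    if "i \<le> N" "j \<le> N" for i j
  proof -
    have "(?L ^^ (i + j)) (\<lambda>u. ?K u []) [] = (?L ^^ i) (\<lambda>v. (?L ^^ j) (\<lambda>u. ?K u []) v) []"
      by (simp add: funpow_add)
    also have "\<dots> = (?L ^^ i) (\<lambda>v. (?L ^^ j) (?K v) []) []" by (simp add: fock_steps_symmetric)
    also have "\<dots> = (\<Sum>u\<in>S. a i u * (\<Sum>v\<in>S. a j v * ?K u v))" by (simp add: S that)
    finally show ?thesis by (simp add: K0 sum_distrib_left mult.assoc)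
  qed
  show ?thesis unfolding psd_on_def
  proof
    fix c :: "nat \<Rightarrow> real"
    have "(\<Sum>i\<le>N. \<Sum>j\<le>N. c i * c j * (?L ^^ (i + j)) (\<lambda>u. if u = [] then 1 else 0) []) =
       (\<Sum>i\<le>N. \<Sum>j\<le>N. \<Sum>u\<in>S. \<Sum>v\<in>S. (c i * a i u) * (c j * a j v) * ?K u v)"
      by (simp add: m sum_distrib_left mult_ac)
    also have "\<dots> = (\<Sum>i\<le>N. \<Sum>u\<in>S. \<Sum>v\<in>S. \<Sum>j\<le>N. (c i * a i u) * (c j * a j v) * ?K u v)"
      by (intro sum.cong refl) (subst sum.swap, intro sum.cong refl, rule sum.swap)
    also have "\<dots> = (\<Sum>u\<in>S. \<Sum>v\<in>S. \<Sum>i\<le>N. \<Sum>j\<le>N. (c i * a i u) * (c j * a j v) * ?K u v)"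
      by (subst sum.swap, intro sum.cong refl, rule sum.swap)
    also have "\<dots> = (\<Sum>u\<in>S. \<Sum>v\<in>S. (\<Sum>i\<le>N. c i * a i u) * (\<Sum>j\<le>N. c j * a j v) * ?K u v)"
      unfolding sum_product by (simp only: sum_distrib_right)
    also have "\<dots> \<ge> 0"
      using psd_on_fock_inner[OF assms finS, unfolded psd_on_def, rule_format, of "\<lambda>u. \<Sum>i\<le>N. c i
        * a i u"] .
    finally show "0 \<le> (\<Sum>i\<le>N. \<Sum>j\<le>N. c i * c j * (?L ^^ (i + j)) (\<lambda>u. if u = [] then 1 else 0) [])" .
  qed
qed

text \<open>
  The ways to group a stack of height \<open>j\<close> into consecutive open blocks; an entry \<open>i\<close> of the
  list stands for a block with \<open>i + 1\<close> points, that is for the letter \<open>x\<^sup>i\<close>.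
\<close>

definition block_compositions :: "nat \<Rightarrow> nat list set" where
  "block_compositions j = {w. (\<Sum>i\<leftarrow>w. Suc i) = j}"

lemma finite_block_compositions: "finite (block_compositions j)"
proof (rule finite_subset)
  show "block_compositions j \<subseteq> {w. set w \<subseteq> {..j} \<and> length w \<le> j}"
  proof
    fix w assume w: "w \<in> block_compositions j"
    have "length w \<le> (\<Sum>i\<leftarrow>w. Suc i)" by (induction w) auto
    moreover have "i \<le> (\<Sum>i\<leftarrow>w. Suc i)" if "i \<in> set w" for i using that by (induction w) auto
    ultimately show "w \<in> {w. set w \<subseteq> {..j} \<and> length w \<le> j}" using w
      by (auto simp: block_compositions_def)
  qed
qed (rule finite_lists_length_le, simp)

lemma block_compositions_0: "block_compositions 0 = {[]}"
  by (auto simp: block_compositions_def)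

lemma sum_block_compositions_nonempty:
  "(\<Sum>w\<in>block_compositions j - {[]}. h (hd w) (tl w))
      = (\<Sum>k<j. \<Sum>u\<in>block_compositions (j - Suc k). h k u :: real)"
proof -
  have "(\<Sum>k<j. \<Sum>u\<in>block_compositions (j - Suc k). h k u)
    = (\<Sum>(k, u)\<in>(SIGMA k:{..<j}. block_compositions (j - Suc k)). h k u)"
    by (rule sum.Sigma) (auto simp: finite_block_compositions)
  also have "\<dots> = (\<Sum>w\<in>block_compositions j - {[]}. h (hd w) (tl w))"
    by (rule sum.reindex_bij_witness[of _ "\<lambda>w. (hd w, tl w)" "\<lambda>(k, u). k # u"])
      (auto simp: block_compositions_def neq_Nil_conv)
  finally show ?thesis ..
qed

text \<open>
  The stack machine decides only at the closing point which stack entries form a block,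
  whereas the Fock space operator records the open blocks from the start. Summing over all
  groupings of the stack identifies the two.
\<close>

lemma sum_block_compositions_fock:
  "(\<Sum>w\<in>block_compositions j. (fock_step \<kappa> ^^ n) (\<lambda>u. if u = [] then 1 else 0) w)
      = stack_moment \<kappa> n j"
proof (induction n arbitrary: j)
  case 0
  have "(\<Sum>w\<in>block_compositions j. if w = [] then 1 else 0 :: real)
    = (if [] \<in> block_compositions j then 1 else 0)"
    by (simp add: finite_block_compositions)
  then show ?case by (simp add: block_compositions_def)
next
  case (Suc n)
  let ?H = "(fock_step \<kappa> ^^ n) (\<lambda>u. if u = [] then 1 else 0)"
  have nil: "[] \<in> block_compositions j \<longleftrightarrow> j = 0" for j by (auto simp: block_compositions_def)
  have ne: "block_compositions (Suc j) - {[]} = block_compositions (Suc j)"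
    by (auto simp: block_compositions_def)
  have "(\<Sum>w\<in>block_compositions j. fock_step \<kappa> ?H w)
    = (\<Sum>w\<in>block_compositions j. ?H (0 # w)) + \<kappa> (Suc 0) * (\<Sum>w\<in>block_compositions j. ?H w)
     + (\<Sum>w\<in>block_compositions j. case w of [] \<Rightarrow> 0 | i # u \<Rightarrow> \<kappa> (i + 2) * ?H u + ?H (Suc i # u))"
    by (simp add: fock_step_def sum.distrib sum_distrib_left)
  also have "(\<Sum>w\<in>block_compositions j. case w of [] \<Rightarrow> 0 | i # u \<Rightarrow> \<kappa> (i + 2) * ?H u
    + ?H (Suc i # u)) =
     (\<Sum>w\<in>block_compositions j - {[]}. \<kappa> (hd w + 2) * ?H (tl w) + ?H (Suc (hd w) # tl w))"
    by (rule sum.mono_neutral_cong_right) (auto simp: finite_block_compositions neq_Nil_conv)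
  also have "\<dots> = (\<Sum>k<j. \<Sum>u\<in>block_compositions (j - Suc k). \<kappa> (k + 2) * ?H u + ?H (Suc k # u))"
    by (rule sum_block_compositions_nonempty)
  also have "\<dots> = (\<Sum>k<j. \<kappa> (Suc (Suc k)) * stack_moment \<kappa> n (j - Suc k))
    + (\<Sum>k<j. \<Sum>u\<in>block_compositions (j - Suc k). ?H (Suc k # u))"
    by (simp add: sum.distrib flip: sum_distrib_left Suc.IH)
  finally have *: "(\<Sum>w\<in>block_compositions j. fock_step \<kappa> ?H w) =
     ((\<Sum>w\<in>block_compositions j. ?H (0 # w)) + (\<Sum>k<j. \<Sum>u\<in>block_compositions (j
         - Suc k). ?H (Suc k # u))) +
     (\<kappa> (Suc 0) * stack_moment \<kappa> n j + (\<Sum>k<j. \<kappa> (Suc (Suc k)) * stack_moment \<kappa> n (j - Suc k)))"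
    by (simp add: Suc.IH)
  have "stack_moment \<kappa> n (Suc j) = (\<Sum>w\<in>block_compositions (Suc j) - {[]}. ?H (hd w # tl w))"
    unfolding ne Suc.IH[symmetric]
  proof (rule sum.cong[OF refl])
    fix w assume "w \<in> block_compositions (Suc j)"
    then have "w \<noteq> []" by (auto simp: block_compositions_def)
    then have "hd w # tl w = w" by (rule list.collapse)
    then show "?H w = ?H (hd w # tl w)" by simp
  qed
  also have "\<dots> = (\<Sum>k<Suc j. \<Sum>u\<in>block_compositions (Suc j - Suc k). ?H (k # u))"
    by (rule sum_block_compositions_nonempty)
  also have "\<dots> = (\<Sum>w\<in>block_compositions j. ?H (0 # w)) + (\<Sum>k<j. \<Sum>u\<in>block_compositions (j
    - Suc k). ?H (Suc k # u))"
    by (subst sum.lessThan_Suc_shift) simp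
  finally have 1: "(\<Sum>w\<in>block_compositions j. ?H (0 # w)) + (\<Sum>k<j. \<Sum>u\<in>block_compositions (j
    - Suc k). ?H (Suc k # u)) = stack_moment \<kappa> n (Suc j)" ..
  have 2: "\<kappa> (Suc 0) * stack_moment \<kappa> n j + (\<Sum>k<j. \<kappa> (Suc (Suc k)) * stack_moment \<kappa> n (j - Suc k)) =
      (\<Sum>k\<le>j. \<kappa> (Suc k) * stack_moment \<kappa> n (j - k))"
    by (simp only: lessThan_Suc_atMost[symmetric] sum.lessThan_Suc_shift) simp
  show ?case using * unfolding 1 2 by simp
qed

lemma stack_moment_psd:
  assumes "hadamard_psd (shift2 \<kappa>)"
  shows "psd_on {..N} (\<lambda>i j. stack_moment \<kappa> (i + j) 0)"
  using fock_vacuum_psd[OF assms, of N] sum_block_compositions_fock[where j = 0 and \<kappa> = \<kappa>]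
    by (simp add: block_compositions_0)

section \<open>The moment problem on a compact interval\<close>

text \<open>
  Here \<open>h k l\<close> stands for the integral of \<open>u\<^sup>k (1 - u)\<^sup>l\<close>; the hypothesis says
  \<open>u + (1 - u) = 1\<close>, and the identity is the binomial expansion of
  \<open>u\<^sup>j (1 - u)\<^sup>i (u + (1 - u))\<^sup>n\<close>.
\<close>

lemma sum_choose_hausdorff:
  assumes h: "\<And>k l. h k l = h (Suc k) l + h k (Suc l)"
  shows "(\<Sum>k\<le>n. real (n choose k) * h (k + j) (n - k + i)) = (h j i :: real)"
proof (induction n arbitrary: i j)
  case (Suc n)
  have "(\<Sum>k\<le>Suc n. real (Suc n choose k) * h (k + j) (Suc n - k + i)) =
     h j (Suc n + i) + (\<Sum>k\<le>n. real (Suc n choose Suc k) * h (Suc k + j) (n - k + i))"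
    by (subst sum.atMost_Suc_shift) simp
  also have "(\<Sum>k\<le>n. real (Suc n choose Suc k) * h (Suc k + j) (n - k + i)) =
     (\<Sum>k\<le>n. real (n choose k) * h (k + Suc j) (n - k + i)) + (\<Sum>k\<le>n. real (n choose Suc k)
         * h (Suc k + j) (n - k + i))"
    by (simp add: distrib_right sum.distrib)
  also have "(\<Sum>k\<le>n. real (n choose k) * h (k + Suc j) (n - k + i)) = h (Suc j) i" by (rule Suc.IH)
  also have "(\<Sum>k\<le>n. real (n choose Suc k) * h (Suc k + j) (n - k + i)) =
      (\<Sum>k<n. real (n choose Suc k) * h (Suc k + j) (n - Suc k + Suc i))"
  proof (rule sum.mono_neutral_cong_right)
    fix k assume "k \<in> {..<n}"
    then have "n - k + i = n - Suc k + Suc i" by auto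
    then show "real (n choose Suc k) * h (Suc k + j) (n - k + i)
      = real (n choose Suc k) * h (Suc k + j) (n - Suc k + Suc i)" by simp
  qed auto
  also have "h j (Suc n + i) + (h (Suc j) i + \<dots>)
    = h (Suc j) i + (\<Sum>k<Suc n. real (n choose k) * h (k + j) (n - k + Suc i))"
    by (subst sum.lessThan_Suc_shift) simp
  also have "(\<Sum>k<Suc n. real (n choose k) * h (k + j) (n - k + Suc i)) = h j (Suc i)"
    unfolding lessThan_Suc_atMost by (rule Suc.IH)
  also have "h (Suc j) i + h j (Suc i) = h j i" using h[of j i] by simp
  finally show ?case .
qed simp

lemma sum_choose_choose_hausdorff:
  assumes h: "\<And>k l. h k l = h (Suc k) l + h k (Suc l)" and "r \<le> N"
  shows "(\<Sum>k\<le>N. real (N choose k) * h k (N - k) * real (k choose r)) = real (N choose r) * h r 0"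
proof -
  have "(\<Sum>k\<le>N. real (N choose k) * h k (N - k) * real (k choose r)) =
      (\<Sum>k=r..N. real (N choose k) * h k (N - k) * real (k choose r))"
    by (rule sum.mono_neutral_right) (auto simp: binomial_eq_0)
  also have "\<dots> = (\<Sum>k\<le>N - r. real (N choose (k + r)) * h (k + r) (N - (k + r)) * real ((k
    + r) choose r))"
    by (rule sum.reindex_bij_witness[of _ "\<lambda>k. k + r" "\<lambda>k. k - r"]) (use assms(2) in auto)
  also have "\<dots> = (\<Sum>k\<le>N - r. real (N choose r) * (real ((N - r) choose k) * h (k + r) (N - r - k
    + 0)))"
  proof (rule sum.cong[OF refl])
    fix k assume k: "k \<in> {..N - r}"
    have "(N choose (k + r)) * ((k + r) choose r) = (N choose r) * ((N - r) choose k)"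
      using choose_mult[of r "k + r" N] k assms(2) by simp
    then have "real (N choose (k + r)) * real ((k + r) choose r)
      = real (N choose r) * real ((N - r) choose k)"
      by (metis of_nat_mult)
    moreover have "N - (k + r) = N - r - k + 0" by simp
    ultimately show "real (N choose (k + r)) * h (k + r) (N - (k + r)) * real ((k + r) choose r) =
        real (N choose r) * (real ((N - r) choose k) * h (k + r) (N - r - k + 0))"
      by (simp add: mult_ac)
  qed
  also have "\<dots> = real (N choose r) * h r 0"
    by (simp only: sum_distrib_left[symmetric] sum_choose_hausdorff[where h = h, OF h])
  finally show ?thesis .
qed

text \<open>
  Both are products of \<open>r\<close> factors of absolute value at most \<open>1\<close>, and the \<open>i\<close>-th factors
  differ by \<open>i / N\<close>.
\<close>

lemma power_falling_factorial_close:
  assumes "k \<le> N" "r \<le> N" "N > 0"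
  shows "\<bar>(real k / real N) ^ r - fact r * real (k choose r) / real N ^ r\<bar> \<le> (real r)\<^sup>2 / real N"
proof -
  have e: "fact r * real (k choose r) / real N ^ r = (\<Prod>i<r. (real k - real i) / real N)"
    using gbinomial_mult_fact[of r "real k"] by (simp add: binomial_gbinomial prod_dividef
      atLeast0LessThan)
  have "norm ((\<Prod>i<r. real k / real N) - (\<Prod>i<r. (real k - real i) / real N)) \<le>
     (\<Sum>i<r. norm (real k / real N - (real k - real i) / real N))"
    by (rule norm_prod_diff) (use assms in \<open>auto simp: abs_le_iff divide_le_eq le_divide_eq\<close>)
  also have "\<dots> = (\<Sum>i<r. real i / real N)" by (intro sum.cong refl) (simp add: diff_divide_distrib)
  also have "\<dots> \<le> (\<Sum>i<r. real r / real N)" by (intro sum_mono divide_right_mono) auto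
  also have "\<dots> = (real r)\<^sup>2 / real N" by (simp add: power2_eq_square)
  finally show ?thesis unfolding e by simp
qed

text \<open>
  Dual to the Bernstein operator: integrating \<open>f\<close> gives the functional applied to the \<open>N\<close>-th
  Bernstein polynomial of \<open>f\<close>.
\<close>

definition bernstein_measure :: "(nat \<Rightarrow> nat \<Rightarrow> real) \<Rightarrow> nat \<Rightarrow> real measure" where
  "bernstein_measure h N = distr (density (count_space {..N})
     (\<lambda>k. ennreal (real (N choose k) * h k (N - k)))) borel (\<lambda>k. real k / real N)"

lemma integral_bernstein_measure:
  assumes "\<And>k l. h k l \<ge> 0" and f: "f \<in> borel_measurable borel"
  shows "(LINT x|bernstein_measure h N. f x :: real)
    = (\<Sum>k\<le>N. real (N choose k) * h k (N - k) * f (real k / real N))"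
proof -
  have "(LINT x|bernstein_measure h N. f x) =
      (LINT k|density (count_space {..N}) (\<lambda>k. ennreal (real (N choose k) * h k (N
          - k))). f (real k / real N))"
    unfolding bernstein_measure_def by (rule integral_distr) (use f in auto)
  also have "\<dots> = (LINT k|count_space {..N}. (real (N choose k) * h k (N - k)) *\<^sub>R f (real k
    / real N))"
    by (rule integral_density) (use assms in auto)
  also have "\<dots> = (\<Sum>k\<le>N. (real (N choose k) * h k (N - k)) *\<^sub>R f (real k / real N))"
    by (rule lebesgue_integral_count_space_finite) simp
  finally show ?thesis by simp
qed

lemma real_distribution_bernstein_measure:
  assumes h: "\<And>k l. h k l = h (Suc k) l + h k (Suc l)" "\<And>k l. h k l \<ge> 0" "h 0 0 = 1"
  shows "real_distribution (bernstein_measure h N)"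
proof -
  let ?D = "density (count_space {..N}) (\<lambda>k. ennreal (real (N choose k) * h k (N - k)))"
  have "emeasure ?D (space ?D) = (\<Sum>k\<le>N. ennreal (real (N choose k) * h k (N - k)))"
    by (simp add: emeasure_density nn_integral_count_space_finite)
  also have "\<dots> = ennreal (\<Sum>k\<le>N. real (N choose k) * h k (N - k))"
    by (rule sum_ennreal) (simp add: h(2))
  also have "\<dots> = 1" using sum_choose_hausdorff[where h = h and n = N and j = 0
    and i = 0, OF h(1)] h(3) by simp
  finally have "prob_space ?D" by (rule prob_spaceI)
  then have "prob_space (bernstein_measure h N)"
    unfolding bernstein_measure_def by (rule prob_space.prob_space_distr) simp
  then show ?thesis
    by (simp add: real_distribution_def real_distribution_axioms_def bernstein_measure_def)
qed

text \<open>
  The factorial moments of the Bernstein measures are exact, and they differ from the ordinary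
  ones by \<open>O(1/N)\<close>.
\<close>

lemma bernstein_moment_limit:
  assumes h: "\<And>k l. h k l = h (Suc k) l + h k (Suc l)" "\<And>k l. h k l \<ge> 0" "h 0 0 = 1"
  shows "(\<lambda>N. \<Sum>k\<le>N. real (N choose k) * h k (N - k) * (real k / real N) ^ r) \<longlonglongrightarrow> h r 0"
proof -
  let ?w = "\<lambda>N k. real (N choose k) * h k (N - k)"
  have one: "(\<Sum>k\<le>N. ?w N k) = 1" for N
    using sum_choose_hausdorff[where h = h and n = N and j = 0 and i = 0, OF h(1)] h(3) by simp
  have bound: "\<bar>(\<Sum>k\<le>N. ?w N k * (real k / real N) ^ r) - h r 0\<bar> \<le> ((real r)\<^sup>2 + (real r)\<^sup>2
    * h r 0) * (1 / real N)"
    if N: "N \<ge> r" "N > 0" for N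
  proof -
    let ?c = "fact r * real (N choose r) / real N ^ r"
    have "(\<Sum>k\<le>N. ?w N k * (fact r * real (k choose r) / real N ^ r))
      = fact r / real N ^ r * (\<Sum>k\<le>N. ?w N k * real (k choose r))"
      by (simp add: sum_distrib_left mult_ac)
    then have fm: "(\<Sum>k\<le>N. ?w N k * (fact r * real (k choose r) / real N ^ r)) = ?c * h r 0"
      using sum_choose_choose_hausdorff[where h = h, OF h(1) N(1)] by simp
    have "\<bar>(\<Sum>k\<le>N. ?w N k * (real k / real N) ^ r) - ?c * h r 0\<bar> =
       \<bar>\<Sum>k\<le>N. ?w N k * ((real k / real N) ^ r - fact r * real (k choose r) / real N ^ r)\<bar>"
      unfolding fm[symmetric] by (simp add: right_diff_distrib sum_subtractf)
    also have "\<dots> \<le> (\<Sum>k\<le>N. \<bar>?w N k * ((real k / real N) ^ r - fact r * real (k choose r)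
      / real N ^ r)\<bar>)"
      by (rule sum_abs)
    also have "\<dots> \<le> (\<Sum>k\<le>N. ?w N k * ((real r)\<^sup>2 / real N))"
    proof (rule sum_mono)
      fix k assume "k \<in> {..N}"
      then have "?w N k * \<bar>(real k / real N) ^ r - fact r * real (k choose r)
        / real N ^ r\<bar> \<le> ?w N k * ((real r)\<^sup>2 / real N)"
        by (intro mult_left_mono power_falling_factorial_close) (use N h(2) in auto)
      then show "\<bar>?w N k * ((real k / real N) ^ r - fact r * real (k choose r)
        / real N ^ r)\<bar> \<le> ?w N k * ((real r)\<^sup>2 / real N)"
        using h(2) by (simp add: abs_mult)
    qed
    also have "\<dots> = (real r)\<^sup>2 / real N" by (simp only: sum_distrib_right[symmetric] one mult_1)
    finally have 1: "\<bar>(\<Sum>k\<le>N. ?w N k * (real k / real N) ^ r) - ?c * h r 0\<bar> \<le> (real r)\<^sup>2 / real N" .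
    have "\<bar>1 - ?c\<bar> \<le> (real r)\<^sup>2 / real N" using power_falling_factorial_close[of N N r] N by simp
    then have "\<bar>1 - ?c\<bar> * h r 0 \<le> (real r)\<^sup>2 / real N * h r 0" by (rule mult_right_mono) (rule h(2))
    moreover have "\<bar>?c * h r 0 - h r 0\<bar> = \<bar>1 - ?c\<bar> * h r 0"
    proof -
      have "?c * h r 0 - h r 0 = - ((1 - ?c) * h r 0)" by (simp add: algebra_simps)
      then show ?thesis using h(2)[of r 0] by (simp add: abs_mult)
    qed
    ultimately have 2: "\<bar>?c * h r 0 - h r 0\<bar> \<le> (real r)\<^sup>2 / real N * h r 0" by linarith
    have "\<bar>(\<Sum>k\<le>N. ?w N k * (real k / real N) ^ r) - h r 0\<bar> \<le> (real r)\<^sup>2 / real N + (real r)\<^sup>2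
      / real N * h r 0"
    proof -
      have tri: "\<bar>a - c\<bar> \<le> e + f" if "\<bar>a - b\<bar> \<le> e" "\<bar>b - c\<bar> \<le> f" for a b c e f :: real using that
        by linarith
      show ?thesis by (rule tri[OF 1 2])
    qed
    then show ?thesis by (simp add: algebra_simps)
  qed
  have "(\<lambda>N. (\<Sum>k\<le>N. ?w N k * (real k / real N) ^ r) - h r 0) \<longlonglongrightarrow> 0"
  proof (rule tendsto_rabs_zero_cancel, rule tendsto_sandwich[where f = "\<lambda>_. 0"])
    show "\<forall>\<^sub>F N in sequentially. \<bar>(\<Sum>k\<le>N. ?w N k * (real k / real N) ^ r) - h r 0\<bar> \<le> ((real r)\<^sup>2
      + (real r)\<^sup>2 * h r 0) * (1 / real N)"
      using eventually_ge_at_top[of "Suc r"] by eventually_elim (rule bound, auto)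
    show "(\<lambda>N. ((real r)\<^sup>2 + (real r)\<^sup>2 * h r 0) * (1 / real N)) \<longlonglongrightarrow> 0"
      by (rule tendsto_mult_right_zero) (rule lim_1_over_n)
  qed auto
  then show ?thesis by (simp add: LIM_zero_iff)
qed

text \<open>
  The Bernstein measures live on \<open>[0, 1]\<close>, so a subsequence converges weakly; truncating \<open>x\<^sup>r\<close>
  outside \<open>[0, 1]\<close> makes it a bounded continuous test function without changing its integrals.
\<close>

theorem hausdorff_moment_problem:
  assumes h: "\<And>k l. h k l = h (Suc k) l + h k (Suc l)" "\<And>k l. h k l \<ge> 0" "h 0 0 = 1"
  obtains \<mu> where "real_distribution \<mu>" "AE x in \<mu>. x \<in> {0..1}" "\<And>r. (LINT x|\<mu>. x ^ r) = h r 0"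
proof -
  let ?\<mu> = "bernstein_measure h"
  note dist = real_distribution_bernstein_measure[OF h]
  have I: "(LINT x|?\<mu> N. f x) = (\<Sum>k\<le>N. real (N choose k) * h k (N - k) * f (real k / real N))"
    if "f \<in> borel_measurable borel" for f N by (rule integral_bernstein_measure[OF h(2) that])
  have unit: "real k / real N \<in> {0..1}" if "k \<le> N" for k N using that by (auto simp: divide_le_eq_1)
  have "measure (?\<mu> N) {-1<..1} = 1" for N
  proof -
    interpret real_distribution "?\<mu> N" by (rule dist)
    have "measure (?\<mu> N) {-1<..1} = (LINT x|?\<mu> N. indicator {-1<..1} x)" by simp
    also have "\<dots> = (\<Sum>k\<le>N. real (N choose k) * h k (N - k) * indicator {-1<..1} (real k / real N))"
      by (rule I) simp
    also have "\<dots> = (\<Sum>k\<le>N. real (N choose k) * h (k + 0) (N - k + 0))"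
      using unit by (intro sum.cong refl) (auto simp: indicator_def intro: less_le_trans[of _ 0])
    finally show ?thesis using sum_choose_hausdorff[where h = h and n = N and j = 0
      and i = 0, OF h(1)] h(3) by simp
  qed
  then have "tight ?\<mu>"
    unfolding tight_def using dist by (intro conjI allI impI exI[of _ "-1"] exI[of _ 1]) simp_all
  then obtain r M where r: "strict_mono r" and M: "real_distribution M"
    and wc: "weak_conv_m (?\<mu> \<circ> id \<circ> r) M"
    using tight_imp_convergent_subsubsequence[of ?\<mu> id] by (auto simp: strict_mono_def)
  interpret M: real_distribution M by (rule M)
  have conv: "(\<lambda>n. LINT x|?\<mu> (r n). f x) \<longlonglongrightarrow> (LINT x|M. f x)"
    if "\<And>x. isCont f x" "\<And>x. norm (f x) \<le> B" for f :: "real \<Rightarrow> real" and B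
    using weak_conv_imp_integral_bdd_continuous_conv[OF _ M wc that] dist by simp
  have AE: "AE x in M. x \<in> {0..1}"
  proof -
    \<comment> \<open>the truncated distance from \<open>[0, 1]\<close>: bounded, continuous, and zero exactly there\<close>
    let ?f = "\<lambda>x :: real. min 1 (max 0 (max (- x) (x - 1)))"
    have c: "continuous_on UNIV ?f" by (intro continuous_intros)
    then have m: "?f \<in> borel_measurable borel" by (rule borel_measurable_continuous_onI)
    have "(\<lambda>n. LINT x|?\<mu> (r n). ?f x) \<longlonglongrightarrow> (LINT x|M. ?f x)"
      by (rule conv[of _ 1]) (use c in \<open>auto simp: continuous_on_eq_continuous_at\<close>)
    moreover have "(LINT x|?\<mu> n. ?f x) = 0" for n
    proof -
      have f0: "?f x = 0" if "x \<in> {0..1}" for x :: real using that by auto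
      show ?thesis unfolding I[OF m] by (intro sum.neutral ballI, subst f0, rule unit) auto
    qed
    ultimately have "(LINT x|M. ?f x) = 0" using LIMSEQ_unique[OF tendsto_const[of 0]] by simp
    moreover have "integrable M ?f"
      by (rule M.integrable_const_bound[of _ 1]) (use m in auto)
    ultimately have "AE x in M. ?f x = 0" by (subst (asm) integral_nonneg_eq_0_iff_AE) auto
    then show ?thesis by eventually_elim (auto simp: min_def max_def split: if_splits)
  qed
  have "(LINT x|M. x ^ j) = h j 0" for j
  proof -
    let ?f = "\<lambda>x :: real. (max 0 (min 1 x)) ^ j"
    have c: "continuous_on UNIV ?f" by (intro continuous_intros)
    then have m: "?f \<in> borel_measurable borel" by (rule borel_measurable_continuous_onI)
    have "(\<lambda>n. LINT x|?\<mu> (r n). ?f x) \<longlonglongrightarrow> (LINT x|M. ?f x)"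
      by (rule conv[of _ 1]) (use c in \<open>auto simp: continuous_on_eq_continuous_at power_le_one\<close>)
    moreover have "(LINT x|?\<mu> n. ?f x) = (\<Sum>k\<le>n. real (n choose k) * h k (n - k) * (real k
      / real n) ^ j)" for n
    proof -
      have fx: "?f x = x ^ j" if "x \<in> {0..1}" for x :: real using that by auto
      show ?thesis unfolding I[OF m] by (intro sum.cong refl, subst fx, rule unit) auto
    qed
    ultimately have "(\<lambda>n. \<Sum>k\<le>r n. real (r n choose k) * h k (r n - k) * (real k
      / real (r n)) ^ j) \<longlonglongrightarrow> (LINT x|M. ?f x)"
      by simp
    moreover have "(\<lambda>n. \<Sum>k\<le>r n. real (r n choose k) * h k (r n - k) * (real k
      / real (r n)) ^ j) \<longlonglongrightarrow> h j 0"
      using LIMSEQ_subseq_LIMSEQ[OF bernstein_moment_limit[OF h] r] by (simp add: comp_def)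
    ultimately have "(LINT x|M. ?f x) = h j 0" by (rule LIMSEQ_unique)
    moreover have "(LINT x|M. ?f x) = (LINT x|M. x ^ j)"
    proof (rule integral_cong_AE)
      show "AE x in M. ?f x = x ^ j" using AE by eventually_elim auto
    qed (use m in auto)
    ultimately show ?thesis by simp
  qed
  then show ?thesis using that[OF M AE] by blast
qed

definition moment_functional :: "(nat \<Rightarrow> real) \<Rightarrow> real poly \<Rightarrow> real" where
  "moment_functional m p = (\<Sum>i\<le>degree p. coeff p i * m i)"

lemma moment_functional_le:
  assumes "degree p \<le> N" shows "moment_functional m p = (\<Sum>i\<le>N. coeff p i * m i)"
  unfolding moment_functional_def
  by (rule sum.mono_neutral_left) (use assms in \<open>auto simp: coeff_eq_0\<close>)

lemma moment_functional_add: "moment_functional m (p + q)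
  = moment_functional m p + moment_functional m q"
proof -
  let ?N = "max (degree p) (degree q)"
  have "degree (p + q) \<le> ?N" by (rule degree_add_le) auto
  then show ?thesis
    by (simp add: moment_functional_le[of _ ?N] distrib_right sum.distrib)
qed

lemma moment_functional_0: "moment_functional m 0 = 0"
  by (simp add: moment_functional_def)

lemma moment_functional_sum: "moment_functional m (\<Sum>i\<in>A. f i) = (\<Sum>i\<in>A. moment_functional m (f i))"
  by (induction A rule: infinite_finite_induct) (simp_all add: moment_functional_add
    moment_functional_0)

lemma moment_functional_smult: "moment_functional m (smult c p) = c * moment_functional m p"
  by (simp add: moment_functional_le[of "smult c p"
    "degree p"] moment_functional_def sum_distrib_left mult.assoc)

lemma moment_functional_monom: "moment_functional m (monom c n) = c * m n"
proof -
  have "moment_functional m (monom c n) = (\<Sum>i\<le>n. coeff (monom c n) i * m i)"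
    by (rule moment_functional_le) (simp add: degree_monom_le)
  then show ?thesis by (simp add: if_distrib[of "\<lambda>x. x * _"] cong: if_cong)
qed

lemma moment_functional_mult:
  "moment_functional m (p * q) = (\<Sum>i\<le>degree p. \<Sum>j\<le>degree q. coeff p i * coeff q j * m (i + j))"
proof -
  have "p * q = (\<Sum>i\<le>degree p. monom (coeff p i) i) * (\<Sum>j\<le>degree q. monom (coeff q j) j)"
    by (simp only: poly_as_sum_of_monoms)
  also have "\<dots> = (\<Sum>i\<le>degree p. \<Sum>j\<le>degree q. monom (coeff p i * coeff q j) (i + j))"
    by (simp add: sum_product mult_monom)
  finally show ?thesis by (simp only: moment_functional_sum moment_functional_monom)
qed

text \<open>
  Iterating the Cauchy-Schwarz inequality gives \<open>x\<^sub>n\<^bsup>2^k\<^esup> \<le> x\<^bsub>2^k n\<^esub>\<close> for \<open>x\<^sub>n = |t\<^sub>n| / (t\<^sub>0 K\<^sup>n)\<close>,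
  and the right-hand side stays bounded in \<open>k\<close>, so the constant \<open>D\<close> can be removed.
\<close>

lemma power_dominated_imp_le:
  fixes t :: "nat \<Rightarrow> real"
  assumes cs: "\<And>n. (t n)\<^sup>2 \<le> t 0 * t (2 * n)" and gr: "\<And>n. \<bar>t n\<bar> \<le> D * K ^ n" and K: "K > 0"
    and t0: "t 0 \<ge> 0"
  shows "\<bar>t n\<bar> \<le> t 0 * K ^ n"
proof (cases "t 0 = 0")
  case True
  then show ?thesis using cs[of n] by simp
next
  case False
  then have t0: "t 0 > 0" using t0 by simp
  define x where "x n = \<bar>t n\<bar> / (t 0 * K ^ n)" for n
  have x0: "x n \<ge> 0" for n using t0 K by (simp add: x_def)
  have x2: "(x n)\<^sup>2 \<le> x (2 * n)" for n
  proof -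
    have "(t n)\<^sup>2 \<le> t 0 * \<bar>t (2 * n)\<bar>" using cs[of n] t0
      by (meson abs_ge_self mult_left_mono order_trans less_imp_le)
    then have "(t n)\<^sup>2 / (t 0 * K ^ n)\<^sup>2 \<le> t 0 * \<bar>t (2 * n)\<bar> / (t 0 * K ^ n)\<^sup>2"
      by (rule divide_right_mono) simp
    also have "\<dots> = x (2 * n)" using t0 by (simp add: x_def power2_eq_square power_mult_distrib
      mult_2 power_add)
    finally show ?thesis by (simp add: x_def power_divide)
  qed
  have xb: "x n \<le> D / t 0" for n using gr[of n] t0 K by (simp add: x_def field_simps)
  have "x n \<le> 1"
  proof (rule ccontr)
    assume "\<not> x n \<le> 1"
    then obtain N where N: "D / t 0 < x n ^ N" using real_arch_pow[of "x n"] by auto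
    have "x n ^ (2 ^ k) \<le> x (2 ^ k * n)" for k
    proof (induction k)
      case (Suc k)
      have "x n ^ 2 ^ Suc k = (x n ^ 2 ^ k)\<^sup>2" by (simp add: power_mult[symmetric] mult.commute)
      also have "\<dots> \<le> (x (2 ^ k * n))\<^sup>2" by (rule power_mono[OF Suc]) (simp add: x0)
      also have "\<dots> \<le> x (2 ^ Suc k * n)" using x2[of "2 ^ k * n"] by (simp add: mult.assoc)
      finally show ?case .
    qed simp
    then have "x n ^ (2 ^ N) \<le> D / t 0" using xb order_trans by blast
    moreover have "x n ^ N \<le> x n ^ (2 ^ N)"
      by (rule power_increasing) (use \<open>\<not> x n \<le> 1\<close> in \<open>auto intro: less_imp_le[OF less_exp]\<close>)
    ultimately show False using N by simp
  qed
  then show ?thesis using t0 K by (simp add: x_def)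
qed

text \<open>
  Growth confines the functional to \<open>[-K, K]\<close>: by \<open>power_dominated_imp_le\<close> the form
  \<open>p \<mapsto> L(q\<^sup>2 p)\<close> is nonnegative at \<open>K + x\<close>, \<open>K - x\<close> and \<open>K\<^sup>2 - x\<^sup>2\<close>. Every \<open>(K + x)\<^sup>k (K - x)\<^sup>l\<close> is
  a square times \<open>1\<close> or one of these, depending on the parities, so after rescaling to
  \<open>[0, 1]\<close> the Hausdorff moment problem applies.
\<close>

theorem compact_moment_problem:
  assumes m0: "m 0 = 1" and psd: "\<And>N. psd_on {..N} (\<lambda>i j. m (i + j))"
    and gr: "\<And>n. \<bar>m n\<bar> \<le> K ^ n" and K: "K > 0"
  obtains \<mu> where "compactly_supported_prob \<mu>" "\<And>n. moment \<mu> n = m n"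
proof -
  let ?L = "moment_functional m"
  have sq: "?L (p * p) \<ge> 0" for p
    using psd[of "degree p"] unfolding moment_functional_mult psd_on_def by blast
  have key: "\<bar>?L (q * q * monom 1 n)\<bar> \<le> ?L (q * q) * K ^ n" for q n
  proof -
    define t where "t n = ?L (q * q * monom 1 n)" for n
    have t0: "t 0 = ?L (q * q)" by (simp add: t_def)
    have quad: "0 \<le> a\<^sup>2 * t 0 + 2 * a * b * t n + b\<^sup>2 * t (2 * n)" for a b n
    proof -
      have "(q * ([:a:] + monom b n)) * (q * ([:a:] + monom b n)) =
         smult (a\<^sup>2) (q * q * monom 1 0) + (smult (a * b) (q * q * monom 1 n) + smult (a * b) (q
           * q * monom 1 n)) + smult (b\<^sup>2) (q * q * monom 1 (2 * n))"
      proof -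
        have "[:a:] + monom b n = smult a 1 + smult b (monom 1 n)" by (simp add: smult_monom)
        moreover have "monom 1 (2 * n) = monom 1 n * (monom 1 n :: real poly)"
          by (simp add: mult_monom mult_2)
        ultimately show ?thesis by (simp add: algebra_simps power2_eq_square smult_add_left)
      qed
      then have "?L ((q * ([:a:] + monom b n)) * (q * ([:a:] + monom b n)))
        = a\<^sup>2 * t 0 + 2 * a * b * t n + b\<^sup>2 * t (2 * n)"
        by (simp only: moment_functional_add moment_functional_smult flip: t_def)
      then show ?thesis using sq by metis
    qed
    have pos: "t (2 * n) \<ge> 0" for n using quad[of 0 1 n] by simp
    have "(t n)\<^sup>2 \<le> t 0 * t (2 * n)" for n
    proof (cases "t 0 = 0")
      case True
      have "0 \<le> - ((t n)\<^sup>2 * (t (2 * n) + 2))"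
        \<comment> \<open>for \<open>t 0 = 0\<close> the form is linear in \<open>a\<close>, and this choice of \<open>a\<close> forces \<open>t n = 0\<close>\<close>
        using quad[of "- (t (2 * n) + 1)" "t n" n] True
          by (simp add: algebra_simps power2_eq_square)
      then have "(t n)\<^sup>2 * (t (2 * n) + 2) \<le> 0" by simp
      then have "(t n)\<^sup>2 \<le> 0" using pos[of n] by (simp add: mult_le_0_iff)
      then show ?thesis using True by simp
    next
      case False
      then have "t 0 > 0" using pos[of 0] by simp
      have "0 \<le> t 0 * (t 0 * t (2 * n) - (t n)\<^sup>2)"
        \<comment> \<open>the minimiser of the quadratic form, scaled by \<open>t 0\<close>\<close>
        using quad[of "- t n" "t 0" n] by (simp add: algebra_simps power2_eq_square)
      then show ?thesis using \<open>t 0 > 0\<close> by (simp add: zero_le_mult_iff)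
    qed
    moreover have "\<bar>t n\<bar> \<le> (\<Sum>i\<le>degree (q * q). \<bar>coeff (q * q) i\<bar> * K ^ i) * K ^ n" for n
    proof -
      have "t n = (\<Sum>i\<le>degree (q * q). \<Sum>j\<le>n. coeff (q * q) i * coeff (monom 1 n) j * m (i + j))"
        unfolding t_def moment_functional_mult by (simp add: degree_monom_eq)
      also have "\<dots> = (\<Sum>i\<le>degree (q * q). coeff (q * q) i * m (i + n))"
        by (simp add: if_distrib[of "\<lambda>x. x * _"] if_distrib[of "\<lambda>x. _ * x"] cong: if_cong)
      finally have "\<bar>t n\<bar> \<le> (\<Sum>i\<le>degree (q * q). \<bar>coeff (q * q) i * m (i + n)\<bar>)"
        by (simp only: sum_abs)
      also have "\<dots> \<le> (\<Sum>i\<le>degree (q * q). \<bar>coeff (q * q) i\<bar> * K ^ (i + n))"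
        by (intro sum_mono) (simp add: abs_mult mult_left_mono gr)
      finally show ?thesis by (simp add: sum_distrib_right power_add mult.assoc)
    qed
    ultimately have "\<bar>t n\<bar> \<le> t 0 * K ^ n"
      by (rule power_dominated_imp_le) (use K pos[of 0] in auto)
    then show ?thesis by (simp only: t0 t_def[of n])
  qed
  let ?P = "[:K, 1:]" and ?Q = "[:K, - 1:]"
  have lin: "?L (p * [:a, b:]) = a * ?L p + b * ?L (p * monom 1 1)" for p a b
  proof -
    have "p * [:a, b:] = smult a p + smult b (p * monom 1 1)"
      by (simp add: monom_Suc algebra_simps)
    then show ?thesis by (simp add: moment_functional_add moment_functional_smult)
  qed
  have P: "?L (q * q * ?P) \<ge> 0" and Q: "?L (q * q * ?Q) \<ge> 0" for q
    using key[of q 1] unfolding lin by (auto simp: abs_le_iff mult.commute)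
  have PQ: "?L (q * q * (?P * ?Q)) \<ge> 0" for q
  proof -
    have "q * q * (?P * ?Q) = smult (K\<^sup>2) (q * q) + smult (- 1) (q * q * monom 1 2)"
      by (simp add: monom_altdef algebra_simps power2_eq_square smult_add_left)
    then have "?L (q * q * (?P * ?Q)) = K\<^sup>2 * ?L (q * q) - ?L (q * q * monom 1 2)"
      by (simp only: moment_functional_add moment_functional_smult)
    then show ?thesis using key[of q 2] by (simp add: abs_le_iff mult.commute)
  qed
  have pos: "?L (?P ^ k * ?Q ^ l) \<ge> 0" for k l
  proof -
    define q where "q = ?P ^ (k div 2) * ?Q ^ (l div 2)"
    have split: "x ^ k = x ^ (k div 2) * x ^ (k div 2) * x ^ (k mod 2)" for x :: "real poly" and k
      by (metis div_mult_mod_eq mult_2_right power_add)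
    have "?P ^ k * ?Q ^ l = q * q * (?P ^ (k mod 2) * ?Q ^ (l mod 2))"
      unfolding q_def by (subst split, subst (2) split) (simp only: mult_ac)
    moreover have "k mod 2 = 0 \<or> k mod 2 = 1" "l mod 2 = 0 \<or> l mod 2 = 1" by auto
    ultimately show ?thesis using sq[of q] P[of q] Q[of q] PQ[of q] by auto
  qed
  define h where "h k l = ?L (?P ^ k * ?Q ^ l) / (2 * K) ^ (k + l)" for k l
  have h1: "h k l = h (Suc k) l + h k (Suc l)" for k l
  proof -
    have "?P ^ Suc k * ?Q ^ l + ?P ^ k * ?Q ^ Suc l = smult (2 * K) (?P ^ k * ?Q ^ l)"
    proof -
      have "?P ^ Suc k * ?Q ^ l + ?P ^ k * ?Q ^ Suc l = (?P ^ k * ?Q ^ l) * (?P + ?Q)"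
        by (simp only: power_Suc distrib_left mult_ac)
      also have "?P + ?Q = [:2 * K:]" by simp
      finally show ?thesis by simp
    qed
    then have "?L (?P ^ Suc k * ?Q ^ l) + ?L (?P ^ k * ?Q ^ Suc l) = 2 * K * ?L (?P ^ k * ?Q ^ l)"
      by (metis moment_functional_add moment_functional_smult)
    then have "h (Suc k) l + h k (Suc l) = 2 * K * ?L (?P ^ k * ?Q ^ l) / (2 * K) ^ Suc (k + l)"
      unfolding h_def by (simp only: add_Suc add_Suc_right add_divide_distrib[symmetric])
    then show ?thesis using K by (simp add: h_def)
  qed
  have h2: "h k l \<ge> 0" for k l using pos[of k l] K by (simp add: h_def)
  have h3: "h 0 0 = 1" by (simp add: h_def moment_functional_def m0)
  obtain \<nu> where \<nu>: "real_distribution \<nu>" "AE x in \<nu>. x \<in> {0..1}" "\<And>r. (LINT x|\<nu>. x ^ r) = h r 0"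
    using hausdorff_moment_problem[OF h1 h2 h3] by metis
  interpret \<nu>: real_distribution \<nu> by (rule \<nu>(1))
  \<comment> \<open>carries \<open>[0, 1]\<close> to \<open>[-K, K]\<close> and \<open>u\<close> to \<open>x\<close> with \<open>2 K u = K + x\<close>\<close>
  define g where "g u = 2 * K * u - K" for u :: real
  define \<mu> where "\<mu> = distr \<nu> borel g"
  have gm[measurable]: "g \<in> borel_measurable borel" unfolding g_def by measurable
  have gm': "g \<in> borel_measurable \<nu>" using gm by simp
  have "real_distribution \<mu>" unfolding \<mu>_def by (rule \<nu>.real_distribution_distr[OF gm'])
  moreover have "AE x in \<mu>. x \<in> {-K..K}"
    unfolding \<mu>_def
  proof (subst AE_distr_iff)
    show "AE x in \<nu>. g x \<in> {-K..K}" using \<nu>(2)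
    proof eventually_elim
      case (elim u)
      then have "K * u \<le> K * 1" "0 \<le> K * u" using K by (auto intro!: mult_left_mono)
      then show ?case by (simp add: g_def)
    qed
  qed (use gm' in auto)
  ultimately have csp: "compactly_supported_prob \<mu>"
    unfolding compactly_supported_prob_def by (meson compact_Icc)
  have int: "integrable \<nu> (\<lambda>u. u ^ r)" for r
  proof (rule \<nu>.integrable_const_bound[of _ 1])
    show "AE u in \<nu>. norm (u ^ r) \<le> 1" using \<nu>(2) by eventually_elim (auto simp: power_le_one)
  qed simp
  have "moment \<mu> n = m n" for n
  proof -
    have "moment \<mu> n = (LINT u|\<nu>. g u ^ n)"
      unfolding moment_def \<mu>_def by (rule integral_distr) (use gm' in auto)
    also have "\<dots> = (LINT u|\<nu>. (\<Sum>r\<le>n. (real (n choose r) * (2 * K) ^ r * (- K) ^ (n - r)) * u ^ r))"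
      unfolding g_def diff_conv_add_uminus[of "2 * K * _"] binomial_ring
      by (simp add: power_mult_distrib mult_ac)
    also have "\<dots> = (\<Sum>r\<le>n. (real (n choose r) * (2 * K) ^ r * (- K) ^ (n - r)) * h r 0)"
      by (simp add: int \<nu>(3))
    also have "\<dots> = (\<Sum>r\<le>n. ?L (smult (real (n choose r) * (- K) ^ (n - r)) (?P ^ r)))"
      unfolding moment_functional_smult h_def using K by (intro sum.cong refl) simp
    also have "\<dots> = ?L (\<Sum>r\<le>n. smult (real (n choose r) * (- K) ^ (n - r)) (?P ^ r))"
      by (simp only: moment_functional_sum)
    also have "(\<Sum>r\<le>n. smult (real (n choose r) * (- K) ^ (n - r)) (?P ^ r)) = (?P + [:- K:]) ^ n"
      unfolding binomial_ring
      by (intro sum.cong refl) (simp add: poly_const_pow of_nat_poly mult.commute mult.left_commute)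
    also have "?P + [:- K:] = monom 1 1" by (simp add: monom_altdef)
    also have "?L (monom 1 1 ^ n) = m n" by (simp add: monom_power moment_functional_monom)
    finally show ?thesis .
  qed
  then show ?thesis using that csp by blast
qed

section \<open>Free infinite divisibility in terms of cumulants\<close>

theorem exists_prob_with_cumulants:
  assumes "\<And>n. n \<ge> 1 \<Longrightarrow> \<bar>\<kappa> n\<bar> \<le> C ^ n" "C > 0" "hadamard_psd (\<lambda>j. \<kappa> (j + 2))"
  obtains \<mu> where "compactly_supported_prob \<mu>" "\<And>n. n \<ge> 1 \<Longrightarrow> free_cumulant \<mu> n = \<kappa> n"
proof -
  have "\<bar>stack_moment \<kappa> n 0\<bar> \<le> (4 * C) ^ n" for n
    using stack_moment_bound[of \<kappa> C n 0] assms by simp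
  moreover have "hadamard_psd (shift2 \<kappa>)" using assms(3) by (simp add: shift2_def[abs_def])
  ultimately obtain \<mu> where "compactly_supported_prob \<mu>" "\<And>n. moment \<mu> n = stack_moment \<kappa> n 0"
    using compact_moment_problem[of "\<lambda>n. stack_moment \<kappa> n 0" "4 * C"] stack_moment_psd assms(2)
      by auto
  then show ?thesis using that free_cumulant_eqI by metis
qed

lemma free_cumulant_dirac_0:
  assumes "j \<ge> 1" shows "free_cumulant (return borel (0::real)) j = 0"
proof (rule free_cumulant_eqI[where \<kappa> = "\<lambda>_. 0", OF _ assms])
  fix n :: nat assume "n \<ge> 1"
  have "stack_moment (\<lambda>_. 0) n j = (if n = 0 \<and> j = 0 then 1 else 0)" for n j
    by (induction n arbitrary: j) auto
  then show "moment (return borel (0::real)) n = stack_moment (\<lambda>_. 0) n 0"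
    using \<open>n \<ge> 1\<close> by (simp add: moment_def integral_return)
qed

text \<open>
  The fractions \<open>(k / n) \<kappa>\<close> satisfy the same conditions, so they are cumulants of laws; these
  are the partial free powers of the law with cumulants \<open>\<kappa> / n\<close>.
\<close>

theorem freely_infinitely_divisibleI:
  assumes \<kappa>: "\<And>n. n \<ge> 1 \<Longrightarrow> \<bar>free_cumulant \<mu> n\<bar> \<le> C ^ n" and C: "C > 0"
    and pos: "hadamard_psd (\<lambda>j. free_cumulant \<mu> (j + 2))" and csp: "compactly_supported_prob \<mu>"
  shows "freely_infinitely_divisible \<mu>"
  unfolding freely_infinitely_divisible_def
proof (intro allI impI)
  fix n :: nat assume n: "n \<ge> 1"
  have ex: "\<exists>\<nu>. compactly_supported_prob \<nu> \<and> (\<forall>j\<ge>1. free_cumulant \<nu> j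
    = (real k / real n) * free_cumulant \<mu> j)"
    if "k \<le> n" for k
  proof -
    have "\<bar>(real k / real n) * free_cumulant \<mu> j\<bar> \<le> C ^ j" if "j \<ge> 1" for j
    proof -
      have "\<bar>(real k / real n) * free_cumulant \<mu> j\<bar> = (real k / real n) * \<bar>free_cumulant \<mu> j\<bar>"
        by (simp add: abs_mult)
      also have "\<dots> \<le> 1 * C ^ j" by (intro mult_mono \<kappa> that) (use \<open>k \<le> n\<close> C n in auto)
      finally show ?thesis by simp
    qed
    moreover have "hadamard_psd (\<lambda>j. (real k / real n) * free_cumulant \<mu> (j + 2))"
      by (rule hadamard_psd_scale[OF _ pos]) simp
    ultimately show ?thesis
      using exists_prob_with_cumulants[of "\<lambda>j. (real k / real n) * free_cumulant \<mu> j" C] C by blast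
  qed
  obtain \<nu> where \<nu>: "compactly_supported_prob \<nu>" "\<And>j. j \<ge> 1 \<Longrightarrow> free_cumulant \<nu> j
    = free_cumulant \<mu> j / real n"
    using ex[of 1] n by auto
  have ret: "compactly_supported_prob (return borel (0::real))"
    unfolding compactly_supported_prob_def
    by (intro conjI exI[of _ "{0}"]) (auto simp: real_distribution_def
      real_distribution_axioms_def prob_space_return AE_return)
  have "is_free_power k \<nu> \<rho>" if "k \<ge> 1" "k \<le> n" "compactly_supported_prob \<rho>"
     "\<And>j. j \<ge> 1 \<Longrightarrow> free_cumulant \<rho> j = (real k / real n) * free_cumulant \<mu> j" for k \<rho>
    using that
  proof (induction k arbitrary: \<rho> rule: nat_induct_at_least)
    case base
    have "is_free_convolution (return borel 0) \<nu> \<rho>"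
      by (rule is_free_convolutionI) (use base ret \<nu> free_cumulant_dirac_0 in auto)
    then show ?case by simp
  next
    case (Suc k)
    obtain \<sigma> where \<sigma>: "compactly_supported_prob \<sigma>" "\<And>j. j \<ge> 1 \<Longrightarrow> free_cumulant \<sigma> j
      = (real k / real n) * free_cumulant \<mu> j"
      using ex[of k] Suc.prems by auto
    have "is_free_convolution \<sigma> \<nu> \<rho>"
      by (rule is_free_convolutionI) (use Suc.prems \<nu> \<sigma> in \<open>auto simp: add_divide_distrib
        distrib_right\<close>)
    moreover have "is_free_power k \<nu> \<sigma>" using Suc.IH[OF _ \<sigma>] Suc.prems by simp
    ultimately show ?case by auto
  qed
  from this[of n \<mu>] have "is_free_power n \<nu> \<mu>" using n csp by simp
  then show "\<exists>\<nu>. compactly_supported_prob \<nu> \<and> is_free_power n \<nu> \<mu>" using \<nu>(1) by blast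
qed

lemma compactly_supported_prob_bound:
  assumes "compactly_supported_prob \<mu>"
  obtains K where "K \<ge> 1" "\<And>n. integrable \<mu> (\<lambda>x. x ^ n)" "\<And>n. \<bar>moment \<mu> n\<bar> \<le> K ^ n"
proof -
  interpret real_distribution \<mu> using assms by (simp add: compactly_supported_prob_def)
  obtain S where S: "compact S" "AE x in \<mu>. x \<in> S" using assms
    by (auto simp: compactly_supported_prob_def)
  then obtain B where B: "\<And>x. x \<in> S \<Longrightarrow> norm x \<le> B" using compact_imp_bounded bounded_iff by metis
  define K where "K = max 1 B"
  have K: "K \<ge> 1" by (simp add: K_def)
  have AE: "AE x in \<mu>. norm (x ^ n) \<le> K ^ n" for n
    using S(2)
  proof eventually_elim
    case (elim x)
    then have "norm x \<le> K" using B by (force simp: K_def)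
    then show ?case unfolding norm_power by (rule power_mono) simp
  qed
  have int: "integrable \<mu> (\<lambda>x. x ^ n)" for n
    by (rule integrable_const_bound[OF AE]) simp
  have "\<bar>moment \<mu> n\<bar> \<le> K ^ n" for n
  proof -
    have "\<bar>moment \<mu> n\<bar> \<le> (LINT x|\<mu>. norm (x ^ n))" unfolding moment_def
      using integral_norm_bound[of \<mu> "\<lambda>x. x ^ n"] by simp
    also have "\<dots> \<le> (LINT x|\<mu>. K ^ n)"
      by (rule integral_mono_AE) (use int AE in \<open>auto intro: integrable_norm\<close>)
    finally show ?thesis by (simp add: prob_space[simplified])
  qed
  then show ?thesis using that K int by blast
qed

lemma free_cumulant_bound:
  assumes "compactly_supported_prob \<mu>"
  obtains C where "C \<ge> 1" "\<And>n. n \<ge> 1 \<Longrightarrow> \<bar>free_cumulant \<mu> n\<bar> \<le> C ^ n"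
proof -
  obtain K where K: "K \<ge> 1" "\<And>n. \<bar>moment \<mu> n\<bar> \<le> K ^ n"
    using compactly_supported_prob_bound[OF assms] by metis
  have "\<bar>free_cumulant \<mu> n\<bar> \<le> (16 * K\<^sup>2) ^ n" if "n \<ge> 1" for n
    by (rule cumulant_bound[OF _ K(1) that]) (use K(2) moment_eq_stack_moment in metis)
  moreover have "16 * K\<^sup>2 \<ge> 1" using one_le_power[OF K(1), of 2] by simp
  ultimately show ?thesis using that by blast
qed

lemma free_cumulant_free_power:
  assumes "is_free_power n \<nu> \<mu>" "j \<ge> 1"
  shows "free_cumulant \<mu> j = real n * free_cumulant \<nu> j"
  using assms(1)
proof (induction n arbitrary: \<mu>)
  case 0
  then show ?case using free_cumulant_dirac_0[OF assms(2)] by simp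
next
  case (Suc n)
  then obtain \<rho> where "is_free_power n \<nu> \<rho>" "is_free_convolution \<rho> \<nu> \<mu>" by auto
  then show ?case using Suc.IH free_cumulant_free_convolution[OF _ assms(2)]
    by (simp add: algebra_simps)
qed

text \<open>
  In the moment-cumulant formula a partition with \<open>b\<close> blocks contributes with the factor
  \<open>n\<^sup>-\<^sup>b\<close>, so after multiplication by \<open>n\<close> only the one-block partition survives.
\<close>

lemma scaled_root_moment_limit:
  assumes N: "N \<ge> 1" and cum: "\<And>n j. j \<ge> 1 \<Longrightarrow> free_cumulant (\<nu> n) j = \<kappa> j / real (Suc n)"
  shows "(\<lambda>n. real (Suc n) * moment (\<nu> n) N) \<longlonglongrightarrow> \<kappa> N"
proof -
  \<comment> \<open>the partitions with at least two blocks\<close>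
  let ?X = "noncrossing_partitions N - {{{..<N}}}"
  have eq: "real (Suc n) * moment (\<nu> n) N =
      \<kappa> N + (\<Sum>\<pi>\<in>?X. (\<Prod>B\<in>\<pi>. \<kappa> (card B)) * (1 / real (Suc n)) ^ (card \<pi> - 1))" for n
  proof -
    have "moment (\<nu> n) N = stack_moment (\<lambda>j. \<kappa> j / real (Suc n)) N 0"
      unfolding moment_eq_stack_moment[OF N] by (rule stack_moment_cong) (rule cum)
    also have "\<dots> = \<kappa> N / real (Suc n) + (\<Sum>\<pi>\<in>?X. \<Prod>B\<in>\<pi>. \<kappa> (card B) / real (Suc n))"
      by (rule sum_noncrossing_split[OF N])
    also have "real (Suc n) * \<dots> = \<kappa> N + (\<Sum>\<pi>\<in>?X. real (Suc n) * (\<Prod>B\<in>\<pi>. \<kappa> (card B) / real (Suc n)))"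
      by (simp add: distrib_left sum_distrib_left del: of_nat_Suc)
    also have "(\<Sum>\<pi>\<in>?X. real (Suc n) * (\<Prod>B\<in>\<pi>. \<kappa> (card B) / real (Suc n))) =
       (\<Sum>\<pi>\<in>?X. (\<Prod>B\<in>\<pi>. \<kappa> (card B)) * (1 / real (Suc n)) ^ (card \<pi> - 1))"
    proof (rule sum.cong[OF refl])
      fix \<pi> assume "\<pi> \<in> ?X"
      moreover have "{..<N} \<noteq> {}" using N by (simp add: lessThan_empty_iff)
      ultimately have "finite \<pi>" "\<pi> \<noteq> {}" using noncrossing_partitionsD(1,4)[of \<pi> N] by auto
      then have "card \<pi> = Suc (card \<pi> - 1)" by (simp add: card_gt_0_iff)
      then obtain d where d: "card \<pi> = Suc d" by blast
      have "(\<Prod>B\<in>\<pi>. \<kappa> (card B) / real (Suc n)) = (\<Prod>B\<in>\<pi>. \<kappa> (card B)) / real (Suc n) ^ Suc d"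
        by (simp only: prod_dividef prod_constant d)
      then show "real (Suc n) * (\<Prod>B\<in>\<pi>. \<kappa> (card B) / real (Suc n)) =
          (\<Prod>B\<in>\<pi>. \<kappa> (card B)) * (1 / real (Suc n)) ^ (card \<pi> - 1)"
        by (simp add: d field_simps del: of_nat_Suc)
    qed
    finally show ?thesis .
  qed
  have "(\<lambda>n. \<kappa> N + (\<Sum>\<pi>\<in>?X. (\<Prod>B\<in>\<pi>. \<kappa> (card B)) * (1 / real (Suc n)) ^ (card \<pi> - 1))) \<longlonglongrightarrow>
     \<kappa> N + (\<Sum>\<pi>\<in>?X. (\<Prod>B\<in>\<pi>. \<kappa> (card B)) * 0)"
  proof (intro tendsto_add tendsto_const tendsto_sum tendsto_mult)
    fix \<pi> assume p: "\<pi> \<in> ?X"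
    then have D: "finite \<pi>" "\<Union>\<pi> = {..<N}" using noncrossing_partitionsD(1,4)[of \<pi> N] by auto
    then obtain B where B: "B \<in> \<pi>" using N by (metis Union_empty equals0I lessThan_empty_iff
      not_one_le_zero bot_nat_def)
    obtain C where C: "C \<in> \<pi>" "C \<noteq> B" using noncrossing_nontop_card(2)[of \<pi> N B] p B by blast
    have "card {B, C} \<le> card \<pi>" by (rule card_mono) (use B C D in auto)
    then have "card \<pi> - 1 > 0" using C by simp
    then show "(\<lambda>n. (1 / real (Suc n)) ^ (card \<pi> - 1)) \<longlonglongrightarrow> 0"
      by (intro tendsto_null_power LIMSEQ_Suc[OF lim_1_over_n])
  qed
  then show ?thesis unfolding eq by simp
qed

text \<open>
  With \<open>\<nu>\<^sub>n\<close> the \<open>n\<close>-th root, \<open>n\<close> times the \<open>(j + 2)\<close>-th moment of \<open>\<nu>\<^sub>n\<close> is the \<open>j\<close>-th moment of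
  the positive measure \<open>n x\<^sup>2 \<nu>\<^sub>n(dx)\<close>, and these converge to \<open>\<kappa>\<^sub>j\<^sub>+\<^sub>2\<close>.
\<close>

theorem freely_infinitely_divisible_hadamard_psd:
  assumes "freely_infinitely_divisible \<mu>"
  shows "hadamard_psd (\<lambda>j. free_cumulant \<mu> (j + 2))"
proof -
  have "\<forall>n. \<exists>\<nu>. compactly_supported_prob \<nu> \<and> is_free_power (Suc n) \<nu> \<mu>"
    using assms unfolding freely_infinitely_divisible_def by (metis le_add1 plus_1_eq_Suc)
  then obtain \<nu> where \<nu>: "\<And>n. compactly_supported_prob (\<nu> n)" "\<And>n. is_free_power (Suc n) (\<nu> n) \<mu>"
    by metis
  have cum: "free_cumulant (\<nu> n) j = free_cumulant \<mu> j / real (Suc n)" if "j \<ge> 1" for n j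
    using free_cumulant_free_power[OF \<nu>(2)[of n] that] by (simp add: field_simps del: of_nat_Suc)
  show ?thesis
  proof (rule hadamard_psd_limit)
    fix j
    show "(\<lambda>n. real (Suc n) * moment (\<nu> n) (j + 2)) \<longlonglongrightarrow> free_cumulant \<mu> (j + 2)"
      by (rule scaled_root_moment_limit) (use cum in auto)
  next
    fix n
    have int: "integrable (\<nu> n) (\<lambda>x. x ^ j)" for j using compactly_supported_prob_bound[OF \<nu>(1)]
      by metis
    have "hadamard_psd (\<lambda>j. LINT x|\<nu> n. (real (Suc n) * x\<^sup>2) * x ^ j)"
    proof (rule hadamard_psd_integral)
      fix j show "integrable (\<nu> n) (\<lambda>x. real (Suc n) * x\<^sup>2 * x ^ j)"
        unfolding mult.assoc power_add[symmetric] by (intro integrable_mult_right int)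
    qed simp
    moreover have "(LINT x|\<nu> n. (real (Suc n) * x\<^sup>2) * x ^ j)
      = real (Suc n) * moment (\<nu> n) (j + 2)" for j
      unfolding mult.assoc power_add[symmetric] moment_def by (simp add: add.commute)
    ultimately show "hadamard_psd (\<lambda>j. real (Suc n) * moment (\<nu> n) (j + 2))" by simp
  qed
qed

section \<open>Evolution of the free cumulants\<close>

lemma nn_integral_gauss_half_line:
  fixes y :: real assumes "y > 0"
  shows "(\<integral>\<^sup>+u. ennreal (exp (- (y * u)\<^sup>2 / 2)) * indicator {0..} u \<partial>lborel)
    = ennreal (sqrt (pi / 2) / y)"
proof -
  let ?f = "\<lambda>x::real. ennreal (exp (- x\<^sup>2)) * indicator {0..} x"
  have "(\<integral>\<^sup>+x. ennreal (indicator {0..} x *\<^sub>R exp (- x\<^sup>2)) \<partial>lborel) = ennreal (sqrt pi / 2)"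
    using gaussian_moment_0 by (subst nn_integral_eq_integral) (auto simp: has_bochner_integral_iff)
  moreover have "(\<integral>\<^sup>+x. ennreal (indicator {0..} x *\<^sub>R exp (- x\<^sup>2)) \<partial>lborel) = (\<integral>\<^sup>+x. ?f x \<partial>lborel)"
    by (intro nn_integral_cong) (simp split: split_indicator)
  ultimately have "ennreal (sqrt pi / 2) = (\<integral>\<^sup>+x. ?f x \<partial>lborel)" by simp
  also have "\<dots> = ennreal \<bar>y / sqrt 2\<bar> * (\<integral>\<^sup>+u. ?f (0 + (y / sqrt 2) * u) \<partial>lborel)"
    by (rule nn_integral_real_affine) (use assms in auto)
  also have "(\<integral>\<^sup>+u. ?f (0 + (y / sqrt 2) * u) \<partial>lborel) =
      (\<integral>\<^sup>+u. ennreal (exp (- (y * u)\<^sup>2 / 2)) * indicator {0..} u \<partial>lborel)"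
    using assms by (intro nn_integral_cong) (auto simp: indicator_def power_mult_distrib
      power_divide zero_le_divide_iff zero_le_mult_iff)
  finally have "ennreal (sqrt 2 / y) * ennreal (sqrt pi / 2)
    = ennreal (sqrt 2 / y) * (ennreal \<bar>y / sqrt 2\<bar> *
     (\<integral>\<^sup>+u. ennreal (exp (- (y * u)\<^sup>2 / 2)) * indicator {0..} u \<partial>lborel))" by simp
  also have "\<dots> = (\<integral>\<^sup>+u. ennreal (exp (- (y * u)\<^sup>2 / 2)) * indicator {0..} u \<partial>lborel)"
    using assms by (simp add: mult.assoc[symmetric] ennreal_mult'[symmetric] abs_of_pos)
  also have "ennreal (sqrt 2 / y) * ennreal (sqrt pi / 2) = ennreal (sqrt (pi / 2) / y)"
  proof -
    have "sqrt 2 / y * (sqrt pi / 2) = (sqrt 2 / 2) * sqrt pi / y"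
      by (simp only: times_divide_eq_left times_divide_eq_right mult.commute divide_divide_eq_left)
    also have "\<dots> = sqrt (pi / 2) / y"
    proof -
      have "sqrt 2 / 2 = inverse (sqrt (2 :: real))" by (rule sqrt_divide_self_eq) simp
      moreover have "sqrt (pi / 2) = inverse (sqrt 2) * sqrt pi"
        by (subst real_sqrt_divide, subst divide_inverse, rule mult.commute)
      ultimately show ?thesis by (simp only:)
    qed
    finally have "sqrt 2 / y * (sqrt pi / 2) = sqrt (pi / 2) / y" .
    then show ?thesis using assms by (simp add: ennreal_mult'[symmetric])
  qed
  finally show ?thesis ..
qed

lemma nn_integral_gauss_tail:
  fixes c s :: real assumes "c > 0" "s \<ge> 0"
  shows "(\<integral>\<^sup>+y. ennreal (y * exp (- y\<^sup>2 * c / 2)) * indicator {s..} y \<partial>lborel)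
    = ennreal (exp (- s\<^sup>2 * c / 2) / c)"
proof -
  let ?F = "\<lambda>y. - exp (- y\<^sup>2 * c / 2) / c"
  have "(?F \<longlongrightarrow> 0) at_top" using assms by real_asymp
  then have "(\<integral>\<^sup>+y. ennreal (y * exp (- y\<^sup>2 * c / 2)) * indicator {s..} y \<partial>lborel)
    = ennreal (0 - ?F s)"
    by (intro nn_integral_FTC_atLeast)
      (use assms in \<open>auto intro!: derivative_eq_intros mult_nonneg_nonneg simp: field_simps
          power2_eq_square\<close>)
  then show ?thesis by simp
qed

text \<open>
  Write \<open>exp (- s\<^sup>2 (1 + u\<^sup>2) / 2) / (1 + u\<^sup>2)\<close> as an integral over \<open>y \<ge> s\<close> and integrate over
  \<open>u\<close> first: the Gaussian integral produces \<open>1 / y\<close> and leaves the tail of the normal law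
  beyond \<open>s\<close>. The same tail appears on the right after completing the square.
\<close>

lemma nn_integral_cauchy_gauss:
  fixes s :: real assumes s: "s \<ge> 0"
  shows "(\<integral>\<^sup>+u. ennreal (exp (- s\<^sup>2 * u\<^sup>2 / 2) / (u\<^sup>2 + 1)) * indicator {0..} u \<partial>lborel) =
     ennreal pi * (\<integral>\<^sup>+u. ennreal (std_normal_density u * exp (- s * u))
       * indicator {0..} u \<partial>lborel)"
proof -
  let ?P = "\<integral>\<^sup>+y. ennreal (std_normal_density y) * indicator {s..} y \<partial>lborel"
  let ?E = "ennreal (exp (s\<^sup>2 / 2))"
  have E1: "?E * ennreal (exp (- s\<^sup>2 / 2)) = 1"
    by (simp add: ennreal_mult'[symmetric] flip: exp_add)
  have "?P = ennreal \<bar>1\<bar> * (\<integral>\<^sup>+u. ennreal (std_normal_density (s + 1 * u)) * indicator {s..} (s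
    + 1 * u) \<partial>lborel)"
    by (rule nn_integral_real_affine) auto
  also have "\<dots> = (\<integral>\<^sup>+u. ennreal (exp (- s\<^sup>2 / 2)) * (ennreal (std_normal_density u * exp (- s
    * u)) * indicator {0..} u) \<partial>lborel)"
    unfolding abs_one ennreal_1 mult_1
  proof (rule nn_integral_cong)
    fix u
    have "std_normal_density (s + u) = exp (- s\<^sup>2 / 2) * (std_normal_density u * exp (- s * u))"
      by (simp add: std_normal_density_def flip: exp_add) (simp add: power2_eq_square field_simps)
    moreover have "indicator {s..} (s + u) = (indicator {0..} u :: ennreal)"
      by (simp add: indicator_def)
    ultimately show "ennreal (std_normal_density (s + u)) * indicator {s..} (s + u) =
        ennreal (exp (- s\<^sup>2 / 2)) * (ennreal (std_normal_density u * exp (- s * u))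
          * indicator {0..} u)"
      by (simp add: ennreal_mult' mult.assoc)
  qed
  also have "\<dots> = ennreal (exp (- s\<^sup>2 / 2)) * (\<integral>\<^sup>+u. ennreal (std_normal_density u * exp (- s * u))
    * indicator {0..} u \<partial>lborel)"
    by (rule nn_integral_cmult) simp
  finally have "?E * ?P = ?E * ennreal (exp (- s\<^sup>2 / 2)) * (\<integral>\<^sup>+u. ennreal (std_normal_density u
    * exp (- s * u)) * indicator {0..} u \<partial>lborel)"
    by (simp only: mult.assoc)
  then have R: "?E * ?P = (\<integral>\<^sup>+u. ennreal (std_normal_density u * exp (- s * u))
    * indicator {0..} u \<partial>lborel)"
    by (simp only: E1 mult_1)
  let ?g = "\<lambda>u y. ennreal (y * exp (- y\<^sup>2 * (1 + u\<^sup>2) / 2)) * indicator {s..} y * indicator {0..} u"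
  have "(\<integral>\<^sup>+u. ennreal (exp (- s\<^sup>2 * u\<^sup>2 / 2) / (u\<^sup>2 + 1)) * indicator {0..} u \<partial>lborel) =
     (\<integral>\<^sup>+u. ?E * (\<integral>\<^sup>+y. ?g u y \<partial>lborel) \<partial>lborel)"
  proof (rule nn_integral_cong)
    fix u :: real
    have pos: "1 + u\<^sup>2 > 0" by (rule add_pos_nonneg) auto
    have "(\<integral>\<^sup>+y. ?g u y \<partial>lborel) = (\<integral>\<^sup>+y. ennreal (y * exp (- y\<^sup>2 * (1 + u\<^sup>2) / 2))
      * indicator {s..} y \<partial>lborel) * indicator {0..} u"
      by (rule nn_integral_multc) simp
    also have "\<dots> = ennreal (exp (- s\<^sup>2 * (1 + u\<^sup>2) / 2) / (1 + u\<^sup>2)) * indicator {0..} u"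
      by (simp only: nn_integral_gauss_tail[OF pos s])
    finally have st: "(\<integral>\<^sup>+y. ?g u y \<partial>lborel) = ennreal (exp (- s\<^sup>2 * (1 + u\<^sup>2) / 2) / (1 + u\<^sup>2))
      * indicator {0..} u" .
    have "?E * (\<integral>\<^sup>+y. ?g u y \<partial>lborel) = ennreal (exp (s\<^sup>2 / 2) * (exp (- s\<^sup>2 * (1 + u\<^sup>2) / 2) / (1
      + u\<^sup>2))) * indicator {0..} u"
      unfolding st by (simp only: ennreal_mult'[OF exp_ge_zero] mult.assoc)
    also have "exp (s\<^sup>2 / 2) * (exp (- s\<^sup>2 * (1 + u\<^sup>2) / 2) / (1 + u\<^sup>2))
      = exp (- s\<^sup>2 * u\<^sup>2 / 2) / (u\<^sup>2 + 1)"
      by (simp add: add.commute flip: exp_add) (simp add: field_simps)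
    finally show "ennreal (exp (- s\<^sup>2 * u\<^sup>2 / 2) / (u\<^sup>2 + 1)) * indicator {0..} u
      = ?E * (\<integral>\<^sup>+y. ?g u y \<partial>lborel)" ..
  qed
  also have "\<dots> = ?E * (\<integral>\<^sup>+u. (\<integral>\<^sup>+y. ?g u y \<partial>lborel) \<partial>lborel)"
    by (rule nn_integral_cmult) simp
  also have "(\<integral>\<^sup>+u. (\<integral>\<^sup>+y. ?g u y \<partial>lborel) \<partial>lborel) = (\<integral>\<^sup>+y. (\<integral>\<^sup>+u. ?g u y \<partial>lborel) \<partial>lborel)"
    by (rule lborel_pair.Fubini') simp
  also have "\<dots> = (\<integral>\<^sup>+y. ennreal pi * (ennreal (std_normal_density y) * indicator {s..} y) \<partial>lborel)"
  proof (rule nn_integral_cong_AE)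
    have "AE y in lborel. y \<noteq> (0::real)" by (rule AE_lborel_singleton)
    then show "AE y in lborel. (\<integral>\<^sup>+u. ?g u y \<partial>lborel)
      = ennreal pi * (ennreal (std_normal_density y) * indicator {s..} y)"
    proof eventually_elim
      case (elim y)
      show ?case
      proof (cases "y \<ge> s")
        case True
        then have y: "y > 0" using s elim by simp
        have "(\<integral>\<^sup>+u. ?g u y \<partial>lborel) = (\<integral>\<^sup>+u. ennreal (y * exp (- y\<^sup>2 / 2)) * (ennreal (exp (- (y
          * u)\<^sup>2 / 2)) * indicator {0..} u) \<partial>lborel)"
        proof (rule nn_integral_cong)
          fix u
          have "y * exp (- y\<^sup>2 * (1 + u\<^sup>2) / 2) = y * exp (- y\<^sup>2 / 2) * exp (- (y * u)\<^sup>2 / 2)"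
            by (simp add: flip: exp_add) (simp add: field_simps power_mult_distrib)
          then show "?g u y = ennreal (y * exp (- y\<^sup>2 / 2)) * (ennreal (exp (- (y * u)\<^sup>2 / 2))
            * indicator {0..} u)"
            using True y by (simp add: ennreal_mult' mult.assoc)
        qed
        also have "\<dots> = ennreal (y * exp (- y\<^sup>2 / 2)) * ennreal (sqrt (pi / 2) / y)"
          by (subst nn_integral_cmult) (simp, simp only: nn_integral_gauss_half_line[OF y])
        also have "\<dots> = ennreal (y * exp (- y\<^sup>2 / 2) * (sqrt (pi / 2) / y))"
          using y by (intro ennreal_mult'[symmetric]) simp
        also have "y * exp (- y\<^sup>2 / 2) * (sqrt (pi / 2) / y) = pi * std_normal_density y"
        proof -
          have "sqrt (pi / 2) * sqrt (2 * pi) = sqrt (pi\<^sup>2)" unfolding real_sqrt_mult[symmetric]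
            by (simp add: power2_eq_square)
          then have "sqrt (pi / 2) = pi / sqrt (2 * pi)" by (simp add: field_simps)
          then show ?thesis using y by (simp add: std_normal_density_def)
        qed
        finally show ?thesis using True by (simp add: ennreal_mult')
      qed simp
    qed
  qed
  also have "\<dots> = ennreal pi * ?P" by (rule nn_integral_cmult) simp
  finally show ?thesis unfolding R[symmetric] by (simp only: mult.left_commute)
qed

lemma integrable_std_normal_bounded:
  assumes "g \<in> borel_measurable borel" "\<And>u. \<bar>g u\<bar> \<le> 1"
  shows "integrable lborel (\<lambda>u. std_normal_density u * g u)"
proof (rule Bochner_Integration.integrable_bound)
  show "integrable lborel std_normal_density" using integrable_std_normal_moment[of 0] by simp
  show "AE u in lborel. norm (std_normal_density u * g u) \<le> norm (std_normal_density u)"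
    using assms(2) by (intro AE_I2) (simp add: abs_mult mult_left_le)
qed (use assms in simp)

text \<open>
  The key to the evolution: \<open>a\<^sub>k(t)\<close> is the \<open>k\<close>-th moment of \<open>exp (- \<surd>t |N|)\<close> for a standard
  normal \<open>N\<close>.
\<close>

lemma a_coeff_eq_gauss:
  assumes "t \<ge> 0"
  shows "a_coeff k t = (LINT u|lborel. std_normal_density u * exp (- sqrt t * \<bar>u\<bar>) ^ k)"
proof -
  define s where "s = real k * sqrt t"
  have s: "s \<ge> 0" "s\<^sup>2 = t * (real k)\<^sup>2" using assms by (simp_all add: s_def power_mult_distrib)
  let ?B = "\<integral>\<^sup>+u. ennreal (std_normal_density u * exp (- s * u)) * indicator {0..} u \<partial>lborel"
  let ?f = "\<lambda>u. std_normal_density u * exp (- s * \<bar>u\<bar>)"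
  have ps: "exp (- sqrt t * \<bar>u\<bar>) ^ k = exp (- s * \<bar>u\<bar>)" for u
    by (simp add: s_def mult_ac flip: exp_of_nat_mult)
  have int: "integrable lborel ?f"
    by (rule integrable_std_normal_bounded) (use s in auto)
  have ind: "integrable lborel (\<lambda>u. indicator {0..} u *\<^sub>R ?f u)"
    using int by (intro integrable_mult_indicator) auto
  have "has_bochner_integral lborel ?f (2 *\<^sub>R (LINT u|lborel. indicator {0..} u *\<^sub>R ?f u))"
  proof (rule has_bochner_integral_even_function)
    show "has_bochner_integral lborel (\<lambda>u. indicator {0..} u *\<^sub>R ?f u) (LINT u|lborel. indicator
      {0..} u *\<^sub>R ?f u)"
      using ind by (rule has_bochner_integral_integrable)
  qed (simp add: std_normal_density_def)
  then have "(LINT u|lborel. ?f u) = 2 * (LINT u|lborel. indicator {0..} u *\<^sub>R ?f u)"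
    by (simp add: has_bochner_integral_iff)
  also have "(LINT u|lborel. indicator {0..} u *\<^sub>R ?f u)
    = enn2real (\<integral>\<^sup>+u. ennreal (indicator {0..} u *\<^sub>R ?f u) \<partial>lborel)"
    by (rule integral_eq_nn_integral) (use ind in auto)
  also have "(\<integral>\<^sup>+u. ennreal (indicator {0..} u *\<^sub>R ?f u) \<partial>lborel) = ?B"
    by (intro nn_integral_cong) (auto simp: indicator_def)
  finally have R: "(LINT u|lborel. ?f u) = 2 * enn2real ?B" .
  have "(LBINT u:{0..}. exp (- t * (real k)\<^sup>2 * u\<^sup>2 / 2) / (u\<^sup>2 + 1)) =
     enn2real (\<integral>\<^sup>+u. ennreal (indicator {0..} u *\<^sub>R (exp (- t * (real k)\<^sup>2 * u\<^sup>2 / 2) / (u\<^sup>2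
       + 1))) \<partial>lborel)"
    unfolding set_lebesgue_integral_def by (rule integral_eq_nn_integral) (auto simp: indicator_def)
  also have "(\<integral>\<^sup>+u. ennreal (indicator {0..} u *\<^sub>R (exp (- t * (real k)\<^sup>2 * u\<^sup>2 / 2) / (u\<^sup>2
    + 1))) \<partial>lborel) =
     (\<integral>\<^sup>+u. ennreal (exp (- s\<^sup>2 * u\<^sup>2 / 2) / (u\<^sup>2 + 1)) * indicator {0..} u \<partial>lborel)"
    by (intro nn_integral_cong) (auto simp: indicator_def s)
  also have "\<dots> = ennreal pi * ?B" by (rule nn_integral_cauchy_gauss[OF s(1)])
  finally have "a_coeff k t = 2 / pi * (pi * enn2real ?B)"
    by (simp add: a_coeff_def enn2real_mult)
  then show ?thesis unfolding ps R by simp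
qed

lemma std_normal_integral: "(LINT u|lborel. std_normal_density u)
  = 1" "integrable lborel std_normal_density"
  using integral_std_normal_moment_even[of 0] integrable_std_normal_moment[of 0] by simp_all

text \<open>
  The \<open>j\<close>-th evolved cumulant is the normal mean of this at \<open>c = exp (- \<surd>t |u|)\<close>. For fixed
  \<open>c\<close> it combines a dilation, a free power, and a semicircular summand of variance
  \<open>(1 - c) D\<close>.
\<close>

definition evolved_mixand :: "(nat \<Rightarrow> real) \<Rightarrow> real \<Rightarrow> real \<Rightarrow> nat \<Rightarrow> real" where
  "evolved_mixand \<kappa> D c j = c ^ (j - 1) * \<kappa> j + (if j = 2 then (1 - c) * D else 0)"

lemma a_coeff_bounds:
  assumes "t \<ge> 0" shows "0 \<le> a_coeff k t" "a_coeff k t \<le> 1"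
proof -
  have int: "integrable lborel (\<lambda>u. std_normal_density u * exp (- sqrt t * \<bar>u\<bar>) ^ k)"
    by (rule integrable_std_normal_bounded) (use assms in \<open>auto simp: power_le_one\<close>)
  show "0 \<le> a_coeff k t" unfolding a_coeff_eq_gauss[OF assms]
    by (intro integral_nonneg_AE AE_I2) simp
  have "a_coeff k t \<le> (LINT u|lborel. std_normal_density u)"
    unfolding a_coeff_eq_gauss[OF assms]
    by (intro integral_mono int std_normal_integral) (use assms in \<open>auto simp: mult_left_le
      power_le_one\<close>)
  then show "a_coeff k t \<le> 1" by (simp add: std_normal_integral)
qed

lemma evolved_mixand_integral:
  assumes t: "t \<ge> 0" and j: "j \<ge> 1"
  shows "integrable lborel (\<lambda>u. std_normal_density u * evolved_mixand \<kappa> D (exp (- sqrt t * \<bar>u\<bar>)) j)"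
    "(LINT u|lborel. std_normal_density u * evolved_mixand \<kappa> D (exp (- sqrt t * \<bar>u\<bar>)) j) =
       a_coeff (j - 1) t * \<kappa> j + (if j = 2 then (1 - a_coeff 1 t) * D else 0)"
proof -
  let ?c = "\<lambda>u. exp (- sqrt t * \<bar>u\<bar>)"
  have int: "integrable lborel (\<lambda>u. std_normal_density u * ?c u ^ k)" for k
    by (rule integrable_std_normal_bounded) (use t in \<open>auto simp: power_le_one\<close>)
  have eq: "std_normal_density u * evolved_mixand \<kappa> D (?c u) j
    = \<kappa> j * (std_normal_density u * ?c u ^ (j - 1)) +
      (if j = 2 then D else 0) * (std_normal_density u - std_normal_density u * ?c u ^ 1)" for u
    by (simp add: evolved_mixand_def algebra_simps)
  show "integrable lborel (\<lambda>u. std_normal_density u * evolved_mixand \<kappa> D (?c u) j)"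
    unfolding eq by (intro Bochner_Integration.integrable_add integrable_mult_right
      Bochner_Integration.integrable_diff int std_normal_integral)
  have "(LINT u|lborel. std_normal_density u * evolved_mixand \<kappa> D (?c u) j) =
     \<kappa> j * (LINT u|lborel. std_normal_density u * ?c u ^ (j - 1)) +
      (if j = 2 then D else 0) * ((LINT u|lborel. std_normal_density u)
          - (LINT u|lborel. std_normal_density u * ?c u ^ 1))"
    unfolding eq Bochner_Integration.integral_add[OF integrable_mult_right[OF int]
        integrable_mult_right[OF Bochner_Integration.integrable_diff[OF std_normal_integral(2)
          int]]]
    by (simp only: integral_mult_right_zero Bochner_Integration.integral_diff[OF
      std_normal_integral(2) int])
  then show "(LINT u|lborel. std_normal_density u * evolved_mixand \<kappa> D (?c u) j) =
       a_coeff (j - 1) t * \<kappa> j + (if j = 2 then (1 - a_coeff 1 t) * D else 0)"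
    unfolding a_coeff_eq_gauss[OF t, symmetric] by (simp add: std_normal_integral)
qed

text \<open>
  The evolved sequence inherits the positivity condition and the exponential growth, which
  yields the law. Since the mixands are bounded by \<open>C\<^sup>j\<close> uniformly in \<open>c\<close>, the power series may
  be integrated term by term for \<open>|w| < 1 / (2 C)\<close>.
\<close>

theorem evolved_law:
  fixes m :: "real measure" and t D :: real
  assumes csp: "compactly_supported_prob m" and fid: "freely_infinitely_divisible m"
    and cum1: "free_cumulant m 1 = 0" and t: "t \<ge> 0" and D: "D \<ge> 0"
  obtains mt where "compactly_supported_prob mt" "freely_infinitely_divisible mt"
    "\<And>j. j \<ge> 1 \<Longrightarrow> free_cumulant mt j =
        a_coeff (j - 1) t * free_cumulant m j + (if j = 2 then (1 - a_coeff 1 t) * D else 0)"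
    "\<forall>\<^sub>F w in nhds 0. summable (\<lambda>k. of_real (free_cumulant mt (k + 1)) * w ^ k) \<and>
       integrable lborel (\<lambda>u. of_real (std_normal_density u) * (of_real ((1 - exp (- sqrt t
         * \<bar>u\<bar>)) * D) * w +
          R_transform m (of_real (exp (- sqrt t * \<bar>u\<bar>)) * w))) \<and>
       R_transform mt w = (LINT u|lborel. of_real (std_normal_density u) * (of_real ((1
         - exp (- sqrt t * \<bar>u\<bar>)) * D) * w +
          R_transform m (of_real (exp (- sqrt t * \<bar>u\<bar>)) * w)))"
proof -
  let ?\<kappa> = "free_cumulant m" and ?c = "\<lambda>u. exp (- sqrt t * \<bar>u\<bar>)"
  define \<tau> where "\<tau> j = a_coeff (j - 1) t * ?\<kappa> j + (if j = 2 then (1 - a_coeff 1 t) * D else 0)"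
    for j
  have c01: "0 \<le> ?c u" "?c u \<le> 1" for u using t by auto
  obtain C0 where C0: "C0 \<ge> 1" "\<And>n. n \<ge> 1 \<Longrightarrow> \<bar>?\<kappa> n\<bar> \<le> C0 ^ n"
    using free_cumulant_bound[OF csp] by blast
  \<comment> \<open>large enough at index \<open>2\<close>, the only one where \<open>D\<close> enters: \<open>C0\<^sup>2 + D \<le> C\<^sup>2\<close>\<close>
  define C where "C = C0 + D"
  have C: "C > 0" using C0 D by (simp add: C_def)
  have bound: "\<bar>b * ?\<kappa> j + (if j = 2 then (1 - c) * D else 0)\<bar> \<le> C ^ j"
    if "j \<ge> 1" "0 \<le> b" "b \<le> 1" "0 \<le> c" "c \<le> 1" for j b c
  proof -
    have "\<bar>b * ?\<kappa> j\<bar> \<le> C0 ^ j"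
      using C0(2)[OF that(1)] that by (simp add: abs_mult) (meson abs_ge_zero mult_left_le_one_le
        order_trans)
    moreover have "C0 ^ j + (if j = 2 then D else 0) \<le> C ^ j"
    proof (cases "j = 2")
      case True
      have "D * 1 \<le> D * (2 * C0)" by (rule mult_left_mono) (use C0 D in auto)
      then show ?thesis using True D by (simp add: C_def power2_eq_square algebra_simps
        add_increasing)
    next
      case False
      then show ?thesis using power_mono[of C0 C j] C0 D by (simp add: C_def)
    qed
    moreover have "\<bar>if j = 2 then (1 - c) * D else 0\<bar> \<le> (if j = 2 then D else 0)"
      using that D by (auto simp: abs_mult mult_left_le_one_le)
    ultimately show ?thesis by linarith
  qed
  have \<tau>b: "\<bar>\<tau> j\<bar> \<le> C ^ j" if "j \<ge> 1" for j
    unfolding \<tau>_def by (rule bound[OF that]) (use a_coeff_bounds[OF t] in auto)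
  have "hadamard_psd (\<lambda>j. LINT u|lborel. (std_normal_density u * ?c u) * ?c u ^ j)"
  proof (rule hadamard_psd_integral)
    fix n
    have "integrable lborel (\<lambda>u. std_normal_density u * ?c u ^ Suc n)"
      by (rule integrable_std_normal_bounded) (use t in \<open>auto intro!: power_le_one mult_le_one
        simp: zero_le_mult_iff\<close>)
    then show "integrable lborel (\<lambda>u. (std_normal_density u * ?c u) * ?c u ^ n)"
      by (simp add: mult.assoc)
  qed simp
  moreover have "(LINT u|lborel. (std_normal_density u * ?c u) * ?c u ^ j) = a_coeff (Suc j) t"
    for j
    unfolding a_coeff_eq_gauss[OF t] by (simp add: mult.assoc)
  ultimately have "hadamard_psd (\<lambda>j. a_coeff (Suc j) t)" by simp
  then have "hadamard_psd (\<lambda>j. a_coeff (Suc j) t * ?\<kappa> (j + 2) + (if j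
    = 0 then (1 - a_coeff 1 t) * D else 0))"
    by (intro hadamard_psd_add hadamard_psd_mult hadamard_psd_delta
      freely_infinitely_divisible_hadamard_psd fid)
      (use a_coeff_bounds[OF t] D in auto)
  then have pos: "hadamard_psd (\<lambda>j. \<tau> (j + 2))" by (simp add: \<tau>_def)
  obtain mt where mt: "compactly_supported_prob mt" "\<And>n. n \<ge> 1 \<Longrightarrow> free_cumulant mt n = \<tau> n"
    using exists_prob_with_cumulants[OF \<tau>b C pos] by metis
  have "freely_infinitely_divisible mt"
    by (rule freely_infinitely_divisibleI[of mt C]) (use mt \<tau>b C pos in auto)
  let ?F = "\<lambda>w u. complex_of_real (std_normal_density u) * (of_real ((1 - ?c u) * D) * w
    + R_transform m (of_real (?c u) * w))"
  have main: "summable (\<lambda>k. of_real (free_cumulant mt (k + 1)) * w ^ k) \<and> integrable lborel (?F w) \<and>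
       R_transform mt w = (LINT u|lborel. ?F w u)" if w: "norm w < 1 / (2 * C)" for w :: complex
  proof -
    define f where "f k u = complex_of_real (std_normal_density u
      * evolved_mixand ?\<kappa> D (?c u) (Suc k)) * w ^ k" for k u
    have Cw: "C ^ Suc k * norm w ^ k \<le> C * (1 / 2) ^ k" for k
    proof -
      have "C * norm w \<le> 1 / 2" using w C by (simp add: field_simps)
      then have "(C * norm w) ^ k \<le> (1 / 2) ^ k" by (rule power_mono) (use C in auto)
      then show ?thesis using C by (simp add: power_mult_distrib mult.assoc)
    qed
    have sm: "summable (\<lambda>k. C * (1 / 2) ^ k)" by (intro summable_mult summable_geometric) simp
    have evb: "norm (complex_of_real (evolved_mixand ?\<kappa> D (?c u) (Suc k)) * w ^ k) \<le> C * (1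
      / 2) ^ k" for u k
    proof -
      have "\<bar>evolved_mixand ?\<kappa> D (?c u) (Suc k)\<bar> \<le> C ^ Suc k"
        unfolding evolved_mixand_def by (rule bound) (use c01 in \<open>auto simp: power_le_one\<close>)
      then have "\<bar>evolved_mixand ?\<kappa> D (?c u) (Suc k)\<bar> * norm w ^ k \<le> C ^ Suc k * norm w ^ k"
        by (rule mult_right_mono) simp
      then show ?thesis using Cw[of k] by (simp add: norm_mult norm_power)
    qed
    have fb: "norm (f k u) \<le> std_normal_density u * (C * (1 / 2) ^ k)" for k u
    proof -
      have "norm (f k u) = std_normal_density u
        * norm (complex_of_real (evolved_mixand ?\<kappa> D (?c u) (Suc k)) * w ^ k)"
        by (simp add: f_def norm_mult abs_mult mult.assoc)
      also have "\<dots> \<le> std_normal_density u * (C * (1 / 2) ^ k)" by (intro mult_left_mono evb) simp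
      finally show ?thesis .
    qed
    have fi: "integrable lborel (f k)" and fI: "(LINT u|lborel. f k u)
      = of_real (\<tau> (Suc k)) * w ^ k" for k
    proof -
      show "integrable lborel (f k)" unfolding f_def
        by (intro integrable_mult_left integrable_of_real evolved_mixand_integral(1)[OF t]) simp
      have "(LINT u|lborel. f k u) = of_real (LINT u|lborel. std_normal_density u
        * evolved_mixand ?\<kappa> D (?c u) (Suc k)) * w ^ k"
        unfolding f_def by (simp only: integral_mult_left_zero integral_complex_of_real)
      then show "(LINT u|lborel. f k u) = of_real (\<tau> (Suc k)) * w ^ k"
        using evolved_mixand_integral(2)[OF t, of "Suc k" ?\<kappa> D] by (simp add: \<tau>_def)
    qed
    have sumAE: "AE u in lborel. summable (\<lambda>k. norm (f k u))"
    proof (rule AE_I2)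
      fix u show "summable (\<lambda>k. norm (f k u))"
        by (rule summable_comparison_test'[where N
          = 0, OF summable_mult[OF sm, of "std_normal_density u"]]) (use fb in simp)
    qed
    have sumI: "summable (\<lambda>k. LINT u|lborel. norm (f k u))"
    proof (rule summable_comparison_test'[where N = 0, OF sm])
      fix k
      have "(LINT u|lborel. norm (f k u)) \<le> (LINT u|lborel. std_normal_density u * (C * (1
        / 2) ^ k))"
        by (intro integral_mono integrable_norm fi integrable_mult_left std_normal_integral fb)
      then show "norm (LINT u|lborel. norm (f k u)) \<le> C * (1 / 2) ^ k"
        by (simp add: std_normal_integral)
    qed
    have Feq: "(\<Sum>k. f k u) = ?F w u" for u
    proof -
      let ?e = "\<lambda>k. complex_of_real (evolved_mixand ?\<kappa> D (?c u) (Suc k)) * w ^ k"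
      let ?r = "\<lambda>k. complex_of_real (?\<kappa> (k + 1)) * (of_real (?c u) * w) ^ k"
      have split: "?e k = ?r k + (if k = 1 then of_real ((1 - ?c u) * D) * w else 0)" for k
        by (simp add: evolved_mixand_def power_mult_distrib algebra_simps)
      have se: "summable ?e"
        by (rule summable_comparison_test'[where N = 0, OF sm]) (rule evb)
      have s1: "(\<lambda>k. if k = 1 then of_real ((1 - ?c u) * D) * w else 0) sums (of_real ((1 - ?c u)
        * D) * w)"
        using sums_single[of 1 "\<lambda>_. of_real ((1 - ?c u) * D) * w"] by simp
      have "(\<lambda>k. ?e k - (if k = 1 then of_real ((1 - ?c u) * D) * w else 0)) sums (suminf ?e
        - of_real ((1 - ?c u) * D) * w)"
        by (intro sums_diff summable_sums se s1)
      then have "?r sums (suminf ?e - of_real ((1 - ?c u) * D) * w)" unfolding split by simp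
      then have "R_transform m (of_real (?c u) * w) = suminf ?e - of_real ((1 - ?c u) * D) * w"
        unfolding R_transform_def by (rule sums_unique[symmetric])
      moreover have "(\<Sum>k. f k u) = of_real (std_normal_density u) * suminf ?e"
        unfolding f_def of_real_mult mult.assoc by (rule suminf_mult) (rule se)
      ultimately show ?thesis by simp
    qed
    have "summable (\<lambda>k. complex_of_real (\<tau> (Suc k)) * w ^ k)"
    proof (rule summable_comparison_test'[where N = 0, OF sm])
      fix k
      have "\<bar>\<tau> (Suc k)\<bar> * norm w ^ k \<le> C ^ Suc k * norm w ^ k" by (rule mult_right_mono[OF \<tau>b]) auto
      then show "norm (complex_of_real (\<tau> (Suc k)) * w ^ k) \<le> C * (1 / 2) ^ k" using Cw[of k]
        by (simp add: norm_mult norm_power)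
    qed
    moreover have "integrable lborel (\<lambda>u. \<Sum>k. f k u)" by (rule integrable_suminf[OF fi sumAE sumI])
    moreover have "(LINT u|lborel. (\<Sum>k. f k u)) = (\<Sum>k. LINT u|lborel. f k u)"
      by (rule integral_suminf[OF fi sumAE sumI])
    ultimately show ?thesis unfolding Feq fI R_transform_def using mt(2) by simp
  qed
  have "\<forall>\<^sub>F w in nhds (0::complex). norm w < 1 / (2 * C)"
    using eventually_nhds_ball[of "1 / (2 * C)" "0::complex"] C by (simp add: eventually_mono)
  then have ev: "\<forall>\<^sub>F w in nhds 0. summable (\<lambda>k. of_real (free_cumulant mt (k + 1))
    * w ^ k) \<and> integrable lborel (?F w) \<and>
       R_transform mt w = (LINT u|lborel. ?F w u)"
    by (rule eventually_mono) (rule main)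
  show ?thesis
    by (rule that[OF mt(1) \<open>freely_infinitely_divisible mt\<close> _ ev]) (use mt(2) in \<open>simp add: \<tau>_def\<close>)
qed

section \<open>Irreducible characters of finite groups\<close>

lemma index_mult_mat_sum:
  assumes "A \<in> carrier_mat n m" "B \<in> carrier_mat m k" "i < n" "j < k"
  shows "(A * B) $$ (i, j) = (\<Sum>c<m. A $$ (i, c) * B $$ (c, j))"
  using assms by (simp add: Matrix.scalar_prod_def atLeast0LessThan)

lemma index_mult_mat_vec_sum:
  assumes "A \<in> carrier_mat n m" "v \<in> carrier_vec m" "i < n"
  shows "Matrix.vec_index (A *\<^sub>v v) i = (\<Sum>c<m. A $$ (i, c) * Matrix.vec_index v c)"
  using assms by (simp add: Matrix.scalar_prod_def atLeast0LessThan)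

lemma mat_eq_zeroI:
  fixes P :: "complex mat"
  assumes P: "P \<in> carrier_mat e d" and z: "\<And>v. v \<in> carrier_vec d \<Longrightarrow> P *\<^sub>v v = 0\<^sub>v e"
  shows "P = 0\<^sub>m e d"
proof (rule eq_matI)
  fix i j assume ij: "i < dim_row (0\<^sub>m e d :: complex mat)" "j < dim_col (0\<^sub>m e d :: complex mat)"
  have "P $$ (i, j) = (\<Sum>c<d. P $$ (i, c) * Matrix.vec_index (unit_vec d j) c)"
    using ij by (simp add: if_distrib[of "\<lambda>x. _ * x"] cong: if_cong)
  also have "\<dots> = Matrix.vec_index (P *\<^sub>v unit_vec d j) i"
    using index_mult_mat_vec_sum[OF P unit_vec_carrier[of d j], of i] ij by simp
  also have "\<dots> = 0" using z[OF unit_vec_carrier[of d j]] ij by simp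
  finally show "P $$ (i, j) = (0\<^sub>m e d) $$ (i, j)" using ij by simp
qed (use P in auto)

text \<open>
  The kernel of an intertwiner is an invariant subspace.
\<close>

lemma schur_kernel:
  assumes irr: "(d, \<rho>) \<in> irreps G" and \<sigma>: "matrix_rep G e \<sigma>" and P: "P \<in> carrier_mat e d"
    and com: "\<And>g. g \<in> carrier G \<Longrightarrow> P * \<rho> g = \<sigma> g * P"
    and v: "v \<in> carrier_vec d" "v \<noteq> 0\<^sub>v d" "P *\<^sub>v v = 0\<^sub>v e"
  shows "P = 0\<^sub>m e d"
proof -
  define W where "W = {v \<in> carrier_vec d. P *\<^sub>v v = 0\<^sub>v e}"
  have \<rho>: "\<rho> g \<in> carrier_mat d d" if "g \<in> carrier G" for g
    using irr that by (auto simp: irreps_def matrix_rep_def)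
  have \<sigma>c: "\<sigma> g \<in> carrier_mat e e" if "g \<in> carrier G" for g
    using \<sigma> that by (auto simp: matrix_rep_def)
  have "invariant_subspace G d \<rho> W"
    unfolding invariant_subspace_def
  proof (intro conjI ballI allI)
    show "W \<subseteq> carrier_vec d" by (auto simp: W_def)
    show "0\<^sub>v d \<in> W" using P by (auto simp: W_def)
    show "x + y \<in> W" if "x \<in> W" "y \<in> W" for x y
      using that P by (auto simp: W_def mult_add_distrib_mat_vec[OF P])
    show "c \<cdot>\<^sub>v x \<in> W" if "x \<in> W" for c x
      using that P by (auto simp: W_def mult_mat_vec[OF P])
    show "\<rho> g *\<^sub>v x \<in> W" if g: "g \<in> carrier G" and x: "x \<in> W" for g x
    proof -
      have xc: "x \<in> carrier_vec d" "P *\<^sub>v x = 0\<^sub>v e" using x by (auto simp: W_def)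
      have "P *\<^sub>v (\<rho> g *\<^sub>v x) = (P * \<rho> g) *\<^sub>v x" using assoc_mult_mat_vec[OF P \<rho>[OF g] xc(1)]
        by simp
      also have "\<dots> = \<sigma> g *\<^sub>v (P *\<^sub>v x)" unfolding com[OF g]
        by (rule assoc_mult_mat_vec[OF \<sigma>c[OF g] P xc(1)])
      also have "\<dots> = 0\<^sub>v e" using xc \<sigma>c[OF g] by auto
      finally show ?thesis using \<rho>[OF g] xc by (auto simp: W_def)
    qed
  qed
  then have "W = {0\<^sub>v d} \<or> W = carrier_vec d" using irr by (auto simp: irreps_def)
  moreover have "v \<in> W" using v by (simp add: W_def)
  ultimately have "W = carrier_vec d" using v(2) by auto
  then show ?thesis by (intro mat_eq_zeroI[OF P]) (auto simp: W_def)
qed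

text \<open>
  Kernel and image are invariant, so a nonzero intertwiner is bijective. The dimensions agree
  because \<open>P Q\<close> and \<open>Q P\<close> have the same trace.
\<close>

lemma schur_iso:
  assumes irr: "(d, \<rho>) \<in> irreps G" and irr': "(e, \<sigma>) \<in> irreps G" and P: "P \<in> carrier_mat e d"
    and com: "\<And>g. g \<in> carrier G \<Longrightarrow> P * \<rho> g = \<sigma> g * P" and nz: "P \<noteq> 0\<^sub>m e d"
  shows "((d, \<rho>), (e, \<sigma>)) \<in> rep_equiv G"
proof -
  have \<sigma>: "matrix_rep G e \<sigma>" using irr' by (auto simp: irreps_def)
  have \<rho>c: "\<rho> g \<in> carrier_mat d d" if "g \<in> carrier G" for g
    using irr that by (auto simp: irreps_def matrix_rep_def)
  have \<sigma>c: "\<sigma> g \<in> carrier_mat e e" if "g \<in> carrier G" for g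
    using \<sigma> that by (auto simp: matrix_rep_def)
  have inj: "v = 0\<^sub>v d" if "v \<in> carrier_vec d" "P *\<^sub>v v = 0\<^sub>v e" for v
    using schur_kernel[OF irr \<sigma> P com that(1) _ that(2)] nz by blast
  \<comment> \<open>the image of \<open>P\<close>; \<open>u\<close> and \<open>Q\<close> below invert \<open>P\<close> on the unit vectors\<close>
  define W where "W = (*\<^sub>v) P ` carrier_vec d"
  have "invariant_subspace G e \<sigma> W"
    unfolding invariant_subspace_def
  proof (intro conjI ballI allI)
    show "W \<subseteq> carrier_vec e" using P by (auto simp: W_def)
    have "P *\<^sub>v 0\<^sub>v d = 0\<^sub>v e" using P by auto
    then show "0\<^sub>v e \<in> W" unfolding W_def by (metis imageI zero_carrier_vec)
    show "x + y \<in> W" if xy: "x \<in> W" "y \<in> W" for x y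
    proof -
      obtain a b where "a \<in> carrier_vec d" "b \<in> carrier_vec d" "x = P *\<^sub>v a" "y = P *\<^sub>v b"
        using xy by (auto simp: W_def)
      then have "x + y = P *\<^sub>v (a + b)" "a + b \<in> carrier_vec d"
        by (simp_all add: mult_add_distrib_mat_vec[OF P])
      then show ?thesis by (auto simp: W_def)
    qed
    show "c \<cdot>\<^sub>v x \<in> W" if x: "x \<in> W" for c x
    proof -
      obtain a where "a \<in> carrier_vec d" "x = P *\<^sub>v a" using x by (auto simp: W_def)
      then have "c \<cdot>\<^sub>v x = P *\<^sub>v (c \<cdot>\<^sub>v a)" "c \<cdot>\<^sub>v a \<in> carrier_vec d"
        by (simp_all add: mult_mat_vec[OF P])
      then show ?thesis by (auto simp: W_def)
    qed
    show "\<sigma> g *\<^sub>v x \<in> W" if g: "g \<in> carrier G" and x: "x \<in> W" for g x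
    proof -
      obtain a where a: "a \<in> carrier_vec d" "x = P *\<^sub>v a" using x by (auto simp: W_def)
      have "\<sigma> g *\<^sub>v x = (\<sigma> g * P) *\<^sub>v a" unfolding a(2)
        by (rule assoc_mult_mat_vec[symmetric, OF \<sigma>c[OF g] P a(1)])
      also have "\<dots> = P *\<^sub>v (\<rho> g *\<^sub>v a)" unfolding com[OF g, symmetric]
        by (rule assoc_mult_mat_vec[OF P \<rho>c[OF g] a(1)])
      finally show ?thesis using \<rho>c[OF g] a(1) by (auto simp: W_def)
    qed
  qed
  then have "W = {0\<^sub>v e} \<or> W = carrier_vec e" using irr' by (auto simp: irreps_def)
  moreover have "W \<noteq> {0\<^sub>v e}"
  proof
    assume "W = {0\<^sub>v e}"
    then have "P = 0\<^sub>m e d" by (intro mat_eq_zeroI[OF P]) (auto simp: W_def)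
    then show False using nz by simp
  qed
  ultimately have surj: "W = carrier_vec e" by simp
  have "\<forall>i. \<exists>u. u \<in> carrier_vec d \<and> P *\<^sub>v u = unit_vec e i"
    using surj unit_vec_carrier[of e] unfolding W_def by (metis imageE)
  then obtain u where u: "\<And>i. u i \<in> carrier_vec d" "\<And>i. P *\<^sub>v u i = unit_vec e i" by metis
  define Q where "Q = Matrix.mat d e (\<lambda>(i, j). Matrix.vec_index (u j) i)"
  have Q: "Q \<in> carrier_mat d e" by (simp add: Q_def)
  have PQ: "P * Q = 1\<^sub>m e"
  proof (rule eq_matI)
    fix i j assume ij: "i < dim_row (1\<^sub>m e :: complex mat)" "j < dim_col (1\<^sub>m e :: complex mat)"
    have "(P * Q) $$ (i, j) = (\<Sum>c<d. P $$ (i, c) * Matrix.vec_index (u j) c)"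
      using index_mult_mat_sum[OF P Q, of i j] ij by (simp add: Q_def)
    also have "\<dots> = Matrix.vec_index (P *\<^sub>v u j) i" using index_mult_mat_vec_sum[OF P u(1)] ij
      by simp
    finally show "(P * Q) $$ (i, j) = (1\<^sub>m e) $$ (i, j)" using ij by (simp add: u(2))
  qed (use P Q in auto)
  have QP: "Q * P = 1\<^sub>m d"
  proof -
    have D: "Q * P - 1\<^sub>m d \<in> carrier_mat d d" by (rule minus_carrier_mat) simp
    have "Q * P - 1\<^sub>m d = 0\<^sub>m d d"
    proof (rule mat_eq_zeroI)
      fix v :: "complex Matrix.vec" assume v: "v \<in> carrier_vec d"
      show "(Q * P - 1\<^sub>m d) *\<^sub>v v = 0\<^sub>v d"
      proof (rule inj)
        have "P * (Q * P - 1\<^sub>m d) = 0\<^sub>m e d"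
          using P Q PQ by (simp add: mult_minus_distrib_mat[OF P, of "Q
            * P" d] assoc_mult_mat[symmetric, OF P Q P])
        then have "P *\<^sub>v ((Q * P - 1\<^sub>m d) *\<^sub>v v) = 0\<^sub>m e d *\<^sub>v v"
          using assoc_mult_mat_vec[OF P D v] by simp
        also have "\<dots> = 0\<^sub>v e"
          by (intro Matrix.eq_vecI) (use v in \<open>simp_all add: Matrix.scalar_prod_def\<close>)
        finally show "P *\<^sub>v ((Q * P - 1\<^sub>m d) *\<^sub>v v) = 0\<^sub>v e" .
        show "(Q * P - 1\<^sub>m d) *\<^sub>v v \<in> carrier_vec d" using D v by simp
      qed
    qed (use P Q in auto)
    then have "(Q * P) $$ (i, j) = 1\<^sub>m d $$ (i, j)" if "i < d" "j < d" for i j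
      using that P Q arg_cong[of "Q * P - 1\<^sub>m d" "0\<^sub>m d d" "\<lambda>A. A $$ (i, j)"] \<open>Q * P - 1\<^sub>m d
        = 0\<^sub>m d d\<close>
        index_minus_mat(1)[of i "1\<^sub>m d" j "Q * P"] by (simp del: index_mult_mat(1))
    then show ?thesis by (intro eq_matI) (use P Q in auto)
  qed
  have "(\<Sum>i<e. (P * Q) $$ (i, i)) = (\<Sum>i<e. \<Sum>c<d. P $$ (i, c) * Q $$ (c, i))"
    by (intro sum.cong refl index_mult_mat_sum[OF P Q]) auto
  also have "\<dots> = (\<Sum>c<d. \<Sum>i<e. Q $$ (c, i) * P $$ (i, c))"
    by (subst sum.swap) (simp add: mult.commute)
  also have "\<dots> = (\<Sum>c<d. (Q * P) $$ (c, c))"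
    by (intro sum.cong refl index_mult_mat_sum[OF Q P, symmetric]) auto
  finally have "of_nat e = (of_nat d :: complex)" unfolding PQ QP by simp
  then have de: "e = d" by simp
  then have "invertible_mat P" using P Q PQ QP unfolding invertible_mat_def inverts_mat_def by auto
  then show ?thesis using irr irr' P com de unfolding rep_equiv_def by auto
qed

lemma schur_scalar:
  assumes irr: "(d, \<rho>) \<in> irreps G" and P: "P \<in> carrier_mat d d"
    and com: "\<And>g. g \<in> carrier G \<Longrightarrow> P * \<rho> g = \<rho> g * P"
  obtains c where "P = c \<cdot>\<^sub>m 1\<^sub>m d"
proof -
  have d: "d > 0" and rep: "matrix_rep G d \<rho>" using irr by (auto simp: irreps_def)
  obtain c where "c \<in> spectrum P" using spectrum_non_empty[OF P d] by auto
  then obtain v where v: "v \<in> carrier_vec d" "v \<noteq> 0\<^sub>v d" "P *\<^sub>v v = c \<cdot>\<^sub>v v"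
    using P by (auto simp: spectrum_def eigenvalue_def eigenvector_def)
  let ?P = "P - c \<cdot>\<^sub>m 1\<^sub>m d"
  have "?P = 0\<^sub>m d d"
  proof (rule schur_kernel[OF irr rep])
    show "?P \<in> carrier_mat d d" using P by auto
    fix g assume g: "g \<in> carrier G"
    have \<rho>: "\<rho> g \<in> carrier_mat d d" using rep g by (auto simp: matrix_rep_def)
    have "?P * \<rho> g = P * \<rho> g - (c \<cdot>\<^sub>m 1\<^sub>m d) * \<rho> g" by (rule minus_mult_distrib_mat[OF P _ \<rho>]) auto
    also have "\<dots> = \<rho> g * P - \<rho> g * (c \<cdot>\<^sub>m 1\<^sub>m d)"
      using com[OF g] mult_smult_assoc_mat[OF one_carrier_mat \<rho>, of c] mult_smult_distrib[OF \<rho>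
        one_carrier_mat, of c] \<rho> by simp
    also have "\<dots> = \<rho> g * ?P" by (rule mult_minus_distrib_mat[symmetric, OF \<rho> P]) auto
    finally show "?P * \<rho> g = \<rho> g * ?P" .
  next
    show "?P *\<^sub>v v = 0\<^sub>v d"
      using P v minus_mult_distrib_mat_vec[of P d d "c \<cdot>\<^sub>m 1\<^sub>m d" v] by auto
  qed (use v in auto)
  then have eq0: "?P $$ (i, j) = 0\<^sub>m d d $$ (i, j)" for i j by simp
  have "P $$ (i, j) = (c \<cdot>\<^sub>m 1\<^sub>m d) $$ (i, j)" if "i < d" "j < d" for i j
    using that P eq0[of i j] by simp
  then have "P = c \<cdot>\<^sub>m 1\<^sub>m d" by (intro eq_matI) (use P in auto)
  then show ?thesis using that by blast
qed

text \<open>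
  The average \<open>\<Sum>\<^sub>g \<sigma>(g) E\<^sub>k\<^sub>l \<rho>(g\<^sup>-\<^sup>1)\<close> of an elementary matrix, whose entries are the sums in the
  orthogonality relations.
\<close>

definition averaged_mat ::
  "('a, 'b) monoid_scheme \<Rightarrow> nat \<Rightarrow> ('a \<Rightarrow> complex mat) \<Rightarrow> nat \<Rightarrow> ('a \<Rightarrow> complex mat) \<Rightarrow> nat \<Rightarrow> nat \<Rightarrow>
      complex mat" where
  "averaged_mat G e \<sigma> d \<rho> k l =
     Matrix.mat e d (\<lambda>(a, b). \<Sum>g\<in>carrier G. \<sigma> g $$ (a, k) * \<rho> (inv\<^bsub>G\<^esub> g) $$ (l, b))"

lemma averaged_mat_intertwines:
  assumes G: "group G" "finite (carrier G)" and \<rho>: "matrix_rep G d \<rho>" and \<sigma>: "matrix_rep G e \<sigma>"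
    and h: "h \<in> carrier G" and k: "k < e" and l: "l < d"
  shows "averaged_mat G e \<sigma> d \<rho> k l * \<rho> h = \<sigma> h * averaged_mat G e \<sigma> d \<rho> k l"
proof -
  interpret group G by (rule G(1))
  let ?P = "averaged_mat G e \<sigma> d \<rho> k l"
  have P: "?P \<in> carrier_mat e d" by (simp add: averaged_mat_def)
  have c: "\<And>g. g \<in> carrier G \<Longrightarrow> \<rho> g \<in> carrier_mat d d" "\<And>g. g \<in> carrier G \<Longrightarrow> \<sigma> g \<in> carrier_mat e e"
    using \<rho> \<sigma> by (auto simp: matrix_rep_def)
  have m\<rho>: "(\<Sum>c<d. \<rho> x $$ (i, c) * \<rho> y $$ (c, j)) = \<rho> (x \<otimes>\<^bsub>G\<^esub> y) $$ (i, j)"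
    if "x \<in> carrier G" "y \<in> carrier G" "i < d" "j < d" for x y i j
    using index_mult_mat_sum[OF c(1)[OF that(1)] c(1)[OF that(2)]] that \<rho>
      by (simp add: matrix_rep_def)
  have m\<sigma>: "(\<Sum>c<e. \<sigma> x $$ (i, c) * \<sigma> y $$ (c, j)) = \<sigma> (x \<otimes>\<^bsub>G\<^esub> y) $$ (i, j)"
    if "x \<in> carrier G" "y \<in> carrier G" "i < e" "j < e" for x y i j
    using index_mult_mat_sum[OF c(2)[OF that(1)] c(2)[OF that(2)]] that \<sigma>
      by (simp add: matrix_rep_def)
  show ?thesis
  proof (rule eq_matI)
    fix a b assume "a < dim_row (\<sigma> h * ?P)" "b < dim_col (\<sigma> h * ?P)"
    then have ab: "a < e" "b < d" using P c[OF h] by auto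
    have "(?P * \<rho> h) $$ (a, b) = (\<Sum>x<d. \<Sum>g\<in>carrier G. \<sigma> g $$ (a, k) * \<rho> (inv\<^bsub>G\<^esub> g) $$ (l, x)
      * \<rho> h $$ (x, b))"
      using index_mult_mat_sum[OF P c(1)[OF h] ab] ab
        by (simp add: averaged_mat_def sum_distrib_right)
    also have "\<dots> = (\<Sum>g\<in>carrier G. \<sigma> g $$ (a, k) * (\<Sum>x<d. \<rho> (inv\<^bsub>G\<^esub> g) $$ (l, x) * \<rho> h $$ (x, b)))"
      by (subst sum.swap) (simp add: sum_distrib_left mult.assoc)
    also have "\<dots> = (\<Sum>g\<in>carrier G. \<sigma> g $$ (a, k) * \<rho> (inv\<^bsub>G\<^esub> g \<otimes>\<^bsub>G\<^esub> h) $$ (l, b))"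
      using ab l h by (intro sum.cong refl arg_cong2[where f = "(*)"] m\<rho>) auto
    also have "\<dots> = (\<Sum>g\<in>carrier G. \<sigma> (h \<otimes>\<^bsub>G\<^esub> g) $$ (a, k) * \<rho> (inv\<^bsub>G\<^esub> g) $$ (l, b))"
    proof (rule sum.reindex_bij_witness[of _ "\<lambda>g. h \<otimes>\<^bsub>G\<^esub> g" "\<lambda>g. inv\<^bsub>G\<^esub> h \<otimes>\<^bsub>G\<^esub> g"])
      fix g assume "g \<in> carrier G"
      then show "\<sigma> (h \<otimes>\<^bsub>G\<^esub> (inv\<^bsub>G\<^esub> h \<otimes>\<^bsub>G\<^esub> g)) $$ (a, k) * \<rho> (inv\<^bsub>G\<^esub> (inv\<^bsub>G\<^esub> h \<otimes>\<^bsub>G\<^esub> g)) $$ (l, b) =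
         \<sigma> g $$ (a, k) * \<rho> (inv\<^bsub>G\<^esub> g \<otimes>\<^bsub>G\<^esub> h) $$ (l, b)"
        using h by (simp add: inv_mult_group flip: m_assoc)
    qed (use h in \<open>auto simp flip: m_assoc\<close>)
    also have "\<dots> = (\<Sum>g\<in>carrier G. (\<Sum>x<e. \<sigma> h $$ (a, x) * \<sigma> g $$ (x, k)) * \<rho> (inv\<^bsub>G\<^esub> g) $$ (l, b))"
      using ab k h by (intro sum.cong refl arg_cong2[where f = "(*)"] m\<sigma>[symmetric]) auto
    also have "\<dots> = (\<Sum>x<e. \<sigma> h $$ (a, x) * (\<Sum>g\<in>carrier G. \<sigma> g $$ (x, k) * \<rho> (inv\<^bsub>G\<^esub> g) $$ (l, b)))"
      unfolding sum_distrib_left sum_distrib_right by (subst sum.swap) (simp add: mult.assoc)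
    also have "\<dots> = (\<sigma> h * ?P) $$ (a, b)"
      using index_mult_mat_sum[OF c(2)[OF h] P ab] ab by (simp add: averaged_mat_def)
    finally show "(?P * \<rho> h) $$ (a, b) = (\<sigma> h * ?P) $$ (a, b)" .
  qed (use P c[OF h] in auto)
qed

definition rep_char :: "nat \<Rightarrow> ('a \<Rightarrow> complex mat) \<Rightarrow> 'a \<Rightarrow> complex" where
  "rep_char d \<rho> g = (\<Sum>i<d. \<rho> g $$ (i, i))"

lemma rep_char_product_sum:
  "(\<Sum>g\<in>carrier G. rep_char e \<sigma> g * rep_char d \<rho> (inv\<^bsub>G\<^esub> g)) =
     (\<Sum>a<e. \<Sum>b<d. averaged_mat G e \<sigma> d \<rho> a b $$ (a, b))"
proof -
  have "(\<Sum>g\<in>carrier G. rep_char e \<sigma> g * rep_char d \<rho> (inv\<^bsub>G\<^esub> g)) =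
     (\<Sum>g\<in>carrier G. \<Sum>a<e. \<Sum>b<d. \<sigma> g $$ (a, a) * \<rho> (inv\<^bsub>G\<^esub> g) $$ (b, b))"
    by (simp add: rep_char_def sum_product)
  also have "\<dots> = (\<Sum>a<e. \<Sum>b<d. \<Sum>g\<in>carrier G. \<sigma> g $$ (a, a) * \<rho> (inv\<^bsub>G\<^esub> g) $$ (b, b))"
    by (subst sum.swap, intro sum.cong refl, rule sum.swap)
  finally show ?thesis by (simp add: averaged_mat_def)
qed

lemma rep_char_orthogonal:
  assumes G: "group G" "finite (carrier G)" and irr: "(d, \<rho>) \<in> irreps G" "(e, \<sigma>) \<in> irreps G"
    and ne: "((d, \<rho>), (e, \<sigma>)) \<notin> rep_equiv G"
  shows "(\<Sum>g\<in>carrier G. rep_char e \<sigma> g * rep_char d \<rho> (inv\<^bsub>G\<^esub> g)) = 0"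
proof -
  have rep: "matrix_rep G d \<rho>" "matrix_rep G e \<sigma>" using irr by (auto simp: irreps_def)
  have "averaged_mat G e \<sigma> d \<rho> a b = 0\<^sub>m e d" if "a < e" "b < d" for a b
  proof (rule ccontr)
    assume nz: "averaged_mat G e \<sigma> d \<rho> a b \<noteq> 0\<^sub>m e d"
    have "((d, \<rho>), (e, \<sigma>)) \<in> rep_equiv G"
      by (rule schur_iso[OF irr _ _ nz])
        (use averaged_mat_intertwines[OF G rep _ that] in \<open>auto simp: averaged_mat_def\<close>)
    then show False using ne by simp
  qed
  then show ?thesis unfolding rep_char_product_sum by (intro sum.neutral ballI) simp
qed

lemma rep_char_norm:
  assumes G: "group G" "finite (carrier G)" and irr: "(d, \<rho>) \<in> irreps G"
  shows "(\<Sum>g\<in>carrier G. rep_char d \<rho> g * rep_char d \<rho> (inv\<^bsub>G\<^esub> g)) = of_nat (card (carrier G))"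
proof -
  interpret group G by (rule G(1))
  have rep: "matrix_rep G d \<rho>" and d: "d > 0" using irr by (auto simp: irreps_def)
  have c: "\<And>g. g \<in> carrier G \<Longrightarrow> \<rho> g \<in> carrier_mat d d" using rep by (auto simp: matrix_rep_def)
  let ?P = "averaged_mat G d \<rho> d \<rho>"
  have scal: "\<exists>c. ?P a b = c \<cdot>\<^sub>m 1\<^sub>m d" if "a < d" "b < d" for a b
  proof -
    have "?P a b \<in> carrier_mat d d" by (simp add: averaged_mat_def)
    then show ?thesis
      using schur_scalar[OF irr, of "?P a b"] averaged_mat_intertwines[OF G rep rep _ that] by metis
  qed
  have diag: "(\<Sum>i<d. ?P a b $$ (i, i)) = (if a
    = b then of_nat (card (carrier G)) else 0)" if ab: "a < d" "b < d" for a b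
  proof -
    have "(\<Sum>i<d. ?P a b $$ (i, i)) = (\<Sum>g\<in>carrier G. \<Sum>i<d. \<rho> (inv\<^bsub>G\<^esub> g) $$ (b, i) * \<rho> g $$ (i, a))"
      by (simp add: averaged_mat_def mult.commute) (rule sum.swap)
    also have "\<dots> = (\<Sum>g\<in>carrier G. (1\<^sub>m d) $$ (b, a))"
    proof (rule sum.cong[OF refl])
      fix g assume g: "g \<in> carrier G"
      then have "(\<Sum>i<d. \<rho> (inv\<^bsub>G\<^esub> g) $$ (b, i) * \<rho> g $$ (i, a)) = (\<rho> (inv\<^bsub>G\<^esub> g) * \<rho> g) $$ (b, a)"
        using index_mult_mat_sum[OF c c, of "inv\<^bsub>G\<^esub> g" g b a] ab by simp
      also have "\<rho> (inv\<^bsub>G\<^esub> g) * \<rho> g = \<rho> (inv\<^bsub>G\<^esub> g \<otimes>\<^bsub>G\<^esub> g)" using rep g inv_closed[OF g]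
        unfolding matrix_rep_def by metis
      also have "\<dots> = 1\<^sub>m d" using rep g by (simp add: matrix_rep_def)
      finally show "(\<Sum>i<d. \<rho> (inv\<^bsub>G\<^esub> g) $$ (b, i) * \<rho> g $$ (i, a)) = (1\<^sub>m d) $$ (b, a)" .
    qed
    finally show ?thesis using ab by simp
  qed
  have entry: "?P a b $$ (a, b) = (if a = b then of_nat (card (carrier G))
    / of_nat d else 0)" if ab: "a < d" "b < d" for a b
  proof -
    obtain x where x: "?P a b = x \<cdot>\<^sub>m 1\<^sub>m d" using scal[OF ab] by blast
    have "of_nat d * x = (if a = b then of_nat (card (carrier G)) else 0)"
      using diag[OF ab] unfolding x by simp
    then show ?thesis using d ab unfolding x by (auto simp: field_simps)
  qed
  have "(\<Sum>a<d. \<Sum>b<d. ?P a b $$ (a, b)) = (\<Sum>a<d. \<Sum>b<d. if a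
    = b then of_nat (card (carrier G)) / of_nat d else 0)"
    by (intro sum.cong refl entry) auto
  also have "\<dots> = of_nat (card (carrier G))" using d by simp
  finally show ?thesis unfolding rep_char_product_sum .
qed

lemma rep_char_conj:
  assumes "group G" and rep: "matrix_rep G d \<rho>" and g: "g \<in> carrier G" "x \<in> carrier G"
  shows "rep_char d \<rho> (g \<otimes>\<^bsub>G\<^esub> x \<otimes>\<^bsub>G\<^esub> inv\<^bsub>G\<^esub> g) = rep_char d \<rho> x"
proof -
  interpret group G by (rule assms(1))
  have c: "\<And>g. g \<in> carrier G \<Longrightarrow> \<rho> g \<in> carrier_mat d d" using rep by (auto simp: matrix_rep_def)
  have mult: "\<rho> (a \<otimes>\<^bsub>G\<^esub> b) = \<rho> a * \<rho> b" if "a \<in> carrier G" "b \<in> carrier G" for a b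
    using rep that by (simp add: matrix_rep_def)
  have tr: "rep_char d \<rho> (a \<otimes>\<^bsub>G\<^esub> b) = rep_char d \<rho> (b \<otimes>\<^bsub>G\<^esub> a)" if "a \<in> carrier G" "b \<in> carrier G"
    for a b
  proof -
    have "rep_char d \<rho> (a \<otimes>\<^bsub>G\<^esub> b) = (\<Sum>i<d. \<Sum>j<d. \<rho> a $$ (i, j) * \<rho> b $$ (j, i))"
      unfolding rep_char_def mult[OF that] by (intro sum.cong refl index_mult_mat_sum[OF c c])
        (use that in auto)
    also have "\<dots> = (\<Sum>j<d. \<Sum>i<d. \<rho> b $$ (j, i) * \<rho> a $$ (i, j))"
      by (subst sum.swap) (simp add: mult.commute)
    also have "\<dots> = rep_char d \<rho> (b \<otimes>\<^bsub>G\<^esub> a)"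
      unfolding rep_char_def mult[OF that(2,1)]
        by (intro sum.cong refl index_mult_mat_sum[OF c c, symmetric]) (use that in auto)
    finally show ?thesis .
  qed
  have "rep_char d \<rho> ((g \<otimes>\<^bsub>G\<^esub> x) \<otimes>\<^bsub>G\<^esub> inv\<^bsub>G\<^esub> g) = rep_char d \<rho> (inv\<^bsub>G\<^esub> g \<otimes>\<^bsub>G\<^esub> (g \<otimes>\<^bsub>G\<^esub> x))"
    by (rule tr) (use g in auto)
  also have "inv\<^bsub>G\<^esub> g \<otimes>\<^bsub>G\<^esub> (g \<otimes>\<^bsub>G\<^esub> x) = x" using g by (simp flip: m_assoc)
  finally show ?thesis .
qed

text \<open>
  For upper triangular matrices the diagonal is multiplicative.
\<close>

lemma diag_pow_upper_triangular:
  fixes B :: "complex mat"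
  assumes B: "B \<in> carrier_mat d d" and up: "upper_triangular B"
  shows "upper_triangular (B ^\<^sub>m n)" "i < d \<Longrightarrow> (B ^\<^sub>m n) $$ (i, i) = (B $$ (i, i)) ^ n"
proof -
  have ut: "A $$ (i, j) = 0" if "upper_triangular A" "A \<in> carrier_mat d d" "j < i"
    "i < d" for A :: "complex mat" and i j
    using upper_triangularD[of A j i] that by auto
  have "upper_triangular (B ^\<^sub>m n) \<and> (\<forall>i<d. (B ^\<^sub>m n) $$ (i, i) = (B $$ (i, i)) ^ n)"
  proof (induction n)
    case 0
    then show ?case using B by (auto intro: upper_triangularI)
  next
    case (Suc n)
    have Bn: "B ^\<^sub>m n \<in> carrier_mat d d" by (rule pow_carrier_mat[OF B])
    have ent: "(B ^\<^sub>m Suc n) $$ (i, j) = (\<Sum>c<d. (B ^\<^sub>m n) $$ (i, c) * B $$ (c, j))"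
      if "i < d" "j < d" for i j
      using index_mult_mat_sum[OF Bn B that] by simp
    have z: "(B ^\<^sub>m n) $$ (i, c) * B $$ (c, j) = 0" if "i < d" "j < d" "c < d" "c < i \<or> j < c"
      for i j c
      using ut[of "B ^\<^sub>m n" c i] ut[of B j c] Suc Bn B up that by auto
    have "upper_triangular (B ^\<^sub>m Suc n)"
    proof (rule upper_triangularI)
      fix i j assume ij: "j < i" "i < dim_row (B ^\<^sub>m Suc n)"
      then have i: "i < d" using ij(2) B by simp
      show "(B ^\<^sub>m Suc n) $$ (i, j) = 0"
      proof -
        have "(B ^\<^sub>m Suc n) $$ (i, j) = (\<Sum>c<d. (B ^\<^sub>m n) $$ (i, c) * B $$ (c, j))"
          by (rule ent) (use i ij in auto)
        also have "\<dots> = 0"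
        proof (intro sum.neutral ballI)
          fix c assume "c \<in> {..<d}"
          moreover have "c < i \<or> j < c" using ij by auto
          ultimately show "(B ^\<^sub>m n) $$ (i, c) * B $$ (c, j) = 0" by (intro z) (use i ij in auto)
        qed
        finally show ?thesis .
      qed
    qed
    moreover have "(B ^\<^sub>m Suc n) $$ (i, i) = (B $$ (i, i)) ^ Suc n" if i: "i < d" for i
    proof -
      have "(B ^\<^sub>m Suc n) $$ (i, i) = (\<Sum>c\<in>{i}. (B ^\<^sub>m n) $$ (i, c) * B $$ (c, i))"
        unfolding ent[OF i i] by (rule sum.mono_neutral_right) (use i z[OF i i] in \<open>auto simp del:
          mult_eq_0_iff simp: nat_neq_iff\<close>)
      then show ?thesis using Suc i by simp
    qed
    ultimately show ?case by blast
  qed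
  then show "upper_triangular (B ^\<^sub>m n)" "i < d \<Longrightarrow> (B ^\<^sub>m n) $$ (i, i) = (B $$ (i, i)) ^ n" by blast+
qed

lemma finite_group_pow_eq_one:
  assumes "group G" "finite (carrier G)" and g: "g \<in> carrier G"
  shows "\<exists>n > 0. g [^]\<^bsub>G\<^esub> (n::nat) = \<one>\<^bsub>G\<^esub>"
proof -
  interpret group G by (rule assms(1))
  have "\<not> inj_on (\<lambda>k::nat. g [^]\<^bsub>G\<^esub> k) {..card (carrier G)}"
  proof
    assume "inj_on (\<lambda>k::nat. g [^]\<^bsub>G\<^esub> k) {..card (carrier G)}"
    then have "card {..card (carrier G)} \<le> card (carrier G)"
      by (rule card_inj_on_le) (use g assms(2) in auto)
    then show False by simp
  qed
  then obtain i j :: nat where ij: "i < j" "g [^]\<^bsub>G\<^esub> i = g [^]\<^bsub>G\<^esub> j"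
    unfolding inj_on_def by (metis linorder_neqE_nat)
  have "g [^]\<^bsub>G\<^esub> i \<otimes>\<^bsub>G\<^esub> g [^]\<^bsub>G\<^esub> (j - i) = g [^]\<^bsub>G\<^esub> (i + (j - i))"
    by (rule nat_pow_mult[OF g])
  also have "\<dots> = g [^]\<^bsub>G\<^esub> i" using ij by simp
  finally have "g [^]\<^bsub>G\<^esub> (j - i) = \<one>\<^bsub>G\<^esub>"
    using g by (simp only: l_cancel_one nat_pow_closed)
  then show ?thesis using ij(1) by (intro exI[of _ "j - i"]) simp
qed

text \<open>
  After triangularisation the diagonal entries of \<open>\<rho>(g)\<close> are roots of unity \<open>z\<close>, and with
  \<open>g\<^sup>n = 1\<close> the entries of \<open>\<rho>(g\<^sup>-\<^sup>1) = \<rho>(g)\<^sup>n\<^sup>-\<^sup>1\<close> are \<open>z\<^sup>n\<^sup>-\<^sup>1\<close>, the complex conjugate of \<open>z\<close>.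
\<close>

lemma rep_char_inv:
  assumes G: "group G" "finite (carrier G)" and rep: "matrix_rep G d \<rho>" and g: "g \<in> carrier G"
  shows "rep_char d \<rho> (inv\<^bsub>G\<^esub> g) = cnj (rep_char d \<rho> g)"
proof -
  interpret group G by (rule G(1))
  have c: "\<And>g. g \<in> carrier G \<Longrightarrow> \<rho> g \<in> carrier_mat d d" using rep by (auto simp: matrix_rep_def)
  obtain n :: nat where n: "n > 0" and gn: "g [^]\<^bsub>G\<^esub> n = \<one>\<^bsub>G\<^esub>"
    using finite_group_pow_eq_one[OF G g] by blast
  have pow: "\<rho> (g [^]\<^bsub>G\<^esub> k) = \<rho> g ^\<^sub>m k" for k :: nat
  proof (induction k)
    case 0
    then show ?case using rep c[OF g] by (simp add: matrix_rep_def)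
  next
    case (Suc k)
    then show ?case using rep g by (simp add: matrix_rep_def)
  qed
  obtain k where k: "n = Suc k" using n by (cases n) auto
  have inv: "inv\<^bsub>G\<^esub> g = g [^]\<^bsub>G\<^esub> k"
    using gn g unfolding k by (intro inv_equality) simp_all
  obtain es where "char_poly (\<rho> g) = (\<Prod>a\<leftarrow>es. [:- a, 1:])"
    using char_poly_factorized[OF c[OF g]] by blast
  then obtain B where B: "B \<in> carrier_mat d d" "upper_triangular B" "similar_mat (\<rho> g) B"
    using schur_decomposition_exists[OF c[OF g]] by blast
  then obtain P Q where wit: "similar_mat_wit (\<rho> g) B P Q" by (auto simp: similar_mat_def)
  note W = similar_mat_witD2[OF c[OF g] wit]
  have tr: "(\<Sum>i<d. (\<rho> g ^\<^sub>m m) $$ (i, i)) = (\<Sum>i<d. (B $$ (i, i)) ^ m)" for m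
  proof -
    have Bm: "B ^\<^sub>m m \<in> carrier_mat d d" by (rule pow_carrier_mat[OF B(1)])
    have PB: "P * B ^\<^sub>m m \<in> carrier_mat d d" using W(6) Bm by simp
    have "\<rho> g ^\<^sub>m m = P * B ^\<^sub>m m * Q" by (rule similar_mat_wit_pow_id[OF wit])
    then have "(\<Sum>i<d. (\<rho> g ^\<^sub>m m) $$ (i, i)) = (\<Sum>i<d. \<Sum>j<d. (P * B ^\<^sub>m m) $$ (i, j) * Q $$ (j, i))"
      using index_mult_mat_sum[OF PB W(7)] by (simp del: index_mult_mat(1))
    also have "\<dots> = (\<Sum>j<d. \<Sum>i<d. Q $$ (j, i) * (P * B ^\<^sub>m m) $$ (i, j))"
      by (subst sum.swap) (simp add: mult.commute)
    also have "\<dots> = (\<Sum>j<d. (Q * (P * B ^\<^sub>m m)) $$ (j, j))"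
      using index_mult_mat_sum[OF W(7) PB] by (simp del: index_mult_mat(1))
    also have "Q * (P * B ^\<^sub>m m) = B ^\<^sub>m m"
      using assoc_mult_mat[OF W(7,6) Bm] W(2) left_mult_one_mat[OF Bm] by metis
    finally show ?thesis using diag_pow_upper_triangular(2)[OF B(1,2)] by simp
  qed
  have eig: "(B $$ (i, i)) ^ n = 1" if i: "i < d" for i
  proof -
    have "B = Q * \<rho> g * P" using similar_mat_witD2(3)[OF B(1) similar_mat_wit_sym[OF wit]] .
    have "B ^\<^sub>m n = Q * \<rho> g ^\<^sub>m n * P" by (rule similar_mat_wit_pow_id[OF similar_mat_wit_sym[OF
      wit]])
    also have "\<rho> g ^\<^sub>m n = 1\<^sub>m d" unfolding pow[symmetric] gn using rep
      by (simp add: matrix_rep_def)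
    also have "Q * 1\<^sub>m d * P = 1\<^sub>m d" using W by simp
    finally show ?thesis using diag_pow_upper_triangular(2)[OF B(1,2) i, of n] i by simp
  qed
  have "(B $$ (i, i)) ^ k = cnj (B $$ (i, i))" if i: "i < d" for i
  proof -
    let ?z = "B $$ (i, i)"
    have "norm ?z ^ n = 1" using arg_cong[OF eig[OF i], of norm] by (simp add: norm_power)
    then have "norm ?z = 1" using n power_eq_imp_eq_base[of "norm ?z" n 1] by simp
    then have zc: "?z * cnj ?z = 1" by (simp add: complex_norm_square[symmetric])
    have "?z ^ k = ?z ^ k * (?z * cnj ?z)" by (simp add: zc)
    also have "\<dots> = ?z ^ n * cnj ?z" by (simp add: k mult_ac)
    finally show ?thesis using eig[OF i] by simp
  qed
  then have "(\<Sum>i<d. (\<rho> g ^\<^sub>m k) $$ (i, i)) = cnj (\<Sum>i<d. (\<rho> g ^\<^sub>m 1) $$ (i, i))"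
    unfolding tr by simp
  then show ?thesis using c[OF g] by (simp add: rep_char_def inv pow)
qed

lemma invertible_matI:
  assumes "P \<in> carrier_mat d d" "Q \<in> carrier_mat d d" "P * Q = 1\<^sub>m d" "Q * P = 1\<^sub>m d"
  shows "invertible_mat P"
  using assms unfolding invertible_mat_def inverts_mat_def by auto

lemma rep_equivI:
  assumes "(d, \<rho>) \<in> irreps G" "(d, \<sigma>) \<in> irreps G" "P \<in> carrier_mat d d" "invertible_mat P"
    "\<And>g. g \<in> carrier G \<Longrightarrow> P * \<rho> g = \<sigma> g * P"
  shows "((d, \<rho>), (d, \<sigma>)) \<in> rep_equiv G"
  using assms unfolding rep_equiv_def by auto

section \<open>Classes of irreducible representations and of group elements\<close>

lemma equiv_rep_equiv: "equiv (irreps G) (rep_equiv G)"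
proof (rule equivI)
  have car: "\<rho> g \<in> carrier_mat d d" if "(d, \<rho>) \<in> irreps G" "g \<in> carrier G" for d \<rho> g
    using that by (auto simp: irreps_def matrix_rep_def)
  show "rep_equiv G \<subseteq> irreps G \<times> irreps G" by (auto simp: rep_equiv_def)
  show "refl_on (irreps G) (rep_equiv G)"
  proof (rule refl_onI)
    fix x assume x: "x \<in> irreps G"
    obtain d \<rho> where dr: "x = (d, \<rho>)" by force
    have "invertible_mat (1\<^sub>m d :: complex mat)" by (rule invertible_matI[of _ d "1\<^sub>m d"]) auto
    moreover have "1\<^sub>m d * \<rho> g = \<rho> g * 1\<^sub>m d" if "g \<in> carrier G" for g
      using car[of d \<rho> g] x dr that by simp
    ultimately show "(x, x) \<in> rep_equiv G" using x unfolding dr by (intro rep_equivI) auto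
  qed
  have inv: "\<exists>Q\<in>carrier_mat d d. P * Q = 1\<^sub>m d \<and> Q * P
    = 1\<^sub>m d" if Pc: "P \<in> carrier_mat d d" and Pi: "invertible_mat P" for d and P :: "complex mat"
  proof -
    obtain Q where Q: "inverts_mat P Q" "inverts_mat Q P" using Pi
      by (auto simp: invertible_mat_def)
    then have "P * Q = 1\<^sub>m d" "Q * P = 1\<^sub>m (dim_row Q)" using Pc by (auto simp: inverts_mat_def)
    moreover have "dim_col Q = d" using arg_cong[OF \<open>P * Q = 1\<^sub>m d\<close>, of dim_col] by simp
    moreover have "dim_row Q = d" using arg_cong[OF \<open>Q * P = 1\<^sub>m (dim_row Q)\<close>, of dim_col] that(1)
      by simp
    ultimately show ?thesis by (intro bexI[of _ Q]) auto
  qed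
  show "sym (rep_equiv G)"
  proof (rule symI)
    fix x y assume xy: "(x, y) \<in> rep_equiv G"
    obtain d \<rho> \<sigma> where dr: "x = (d, \<rho>)" "y = (d, \<sigma>)" using xy by (auto simp: rep_equiv_def)
    then obtain P where P: "P \<in> carrier_mat d d" "invertible_mat P" "\<And>g. g \<in> carrier G \<Longrightarrow> P * \<rho> g
      = \<sigma> g * P"
      and irr: "(d, \<rho>) \<in> irreps G" "(d, \<sigma>) \<in> irreps G" using xy by (auto simp: rep_equiv_def)
    obtain Q where Q: "Q \<in> carrier_mat d d" "P * Q = 1\<^sub>m d" "Q * P = 1\<^sub>m d" using inv[OF P(1,2)]
      by blast
    have "Q * \<sigma> g = \<rho> g * Q" if g: "g \<in> carrier G" for g
    proof -
      note c = car[OF irr(1) g] car[OF irr(2) g]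
      have "Q * \<sigma> g = Q * (\<sigma> g * (P * Q))" using Q c by simp
      also have "\<dots> = Q * ((\<sigma> g * P) * Q)" using assoc_mult_mat[OF c(2) P(1) Q(1)] by simp
      also have "\<dots> = Q * ((P * \<rho> g) * Q)" using P(3)[OF g] by simp
      also have "\<dots> = Q * (P * (\<rho> g * Q))" using assoc_mult_mat[OF P(1) c(1) Q(1)] by simp
      also have "\<dots> = (Q * P) * (\<rho> g * Q)" using assoc_mult_mat[OF Q(1) P(1), of "\<rho> g * Q" d] c Q
        by simp
      also have "\<dots> = \<rho> g * Q" using Q c by simp
      finally show ?thesis .
    qed
    then show "(y, x) \<in> rep_equiv G" unfolding dr
      by (rule rep_equivI[OF irr(2,1) Q(1) invertible_matI[OF Q(1) P(1) Q(3,2)]])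
  qed
  show "trans (rep_equiv G)"
  proof (rule transI)
    fix x y z assume xy: "(x, y) \<in> rep_equiv G" and yz: "(y, z) \<in> rep_equiv G"
    obtain d \<rho> \<sigma> \<tau> where dr: "x = (d, \<rho>)" "y = (d, \<sigma>)" "z = (d, \<tau>)" using xy yz
      by (auto simp: rep_equiv_def)
    obtain P where P: "P \<in> carrier_mat d d" "invertible_mat P" "\<And>g. g \<in> carrier G \<Longrightarrow> P * \<rho> g
      = \<sigma> g * P"
      using xy unfolding dr rep_equiv_def by auto
    obtain R where R: "R \<in> carrier_mat d d" "invertible_mat R" "\<And>g. g \<in> carrier G \<Longrightarrow> R * \<sigma> g
      = \<tau> g * R"
      using yz unfolding dr rep_equiv_def by auto
    have irr: "(d, \<rho>) \<in> irreps G" "(d, \<sigma>) \<in> irreps G" "(d, \<tau>) \<in> irreps G" using xy yz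
      unfolding dr rep_equiv_def by auto
    have "(R * P) * \<rho> g = \<tau> g * (R * P)" if g: "g \<in> carrier G" for g
    proof -
      note c = car[OF irr(1) g] car[OF irr(2) g] car[OF irr(3) g]
      have "(R * P) * \<rho> g = R * (\<sigma> g * P)" using assoc_mult_mat[OF R(1) P(1) c(1)] P(3)[OF g]
        by simp
      also have "\<dots> = (\<tau> g * R) * P" using assoc_mult_mat[OF R(1) c(2) P(1)] R(3)[OF g] by simp
      also have "\<dots> = \<tau> g * (R * P)" by (rule assoc_mult_mat[OF c(3) R(1) P(1)])
      finally show ?thesis .
    qed
    moreover have "invertible_mat (R * P)"
    proof -
      obtain Q S where Q: "Q \<in> carrier_mat d d" "P * Q = 1\<^sub>m d" "Q * P = 1\<^sub>m d"
        and S: "S \<in> carrier_mat d d" "R * S = 1\<^sub>m d" "S * R = 1\<^sub>m d"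
        using inv[OF P(1,2)] inv[OF R(1,2)] by blast
      have "(R * P) * (Q * S) = R * ((P * Q) * S)" using R(1) P(1) Q(1) S(1)
        by (simp add: assoc_mult_mat[of _ d d _ d _ d])
      also have "\<dots> = 1\<^sub>m d" using Q S by simp
      finally have 1: "(R * P) * (Q * S) = 1\<^sub>m d" .
      have "(Q * S) * (R * P) = Q * ((S * R) * P)" using R(1) P(1) Q(1) S(1)
        by (simp add: assoc_mult_mat[of _ d d _ d _ d])
      also have "\<dots> = 1\<^sub>m d" using Q S P(1) by simp
      finally have 2: "(Q * S) * (R * P) = 1\<^sub>m d" .
      show ?thesis by (rule invertible_matI[OF _ _ 1 2]) (use R(1) P(1) Q(1) S(1) in auto)
    qed
    ultimately show "(x, z) \<in> rep_equiv G" unfolding dr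
      by (intro rep_equivI[OF irr(1,3), of "R * P"]) (use R(1) P(1) in auto)
  qed
qed

lemma irr_class_representative:
  assumes "\<zeta> \<in> irr_classes G"
  shows "(irr_dim \<zeta>, irr_rep \<zeta>) \<in> \<zeta>" "(irr_dim \<zeta>, irr_rep \<zeta>) \<in> irreps G"
proof -
  have "\<zeta> \<noteq> {}" using assms in_quotient_imp_non_empty[OF equiv_rep_equiv]
    unfolding irr_classes_def by blast
  then show mem: "(irr_dim \<zeta>, irr_rep \<zeta>) \<in> \<zeta>"
    unfolding irr_dim_def irr_rep_def by (simp add: some_in_eq)
  show "(irr_dim \<zeta>, irr_rep \<zeta>) \<in> irreps G"
    using in_quotient_imp_subset[OF equiv_rep_equiv, of \<zeta>] mem assms unfolding irr_classes_def
      by blast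
qed

lemma irr_char_eq_rep_char: "irr_char \<zeta> = rep_char (irr_dim \<zeta>) (irr_rep \<zeta>)"
  by (simp add: irr_char_def rep_char_def fun_eq_iff)

lemma matrix_rep_irr_rep: "\<zeta> \<in> irr_classes G \<Longrightarrow> matrix_rep G (irr_dim \<zeta>) (irr_rep \<zeta>)"
  using irr_class_representative(2) by (auto simp: irreps_def)

lemma irr_dim_pos: "\<zeta> \<in> irr_classes G \<Longrightarrow> irr_dim \<zeta> > 0"
  using irr_class_representative(2)[of \<zeta> G] by (auto simp: irreps_def)

lemma irr_char_one: "\<zeta> \<in> irr_classes G \<Longrightarrow> irr_char \<zeta> \<one>\<^bsub>G\<^esub> = of_nat (irr_dim \<zeta>)"
  using matrix_rep_irr_rep[of \<zeta> G] by (simp add: irr_char_def matrix_rep_def)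

lemma irr_char_conj:
  assumes "group G" "\<zeta> \<in> irr_classes G" "g \<in> carrier G" "x \<in> carrier G"
  shows "irr_char \<zeta> (g \<otimes>\<^bsub>G\<^esub> x \<otimes>\<^bsub>G\<^esub> inv\<^bsub>G\<^esub> g) = irr_char \<zeta> x"
  unfolding irr_char_eq_rep_char by (rule rep_char_conj[OF assms(1) matrix_rep_irr_rep[OF
    assms(2)] assms(3,4)])

lemma irr_char_orthogonal:
  assumes G: "group G" "finite (carrier G)" and "\<zeta> \<in> irr_classes G" "\<eta> \<in> irr_classes G"
  shows "(\<Sum>g\<in>carrier G. irr_char \<eta> g * cnj (irr_char \<zeta> g)) = (if \<zeta>
    = \<eta> then of_nat (card (carrier G)) else 0)"
proof -
  let ?d = "irr_dim \<zeta>" and ?\<rho> = "irr_rep \<zeta>" and ?e = "irr_dim \<eta>" and ?\<sigma> = "irr_rep \<eta>"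
  note r = irr_class_representative[OF assms(3)] and s = irr_class_representative[OF assms(4)]
  have "(\<Sum>g\<in>carrier G. irr_char \<eta> g * cnj (irr_char \<zeta> g)) =
      (\<Sum>g\<in>carrier G. rep_char ?e ?\<sigma> g * rep_char ?d ?\<rho> (inv\<^bsub>G\<^esub> g))"
    unfolding irr_char_eq_rep_char using rep_char_inv[OF G matrix_rep_irr_rep[OF assms(3)]] by simp
  also have "\<dots> = (if \<zeta> = \<eta> then of_nat (card (carrier G)) else 0)"
  proof (cases "\<zeta> = \<eta>")
    case True
    then show ?thesis using rep_char_norm[OF G r(2)] by simp
  next
    case False
    have "((?d, ?\<rho>), (?e, ?\<sigma>)) \<notin> rep_equiv G"
      using False quotient_eqI[OF equiv_rep_equiv, of \<zeta> G \<eta>] assms(3,4) r(1) s(1)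
        unfolding irr_classes_def by blast
    then show ?thesis using False rep_char_orthogonal[OF G r(2) s(2)] by simp
  qed
  finally show ?thesis .
qed

text \<open>
  Bessel's inequality for the delta function at the identity, whose coefficient at \<open>\<zeta>\<close> is
  \<open>dim \<zeta>\<close>. It serves to show that there are finitely many classes.
\<close>

lemma sum_irr_dim_square_le:
  assumes G: "group G" "finite (carrier G)" and F: "finite F" "F \<subseteq> irr_classes G"
  shows "(\<Sum>\<zeta>\<in>F. (real (irr_dim \<zeta>))\<^sup>2) \<le> real (card (carrier G))"
proof -
  interpret group G by (rule G(1))
  let ?n = "card (carrier G)" and ?d = "\<lambda>\<zeta>. complex_of_nat (irr_dim \<zeta>)"
  let ?S = "\<Sum>\<zeta>\<in>F. ?d \<zeta> * ?d \<zeta>"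
  have n: "?n > 0" using G(2) by (simp add: card_gt_0_iff) (metis empty_iff one_closed)
  \<comment> \<open>scaled so that the projection onto the span of the characters is \<open>p\<close>\<close>
  define \<delta> where "\<delta> g = (if g = \<one>\<^bsub>G\<^esub> then complex_of_nat ?n else 0)" for g
  define p where "p g = (\<Sum>\<zeta>\<in>F. ?d \<zeta> * irr_char \<zeta> g)" for g
  have \<delta>sum: "(\<Sum>g\<in>carrier G. f g * \<delta> g) = f \<one>\<^bsub>G\<^esub> * of_nat ?n" for f
    by (simp add: \<delta>_def G(2) if_distrib[of "\<lambda>x. _ * x"] cong: if_cong)
  have p1: "p \<one>\<^bsub>G\<^esub> = ?S" unfolding p_def using F(2) irr_char_one by (intro sum.cong refl) auto
  have pp: "(\<Sum>g\<in>carrier G. p g * cnj (p g)) = of_nat ?n * ?S"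
  proof -
    have "(\<Sum>g\<in>carrier G. p g * cnj (p g)) = (\<Sum>g\<in>carrier G. \<Sum>\<eta>\<in>F. \<Sum>\<zeta>\<in>F. ?d \<eta> * ?d \<zeta> * (irr_char \<eta> g
      * cnj (irr_char \<zeta> g)))"
      by (simp add: p_def sum_product mult_ac)
    also have "\<dots> = (\<Sum>\<eta>\<in>F. \<Sum>\<zeta>\<in>F. ?d \<eta> * ?d \<zeta> * (\<Sum>g\<in>carrier G. irr_char \<eta> g * cnj (irr_char \<zeta> g)))"
      unfolding sum_distrib_left by (subst sum.swap, intro sum.cong refl, rule sum.swap)
    also have "\<dots> = (\<Sum>\<eta>\<in>F. \<Sum>\<zeta>\<in>F. ?d \<eta> * ?d \<zeta> * (if \<zeta> = \<eta> then of_nat ?n else 0))"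
      using F(2) by (intro sum.cong refl arg_cong2[where f = "(*)"] irr_char_orthogonal[OF G]) auto
    also have "\<dots> = of_nat ?n * ?S"
      by (simp add: F(1) if_distrib[of "\<lambda>x. _ * x"] sum_distrib_left mult_ac cong: if_cong)
    finally show ?thesis .
  qed
  have "0 \<le> (\<Sum>g\<in>carrier G. (cmod (\<delta> g - p g))\<^sup>2)" by (intro sum_nonneg) simp
  moreover have eq1: "complex_of_real (\<Sum>g\<in>carrier G. (cmod (\<delta> g - p g))\<^sup>2)
    = of_nat ?n * (of_nat ?n - ?S)"
  proof -
    have c\<delta>: "cnj (\<delta> g) = \<delta> g" for g by (simp add: \<delta>_def)
    have "complex_of_real (\<Sum>g\<in>carrier G. (cmod (\<delta> g - p g))\<^sup>2)
      = (\<Sum>g\<in>carrier G. (\<delta> g - p g) * cnj (\<delta> g - p g))"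
      by (simp only: of_real_sum complex_norm_square)
    also have "\<dots> = (\<Sum>g\<in>carrier G. \<delta> g * \<delta> g) - (\<Sum>g\<in>carrier G. p g * \<delta> g)
      - (\<Sum>g\<in>carrier G. cnj (p g) * \<delta> g) + (\<Sum>g\<in>carrier G. p g * cnj (p g))"
      by (simp add: c\<delta> algebra_simps sum.distrib sum_subtractf)
    also have "\<dots> = of_nat ?n * (of_nat ?n - ?S)"
      unfolding pp \<delta>sum p1 by (simp add: \<delta>_def algebra_simps)
    finally show ?thesis .
  qed
  moreover have eq2: "of_nat ?n * (of_nat ?n - ?S)
    = complex_of_real (real ?n * (real ?n - (\<Sum>\<zeta>\<in>F. (real (irr_dim \<zeta>))\<^sup>2)))"
    by (simp add: power2_eq_square)
  moreover have "(\<Sum>g\<in>carrier G. (cmod (\<delta> g - p g))\<^sup>2)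
    = real ?n * (real ?n - (\<Sum>\<zeta>\<in>F. (real (irr_dim \<zeta>))\<^sup>2))"
    using eq1 unfolding eq2 by (simp only: of_real_eq_iff)
  ultimately have "0 \<le> real ?n * (real ?n - (\<Sum>\<zeta>\<in>F. (real (irr_dim \<zeta>))\<^sup>2))"
    by (simp only:)
  then show ?thesis using n by (simp add: zero_le_mult_iff)
qed

lemma finite_irr_classes:
  assumes G: "group G" "finite (carrier G)"
  shows "finite (irr_classes G)"
proof (rule ccontr)
  assume "infinite (irr_classes G)"
  then obtain F where F: "F \<subseteq> irr_classes G" "finite F" "card F = Suc (card (carrier G))"
    using infinite_arbitrarily_large by metis
  have "real (card F) = (\<Sum>\<zeta>\<in>F. 1)" by simp
  also have "\<dots> \<le> (\<Sum>\<zeta>\<in>F. (real (irr_dim \<zeta>))\<^sup>2)"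
  proof (rule sum_mono)
    fix \<zeta> assume "\<zeta> \<in> F"
    then have "irr_dim \<zeta> \<ge> 1" using F(1) irr_dim_pos[of \<zeta> G] by auto
    then show "1 \<le> (real (irr_dim \<zeta>))\<^sup>2" by (simp add: one_le_power)
  qed
  also have "\<dots> \<le> real (card (carrier G))" by (rule sum_irr_dim_square_le[OF G F(2,1)])
  finally show False using F(3) by simp
qed

lemma conj_class_self: "group G \<Longrightarrow> x \<in> carrier G \<Longrightarrow> x \<in> conj_class G x"
proof -
  assume G: "group G" and x: "x \<in> carrier G"
  interpret group G by (rule G)
  have "x = \<one>\<^bsub>G\<^esub> \<otimes>\<^bsub>G\<^esub> x \<otimes>\<^bsub>G\<^esub> inv\<^bsub>G\<^esub> \<one>\<^bsub>G\<^esub>" using x by simp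
  then show ?thesis unfolding conj_class_def by blast
qed

lemma conj_class_eq:
  assumes G: "group G" and x: "x \<in> carrier G" and y: "y \<in> conj_class G x"
  shows "conj_class G y = conj_class G x" "y \<in> carrier G"
proof -
  interpret group G by (rule G)
  obtain g where g: "g \<in> carrier G" "y = g \<otimes>\<^bsub>G\<^esub> x \<otimes>\<^bsub>G\<^esub> inv\<^bsub>G\<^esub> g" using y
    by (auto simp: conj_class_def)
  show yc: "y \<in> carrier G" using g x by simp
  have sub: "conj_class G b \<subseteq> conj_class G a" if a: "a \<in> carrier G" and h: "h \<in> carrier G"
    and b: "b = h \<otimes>\<^bsub>G\<^esub> a \<otimes>\<^bsub>G\<^esub> inv\<^bsub>G\<^esub> h" for a b h
  proof
    fix z assume "z \<in> conj_class G b"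
    then obtain k where k: "k \<in> carrier G" "z = k \<otimes>\<^bsub>G\<^esub> b \<otimes>\<^bsub>G\<^esub> inv\<^bsub>G\<^esub> k"
      by (auto simp: conj_class_def)
    have "z = (k \<otimes>\<^bsub>G\<^esub> h) \<otimes>\<^bsub>G\<^esub> a \<otimes>\<^bsub>G\<^esub> inv\<^bsub>G\<^esub> (k \<otimes>\<^bsub>G\<^esub> h)"
      unfolding k(2) b using a h k(1) by (simp add: inv_mult_group m_assoc)
    then show "z \<in> conj_class G a" using h k(1) unfolding conj_class_def by blast
  qed
  have cancel: "inv\<^bsub>G\<^esub> g \<otimes>\<^bsub>G\<^esub> (g \<otimes>\<^bsub>G\<^esub> z) = z" if "z \<in> carrier G" for z
    using that g(1) by (simp flip: m_assoc)
  have "x = inv\<^bsub>G\<^esub> g \<otimes>\<^bsub>G\<^esub> y \<otimes>\<^bsub>G\<^esub> inv\<^bsub>G\<^esub> (inv\<^bsub>G\<^esub> g)"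
    unfolding g(2) using g(1) x by (simp add: m_assoc cancel)
  then show "conj_class G y = conj_class G x"
    using sub[OF x g] sub[OF yc inv_closed[OF g(1)]] by blast
qed

text \<open>
  The last two parts make the representatives chosen by \<open>SOME\<close> usable.
\<close>

lemma conj_classes_partition:
  assumes G: "group G"
  shows "\<Union>(conj_classes G) = carrier G" "disjoint (conj_classes G)"
    "\<And>\<theta> x. \<theta> \<in> conj_classes G \<Longrightarrow> x \<in> \<theta> \<Longrightarrow> x \<in> carrier G \<and> \<theta> = conj_class G x"
    "\<And>\<theta>. \<theta> \<in> conj_classes G \<Longrightarrow> (SOME g. g \<in> \<theta>) \<in> \<theta>"
proof -
  show *: "x \<in> carrier G \<and> \<theta> = conj_class G x" if "\<theta> \<in> conj_classes G" "x \<in> \<theta>" for \<theta> x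
    using that conj_class_eq[OF G] unfolding conj_classes_def by blast
  show "\<Union>(conj_classes G) = carrier G"
    using * conj_class_self[OF G] unfolding conj_classes_def by blast
  show "disjoint (conj_classes G)"
    unfolding disjoint_def using * by blast
  show "(SOME g. g \<in> \<theta>) \<in> \<theta>" if "\<theta> \<in> conj_classes G" for \<theta>
    using that conj_class_self[OF G] unfolding conj_classes_def by (metis imageE someI_ex)
qed

lemma sum_over_conj_classes:
  assumes G: "group G" "finite (carrier G)"
    and f: "\<And>\<theta> x y. \<theta> \<in> conj_classes G \<Longrightarrow> x \<in> \<theta> \<Longrightarrow> y \<in> \<theta> \<Longrightarrow> f x = f y"
  shows "(\<Sum>\<theta>\<in>conj_classes G. of_nat (card \<theta>) * f (SOME g. g \<in> \<theta>)) = (\<Sum>g\<in>carrier G. f g :: complex)"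
proof -
  note C = conj_classes_partition[OF G(1)]
  have fin: "finite (conj_classes G)" using G(2) by (simp add: conj_classes_def)
  have "(\<Sum>g\<in>carrier G. f g) = (\<Sum>\<theta>\<in>conj_classes G. \<Sum>g\<in>\<theta>. f g)"
    unfolding C(1)[symmetric]
  proof (subst sum.Union_disjoint)
    show "\<forall>A\<in>conj_classes G. finite A" using C(1) G(2) by (metis Union_upper finite_subset)
    show "\<forall>A\<in>conj_classes G. \<forall>B\<in>conj_classes G. A \<noteq> B \<longrightarrow> A \<inter> B = {}" using C(2)
      by (auto simp: disjoint_def)
  qed simp
  also have "\<dots> = (\<Sum>\<theta>\<in>conj_classes G. of_nat (card \<theta>) * f (SOME g. g \<in> \<theta>))"
  proof (rule sum.cong[OF refl])
    fix \<theta> assume \<theta>: "\<theta> \<in> conj_classes G"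
    have "(\<Sum>g\<in>\<theta>. f g) = (\<Sum>g\<in>\<theta>. f (SOME g. g \<in> \<theta>))"
      by (rule sum.cong[OF refl]) (rule f[OF \<theta> _ C(4)[OF \<theta>]])
    then show "(\<Sum>g\<in>\<theta>. f g) = of_nat (card \<theta>) * f (SOME g. g \<in> \<theta>)" by simp
  qed
  finally show ?thesis ..
qed

lemma irr_char_class_const:
  assumes "group G" "\<zeta> \<in> irr_classes G" "\<theta> \<in> conj_classes G" "x \<in> \<theta>"
  shows "irr_char \<zeta> x = irr_char_class \<zeta> \<theta>"
proof -
  note C = conj_classes_partition[OF assms(1)]
  have *: "irr_char \<zeta> y = irr_char \<zeta> x" if "y \<in> \<theta>" for y
  proof -
    have "y \<in> conj_class G x" using C(3)[OF assms(3,4)] that by simp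
    then obtain g where "g \<in> carrier G" "y = g \<otimes>\<^bsub>G\<^esub> x \<otimes>\<^bsub>G\<^esub> inv\<^bsub>G\<^esub> g" by (auto simp: conj_class_def)
    then show ?thesis using irr_char_conj[OF assms(1,2), of g x] C(3)[OF assms(3,4)] by simp
  qed
  show ?thesis unfolding irr_char_class_def by (rule *[symmetric]) (rule C(4)[OF assms(3)])
qed

lemma irr_char_class_orthogonal:
  assumes G: "group G" "finite (carrier G)" and "\<zeta> \<in> irr_classes G" "\<eta> \<in> irr_classes G"
  shows "(\<Sum>\<theta>\<in>conj_classes G. of_nat (card \<theta>) * (irr_char_class \<eta> \<theta> * cnj (irr_char_class \<zeta> \<theta>))) =
     (if \<zeta> = \<eta> then of_nat (card (carrier G)) else 0)"
proof -
  have "(\<Sum>\<theta>\<in>conj_classes G. of_nat (card \<theta>) * (irr_char \<eta> (SOME g. g \<in> \<theta>)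
    * cnj (irr_char \<zeta> (SOME g. g \<in> \<theta>)))) =
     (\<Sum>g\<in>carrier G. irr_char \<eta> g * cnj (irr_char \<zeta> g))"
    by (rule sum_over_conj_classes[OF G]) (use irr_char_class_const[OF G(1)] assms(3,4) in simp)
  then show ?thesis using irr_char_orthogonal[OF G assms(3,4)] by (simp add: irr_char_class_def)
qed

section \<open>Dimensions of Specht modules\<close>

lemma sum_fun_eval: "(\<Sum>a\<in>A. f a) x = (\<Sum>a\<in>A. f a x :: 'c :: comm_monoid_add)"
  by (induction A rule: infinite_finite_induct) auto

text \<open>
  The trace of the identity is the number of elements of a basis, which is finite and
  nonempty.
\<close>

lemma trace_on_identity:
  assumes V: "V = cfun.span S" and F: "finite F" "V \<subseteq> cfun.span F" and f: "f \<in> V" "f \<noteq> (\<lambda>_. 0)"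
  shows "\<exists>n. n > 0 \<and> trace_on V (\<lambda>f. f) = of_nat n"
proof -
  define B where "B = (SOME B. cfun.independent B \<and> cfun.span B = V)"
  have "\<exists>B. cfun.independent B \<and> cfun.span B = V"
    using cfun.maximal_independent_subset[of V] V
    by (metis cfun.span_mono cfun.span_span subset_antisym)
  then have B: "cfun.independent B" "cfun.span B = V" unfolding B_def
    by (metis (mono_tags, lifting) someI_ex)+
  have "B \<subseteq> cfun.span F" using cfun.span_superset[of B] B(2) F(2) by blast
  then have fin: "finite B" using cfun.independent_span_bound[OF F(1) B(1)] by blast
  have "B \<noteq> {}"
  proof
    assume "B = {}"
    then have "V = {0}" using B(2) by simp
    then show False using f by (simp add: zero_fun_def)
  qed
  then have "card B > 0" using fin by (simp add: card_gt_0_iff)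
  moreover have "trace_on V (\<lambda>f. f) = (\<Sum>b\<in>B. cfun.representation B b b)"
    unfolding trace_on_def B_def[symmetric] Let_def ..
  moreover have "(\<Sum>b\<in>B. cfun.representation B b b) = (\<Sum>b\<in>B. 1)"
    by (intro sum.cong refl) (simp add: cfun.representation_basis[OF B(1)])
  ultimately show ?thesis by auto
qed

lemma card_boxes: "finite (boxes \<nu>)" "card (boxes \<nu>) = sum_list \<nu>"
proof -
  have b: "boxes \<nu> = (SIGMA i:{..<length \<nu>}. {..<\<nu> ! i})" by (auto simp: boxes_def)
  show "finite (boxes \<nu>)" unfolding b by auto
  show "card (boxes \<nu>) = sum_list \<nu>" unfolding b by (simp add: sum_list_sum_nth atLeast0LessThan)
qed

text \<open>
  The dimension of a Specht module cancels in the normalized characters once it is known to be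
  finite and nonzero. It is finite since all tabloids map \<open>B\<close> to rows, and nonzero since a
  polytabloid has coefficient \<open>1\<close> at its own tabloid: a column permutation preserving the rows
  is trivial.
\<close>

lemma specht_char_id:
  assumes B: "finite B" "card B = sum_list \<nu>"
  shows "\<exists>n. n > 0 \<and> specht_char \<nu> B id = of_nat n"
proof -
  \<comment> \<open>the indicator functions of maps to rows, a finite spanning set for all tabloid functions\<close>
  let ?F = "(\<lambda>w w'. if w' = w then 1 else 0 :: complex) ` (B \<rightarrow>\<^sub>E {..<length \<nu>})"
  have tab: "tabloid \<nu> B (\<pi> \<circ> t) \<in> B \<rightarrow>\<^sub>E {..<length \<nu>}" if t: "t \<in> tableaux \<nu> B"
    and \<pi>: "\<pi> permutes B" for t \<pi>
  proof -
    have bij: "bij_betw (\<pi> \<circ> t) (boxes \<nu>) B"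
      using t permutes_imp_bij[OF \<pi>] by (auto simp: tableaux_def intro: bij_betw_trans)
    have "inv_into (boxes \<nu>) (\<pi> \<circ> t) b \<in> boxes \<nu>" if "b \<in> B" for b
      using that bij by (metis bij_betw_imp_surj_on inv_into_into)
    then show ?thesis unfolding tabloid_def by (fastforce simp: boxes_def)
  qed
  have fin_cs: "finite (column_stabilizer \<nu> B t)" for t
    unfolding column_stabilizer_def by (rule finite_subset[OF _ finite_permutations[OF B(1)]]) auto
  have sub: "polytabloid \<nu> B ` tableaux \<nu> B \<subseteq> cfun.span ?F"
  proof
    fix f assume "f \<in> polytabloid \<nu> B ` tableaux \<nu> B"
    then obtain t where t: "t \<in> tableaux \<nu> B" "f = polytabloid \<nu> B t" by blast
    have "f = (\<Sum>\<pi>\<in>column_stabilizer \<nu> B t. (\<lambda>w. of_int (sign \<pi>) * (if w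
      = tabloid \<nu> B (\<pi> \<circ> t) then 1 else 0)))"
      unfolding t(2) polytabloid_def by (auto simp: fun_eq_iff sum_fun_eval)
    also have "\<dots> \<in> cfun.span ?F"
      by (intro cfun.span_sum cfun.span_scale cfun.span_base)
        (use tab[OF t(1)] in \<open>auto simp: column_stabilizer_def\<close>)
    finally show "f \<in> cfun.span ?F" .
  qed
  have "card (boxes \<nu>) = card B" using B card_boxes by simp
  then obtain t where t: "bij_betw t (boxes \<nu>) B"
    using finite_same_card_bij[OF card_boxes(1) B(1)] by blast
  have "polytabloid \<nu> B t (tabloid \<nu> B t) = 1"
  proof -
    have id: "\<pi> = id" if \<pi>: "\<pi> \<in> column_stabilizer \<nu> B t"
      and eq: "tabloid \<nu> B t = tabloid \<nu> B (\<pi> \<circ> t)" for \<pi>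
    proof -
      have p: "\<pi> permutes B" and col: "\<And>b. b \<in> B \<Longrightarrow> snd (inv_into (boxes \<nu>) t (\<pi> b))
        = snd (inv_into (boxes \<nu>) t b)"
        using \<pi> by (auto simp: column_stabilizer_def)
      let ?r = "inv_into (boxes \<nu>) t"
      have fixp: "\<pi> b = b" if b: "b \<in> B" for b
      proof -
        have pb: "\<pi> b \<in> B" using p b by (simp add: permutes_in_image)
        have bij: "bij_betw (\<pi> \<circ> t) (boxes \<nu>) B" using t permutes_imp_bij[OF p]
          by (rule bij_betw_trans)
        have rb: "?r b \<in> boxes \<nu>" "t (?r b) = b" using t b
          by (auto simp: bij_betw_def inv_into_into f_inv_into_f)
        have "inv_into (boxes \<nu>) (\<pi> \<circ> t) (\<pi> b) = ?r b"
          by (rule inv_into_f_eq) (use bij rb in \<open>auto simp: bij_betw_def\<close>)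
        then have "fst (?r (\<pi> b)) = fst (?r b)" using fun_cong[OF eq, of "\<pi> b"] pb
          by (simp add: tabloid_def)
        then have "?r (\<pi> b) = ?r b" using col[OF b] by (simp add: prod_eq_iff)
        then have "t (?r (\<pi> b)) = t (?r b)" by simp
        then show ?thesis using t b pb by (simp add: bij_betw_def f_inv_into_f)
      qed
      show ?thesis
      proof
        fix b show "\<pi> b = id b" by (cases "b \<in> B") (use fixp p in \<open>auto simp: permutes_def\<close>)
      qed
    qed
    have idm: "id \<in> column_stabilizer \<nu> B t" by (simp add: column_stabilizer_def permutes_id)
    have "polytabloid \<nu> B t (tabloid \<nu> B t) = (\<Sum>\<pi>\<in>{id}. of_int (sign \<pi>) * (if tabloid \<nu> B t
      = tabloid \<nu> B (\<pi> \<circ> t) then 1 else 0))"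
      unfolding polytabloid_def by (rule sum.mono_neutral_right) (use fin_cs id idm in auto)
    then show ?thesis by (simp add: sign_id)
  qed
  then have nz: "polytabloid \<nu> B t \<noteq> (\<lambda>_. 0)" by (metis zero_neq_one)
  have "\<exists>n. n > 0 \<and> trace_on (specht_module \<nu> B) (\<lambda>f. f) = of_nat n"
  proof (rule trace_on_identity)
    show "specht_module \<nu> B = cfun.span (polytabloid \<nu> B ` tableaux \<nu> B)"
      by (rule specht_module_def)
    show "finite ?F" using B(1) by (intro finite_imageI finite_PiE) auto
    show "specht_module \<nu> B \<subseteq> cfun.span ?F" unfolding specht_module_def
      by (rule cfun.span_minimal[OF sub cfun.subspace_span])
    show "polytabloid \<nu> B t \<in> specht_module \<nu> B" unfolding specht_module_def
      by (intro cfun.span_base imageI) (simp add: tableaux_def t)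
  qed (rule nz)
  then show ?thesis by (simp add: specht_char_def)
qed

section \<open>Characters of wreath products on the base group\<close>

lemma wreath_carrier: "carrier (wreath T n) = ({..<n} \<rightarrow>\<^sub>E carrier T) \<times> {\<sigma>. \<sigma> permutes {..<n}}"
  by (simp add: wreath_def)

lemma wreath_mult:
  "(s, \<sigma>) \<otimes>\<^bsub>wreath T n\<^esub> (t, \<tau>) = (\<lambda>i\<in>{..<n}. s i \<otimes>\<^bsub>T\<^esub> t (inv_into UNIV \<sigma> i), \<sigma> \<circ> \<tau>)"
  by (simp add: wreath_def)

lemma wreath_one: "\<one>\<^bsub>wreath T n\<^esub> = (\<lambda>i\<in>{..<n}. \<one>\<^bsub>T\<^esub>, id)"
  by (simp add: wreath_def)

lemma permutes_inv_lessThan: "\<sigma> permutes {..<n} \<Longrightarrow> i < n \<Longrightarrow> inv_into UNIV \<sigma> i < n"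
  using permutes_in_image[OF permutes_inv, of \<sigma> "{..<n}" i] by simp

lemma permutes_lessThan: "\<sigma> permutes {..<n} \<Longrightarrow> i < n \<Longrightarrow> \<sigma> i < n"
  using permutes_in_image[of \<sigma> "{..<n}" i] by simp

lemma group_wreath:
  assumes "group T" shows "group (wreath T n)"
proof -
  interpret T: group T by (rule assms)
  show ?thesis
  proof (rule groupI)
    fix x y assume x: "x \<in> carrier (wreath T n)" and y: "y \<in> carrier (wreath T n)"
    obtain s \<sigma> t \<tau> where e: "x = (s, \<sigma>)" "y = (t, \<tau>)" by (metis prod.exhaust)
    have p: "\<sigma> permutes {..<n}" "\<tau> permutes {..<n}" using x y by (simp_all add: e wreath_carrier)
    have c: "\<And>i. i < n \<Longrightarrow> s i \<in> carrier T" "\<And>i. i < n \<Longrightarrow> t i \<in> carrier T"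
      using x y by (auto simp: e wreath_carrier)
    have "(\<lambda>i\<in>{..<n}. s i \<otimes>\<^bsub>T\<^esub> t (inv_into UNIV \<sigma> i)) \<in> {..<n} \<rightarrow>\<^sub>E carrier T"
      using c permutes_inv_lessThan[OF p(1)] by simp
    then show "x \<otimes>\<^bsub>wreath T n\<^esub> y \<in> carrier (wreath T n)"
      unfolding e wreath_mult wreath_carrier using permutes_compose[OF p(2,1)] by blast
  next
    show "\<one>\<^bsub>wreath T n\<^esub> \<in> carrier (wreath T n)"
      by (auto simp: wreath_carrier wreath_one permutes_id)
  next
    fix x y z assume x: "x \<in> carrier (wreath T n)" and y: "y \<in> carrier (wreath T n)"
      and z: "z \<in> carrier (wreath T n)"
    obtain s \<sigma> t \<tau> u \<upsilon> where e: "x = (s, \<sigma>)" "y = (t, \<tau>)" "z = (u, \<upsilon>)" by (metis prod.exhaust)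
    have p: "\<sigma> permutes {..<n}" "\<tau> permutes {..<n}" using x y by (auto simp: e wreath_carrier)
    have c: "\<And>i. i < n \<Longrightarrow> s i \<in> carrier T" "\<And>i. i < n \<Longrightarrow> t i \<in> carrier T"
      "\<And>i. i < n \<Longrightarrow> u i \<in> carrier T"
      using x y z by (auto simp: e wreath_carrier)
    have i: "inv_into UNIV (\<sigma> \<circ> \<tau>) = inv_into UNIV \<tau> \<circ> inv_into UNIV \<sigma>"
      by (rule o_inv_distrib) (use p permutes_bij in auto)
    show "x \<otimes>\<^bsub>wreath T n\<^esub> y \<otimes>\<^bsub>wreath T n\<^esub> z = x \<otimes>\<^bsub>wreath T n\<^esub> (y \<otimes>\<^bsub>wreath T n\<^esub> z)"
      unfolding e wreath_mult i
      by (auto simp: fun_eq_iff comp_assoc permutes_inv_lessThan[OF p(1)] permutes_inv_lessThan[OF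
        p(2)] c T.m_assoc)
  next
    fix x assume x: "x \<in> carrier (wreath T n)"
    obtain s \<sigma> where e: "x = (s, \<sigma>)" by (metis prod.exhaust)
    have p: "\<sigma> permutes {..<n}" and s: "s \<in> {..<n} \<rightarrow>\<^sub>E carrier T" using x
      by (auto simp: e wreath_carrier)
    have c: "\<And>i. i < n \<Longrightarrow> s i \<in> carrier T" using s by auto
    show "\<one>\<^bsub>wreath T n\<^esub> \<otimes>\<^bsub>wreath T n\<^esub> x = x"
      using s unfolding e wreath_mult wreath_one
        by (auto simp: fun_eq_iff c PiE_def extensional_def)
    let ?y = "(\<lambda>i\<in>{..<n}. inv\<^bsub>T\<^esub> (s (\<sigma> i)), inv_into UNIV \<sigma>)"
    have "?y \<in> carrier (wreath T n)"
      using c permutes_lessThan[OF p] by (auto simp: wreath_carrier permutes_inv[OF p])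
    moreover have "?y \<otimes>\<^bsub>wreath T n\<^esub> x = \<one>\<^bsub>wreath T n\<^esub>"
      unfolding e wreath_mult wreath_one
      by (auto simp: fun_eq_iff permutes_inv_inv[OF p] permutes_inv_o[OF p] c permutes_lessThan[OF
        p])
    ultimately show "\<exists>y\<in>carrier (wreath T n). y \<otimes>\<^bsub>wreath T n\<^esub> x = \<one>\<^bsub>wreath T n\<^esub>" by blast
  qed
qed

text \<open>
  The right-hand side is the solution \<open>y\<close> of \<open>g y = x g\<close>.
\<close>

lemma wreath_conj_base:
  assumes T: "group T" and g: "(s, \<tau>) \<in> carrier (wreath T n)" and t: "t \<in> {..<n} \<rightarrow>\<^sub>E carrier T"
  shows "inv\<^bsub>wreath T n\<^esub> (s, \<tau>) \<otimes>\<^bsub>wreath T n\<^esub> (t, id) \<otimes>\<^bsub>wreath T n\<^esub> (s, \<tau>) =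
     (\<lambda>i\<in>{..<n}. inv\<^bsub>T\<^esub> (s (\<tau> i)) \<otimes>\<^bsub>T\<^esub> t (\<tau> i) \<otimes>\<^bsub>T\<^esub> s (\<tau> i), id)"
proof -
  interpret T: group T by (rule T)
  interpret W: group "wreath T n" by (rule group_wreath[OF T])
  let ?y = "(\<lambda>i\<in>{..<n}. inv\<^bsub>T\<^esub> (s (\<tau> i)) \<otimes>\<^bsub>T\<^esub> t (\<tau> i) \<otimes>\<^bsub>T\<^esub> s (\<tau> i), id)"
  have p: "\<tau> permutes {..<n}" and c: "\<And>i. i < n \<Longrightarrow> s i \<in> carrier T" "\<And>i. i < n \<Longrightarrow> t i \<in> carrier T"
    using g t by (auto simp: wreath_carrier)
  have y: "?y \<in> carrier (wreath T n)"
    using c permutes_lessThan[OF p] by (auto simp: wreath_carrier permutes_id)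
  have x: "(t, id) \<in> carrier (wreath T n)" using t by (simp add: wreath_carrier permutes_id)
  have cancel: "a \<otimes>\<^bsub>T\<^esub> (inv\<^bsub>T\<^esub> a \<otimes>\<^bsub>T\<^esub> b \<otimes>\<^bsub>T\<^esub> a) = b \<otimes>\<^bsub>T\<^esub> a" if "a \<in> carrier T" "b \<in> carrier T"
    for a b
    using that by (simp flip: T.m_assoc)
  have "(s, \<tau>) \<otimes>\<^bsub>wreath T n\<^esub> ?y = (t, id) \<otimes>\<^bsub>wreath T n\<^esub> (s, \<tau>)"
    unfolding wreath_mult
    by (auto simp: fun_eq_iff permutes_inv_lessThan[OF p] permutes_inverses[OF p] c cancel
      inv_id[unfolded id_def] id_def)
  then have "inv\<^bsub>wreath T n\<^esub> (s, \<tau>) \<otimes>\<^bsub>wreath T n\<^esub> ((t, id) \<otimes>\<^bsub>wreath T n\<^esub> (s, \<tau>)) =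
      inv\<^bsub>wreath T n\<^esub> (s, \<tau>) \<otimes>\<^bsub>wreath T n\<^esub> ((s, \<tau>) \<otimes>\<^bsub>wreath T n\<^esub> ?y)" by (simp only:)
  also have "\<dots> = (inv\<^bsub>wreath T n\<^esub> (s, \<tau>) \<otimes>\<^bsub>wreath T n\<^esub> (s, \<tau>)) \<otimes>\<^bsub>wreath T n\<^esub> ?y"
    by (rule W.m_assoc[symmetric, OF W.inv_closed[OF g] g y])
  also have "\<dots> = ?y" using W.l_inv[OF g] W.l_one[OF y] by (simp only:)
  finally show ?thesis using W.m_assoc[OF W.inv_closed[OF g] x g] by (simp only:)
qed

lemma tensor_char_base:
  "tensor_char n b (t, id) = (\<Prod>i<n. irr_char (b i) (t i))"
proof -
  have "(\<Prod>i<n. irr_char (b i) (t i)) = (\<Prod>i<n. \<Sum>k<irr_dim (b i). irr_rep (b i) (t i) $$ (k, k))"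
    by (simp add: irr_char_def)
  also have "\<dots> = (\<Sum>j\<in>(\<Pi>\<^sub>E i\<in>{..<n}. {..<irr_dim (b i)}). \<Prod>i<n. irr_rep (b i) (t i) $$ (j i, j i))"
    by (rule prod_sum_PiE) auto
  finally show ?thesis by (simp add: tensor_char_def)
qed

lemma exists_block_assignment:
  assumes "finite I" "(\<Sum>\<zeta>\<in>I. k \<zeta>) = n"
  shows "\<exists>b. b \<in> {..<n} \<rightarrow>\<^sub>E I \<and> (\<forall>\<zeta>\<in>I. card {i. i < n \<and> b i = \<zeta>} = (k \<zeta> :: nat))"
  using assms
proof (induction I arbitrary: n rule: finite_induct)
  case empty
  then show ?case by (intro exI[of _ "\<lambda>_. undefined"]) auto
next
  case (insert \<eta> I)
  define m where "m = (\<Sum>\<zeta>\<in>I. k \<zeta>)"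
  obtain b where b: "b \<in> {..<m} \<rightarrow>\<^sub>E I" "\<forall>\<zeta>\<in>I. card {i. i < m \<and> b i = \<zeta>} = k \<zeta>"
    using insert.IH[of m] by (auto simp: m_def)
  have n: "n = m + k \<eta>" using insert by (simp add: m_def)
  define b' where "b' i = (if i < m then b i else if i < n then \<eta> else undefined)" for i
  have bI: "b i \<in> I" if "i < m" for i using b(1) that by auto
  have "b' \<in> {..<n} \<rightarrow>\<^sub>E insert \<eta> I" using bI by (auto simp: b'_def n PiE_def extensional_def)
  moreover have "card {i. i < n \<and> b' i = \<zeta>} = k \<zeta>" if "\<zeta> \<in> insert \<eta> I" for \<zeta>
  proof (cases "\<zeta> = \<eta>")
    case True
    have "{i. i < n \<and> b' i = \<zeta>} = {m..<n}" using bI insert.hyps(2) True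
      by (auto simp: b'_def n) (metis not_less)
    then show ?thesis using n True by simp
  next
    case False
    then have "{i. i < n \<and> b' i = \<zeta>} = {i. i < m \<and> b i = \<zeta>}" by (auto simp: b'_def n)
    then show ?thesis using b(2) that False by simp
  qed
  ultimately show ?case by blast
qed

text \<open>
  The sum does not depend on \<open>p\<close>, by composing with a transposition, so it may be averaged
  over \<open>p\<close>.
\<close>

lemma sum_permutations_inv:
  assumes p: "p < n"
  shows "of_nat n * (\<Sum>\<tau> | \<tau> permutes {..<n}. f (inv_into UNIV \<tau> p))
    = of_nat (fact n) * (\<Sum>i<n. f i :: complex)"
proof -
  let ?P = "{\<tau>. \<tau> permutes {..<n}}"
  have fin: "finite ?P" by (simp add: finite_permutations)
  have eq: "(\<Sum>\<tau>\<in>?P. f (inv_into UNIV \<tau> p)) = (\<Sum>\<tau>\<in>?P. f (inv_into UNIV \<tau> q))" if q: "q < n" for q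
  proof -
    \<comment> \<open>\<open>\<tau> \<mapsto> (p q) \<tau>\<close> exchanges the two sums\<close>
    let ?s = "Transposition.transpose p q"
    have s: "?s permutes {..<n}" by (rule permutes_swap_id) (use p q in auto)
    have ss: "?s \<circ> ?s = id" by (simp add: fun_eq_iff)
    show ?thesis
    proof (rule sum.reindex_bij_witness[of _ "\<lambda>\<tau>. ?s \<circ> \<tau>" "\<lambda>\<tau>. ?s \<circ> \<tau>"])
      fix \<tau> assume \<tau>: "\<tau> \<in> ?P"
      show "?s \<circ> (?s \<circ> \<tau>) = \<tau>" by (simp add: comp_assoc[symmetric] ss)
      then show "?s \<circ> (?s \<circ> \<tau>) = \<tau>" .
      show "?s \<circ> \<tau> \<in> ?P" using \<tau> s by (simp add: permutes_compose)
      then show "?s \<circ> \<tau> \<in> ?P" .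
      have "inv_into UNIV (?s \<circ> \<tau>) = inv_into UNIV \<tau> \<circ> inv_into UNIV ?s"
        by (rule o_inv_distrib) (use \<tau> s permutes_bij in auto)
      then show "f (inv_into UNIV (?s \<circ> \<tau>) q) = f (inv_into UNIV \<tau> p)" by simp
    qed
  qed
  have "of_nat n * (\<Sum>\<tau>\<in>?P. f (inv_into UNIV \<tau> p)) = (\<Sum>q<n. \<Sum>\<tau>\<in>?P. f (inv_into UNIV \<tau> p))" by simp
  also have "\<dots> = (\<Sum>q<n. \<Sum>\<tau>\<in>?P. f (inv_into UNIV \<tau> q))" by (intro sum.cong refl eq) auto
  also have "\<dots> = (\<Sum>\<tau>\<in>?P. \<Sum>q<n. f (inv_into UNIV \<tau> q))" by (rule sum.swap)
  also have "\<dots> = (\<Sum>\<tau>\<in>?P. \<Sum>i<n. f i)"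
  proof (rule sum.cong[OF refl])
    fix \<tau> assume "\<tau> \<in> ?P"
    then have "bij_betw (inv_into UNIV \<tau>) {..<n} {..<n}" using permutes_imp_bij permutes_inv
      by blast
    then show "(\<Sum>q<n. f (inv_into UNIV \<tau> q)) = (\<Sum>i<n. f i)" by (rule sum.reindex_bij_betw)
  qed
  finally show ?thesis by (simp add: card_permutations)
qed

text \<open>
  Conjugates of base elements are base elements, which fix all blocks, so the case distinction
  in the induced character disappears. The constant \<open>K\<close> collects the Specht dimensions and the
  orders of the groups; its value cancels later.
\<close>

lemma wreath_char_base:
  assumes T: "group T" "finite (carrier T)" and \<Lambda>: "\<Lambda> \<in> young_families (irr_classes T) n"
  obtains b K where "\<And>i. i < n \<Longrightarrow> b i \<in> irr_classes T"
    "\<And>\<zeta>. \<zeta> \<in> irr_classes T \<Longrightarrow> card {i. i < n \<and> b i = \<zeta>} = sum_list (\<Lambda> \<zeta>)" "K \<noteq> 0"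
    "\<And>t. t \<in> {..<n} \<rightarrow>\<^sub>E carrier T \<Longrightarrow>
       wreath_char T n \<Lambda> (t, id) = K * (\<Sum>\<tau> | \<tau> permutes {..<n}. \<Prod>i<n. irr_char (b i) (t (\<tau> i)))"
proof -
  interpret T: group T by (rule T(1))
  let ?I = "irr_classes T" and ?W = "wreath T n" and ?E = "{..<n} \<rightarrow>\<^sub>E carrier T" and ?P
    = "{\<tau>. \<tau> permutes {..<n}}"
  define b where "b = block_assignment T n \<Lambda>"
  have finI: "finite ?I" by (rule finite_irr_classes[OF T])
  have "(\<Sum>\<zeta>\<in>?I. sum_list (\<Lambda> \<zeta>)) = n" using \<Lambda> by (auto simp: young_families_def)
  from someI_ex[OF exists_block_assignment[OF finI this]]
  have b: "b \<in> {..<n} \<rightarrow>\<^sub>E ?I" "\<And>\<zeta>. \<zeta> \<in> ?I \<Longrightarrow> card {i. i < n \<and> b i = \<zeta>} = sum_list (\<Lambda> \<zeta>)"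
    unfolding b_def block_assignment_def by blast+
  have bI: "b i \<in> ?I" if "i < n" for i using b(1) that by auto
  let ?S = "block_stabilizer T n b"
  define D where "D = (\<Prod>\<zeta>\<in>?I. specht_char (\<Lambda> \<zeta>) {i. i < n \<and> b i = \<zeta>} id)"
  have "specht_char (\<Lambda> \<zeta>) {i. i < n \<and> b i = \<zeta>} id \<noteq> 0" if "\<zeta> \<in> ?I" for \<zeta>
    using specht_char_id[of "{i. i < n \<and> b i = \<zeta>}" "\<Lambda> \<zeta>"] b(2)[OF that] by auto
  then have D: "D \<noteq> 0" unfolding D_def using finI by simp
  have finW: "finite (carrier ?W)" unfolding wreath_carrier
    by (intro finite_cartesian_product finite_PiE) (auto simp: T(2) finite_permutations)
  have mem: "(t, id) \<in> ?S" if "t \<in> ?E" for t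
    using that by (simp add: block_stabilizer_def wreath_carrier permutes_id)
  have finS: "finite ?S" by (rule finite_subset[OF _ finW]) (auto simp: block_stabilizer_def)
  have oneE: "(\<lambda>i\<in>{..<n}. \<one>\<^bsub>T\<^esub>) \<in> ?E" by auto
  have "finite ?E" by (intro finite_PiE) (auto simp: T(2))
  then have cE: "card ?E \<noteq> 0" using oneE by (metis card_0_eq empty_iff)
  have cS: "card ?S \<noteq> 0" using mem[OF oneE] finS by (metis card_0_eq empty_iff)
  have pr: "perm_restrict id B = id" for B :: "nat set" by (auto simp: perm_restrict_def fun_eq_iff)
  have blk: "block_char T n b \<Lambda> (t, id) = (\<Prod>i<n. irr_char (b i) (t i)) * D" for t
    by (simp add: block_char_def tensor_char_base D_def Let_def pr)
  define K where "K = D * of_nat (card ?E) / of_nat (card ?S)"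
  have K: "K \<noteq> 0" using D cS cE by (simp add: K_def)
  have main: "wreath_char T n \<Lambda> (t, id) = K * (\<Sum>\<tau>\<in>?P. \<Prod>i<n. irr_char (b i) (t (\<tau> i)))" if t:
    "t \<in> ?E" for t
  proof -
    have summand: "(if inv\<^bsub>?W\<^esub> g \<otimes>\<^bsub>?W\<^esub> (t, id) \<otimes>\<^bsub>?W\<^esub> g \<in> ?S
        then block_char T n b \<Lambda> (inv\<^bsub>?W\<^esub> g \<otimes>\<^bsub>?W\<^esub> (t, id) \<otimes>\<^bsub>?W\<^esub> g) else 0) =
        D * (\<Prod>i<n. irr_char (b i) (t (snd g i)))" if g: "g \<in> carrier ?W" for g
    proof -
      obtain s \<tau> where e: "g = (s, \<tau>)" by force
      have p: "\<tau> permutes {..<n}" and s: "\<And>i. i < n \<Longrightarrow> s i \<in> carrier T" using g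
        by (auto simp: e wreath_carrier)
      have tc: "\<And>i. i < n \<Longrightarrow> t i \<in> carrier T" using t by auto
      let ?t = "\<lambda>i\<in>{..<n}. inv\<^bsub>T\<^esub> (s (\<tau> i)) \<otimes>\<^bsub>T\<^esub> t (\<tau> i) \<otimes>\<^bsub>T\<^esub> s (\<tau> i)"
      have tE: "?t \<in> ?E" using s tc permutes_lessThan[OF p] by auto
      have "irr_char (b i) (?t i) = irr_char (b i) (t (\<tau> i))" if i: "i < n" for i
        using irr_char_conj[OF T(1) bI[OF i], of "inv\<^bsub>T\<^esub> (s (\<tau> i))"
          "t (\<tau> i)"] s tc permutes_lessThan[OF p i] i by simp
      then show ?thesis
        using mem[OF tE] blk[of ?t] unfolding e wreath_conj_base[OF T(1) g[unfolded e] t]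
          by (simp cong: prod.cong_simp)
    qed
    have "wreath_char T n \<Lambda> (t, id) = (\<Sum>g\<in>carrier ?W. D * (\<Prod>i<n. irr_char (b i) (t (snd g i))))
      / of_nat (card ?S)"
      unfolding wreath_char_def Let_def b_def[symmetric] induced_char_def
      by (intro arg_cong2[where f = "(/)"] sum.cong refl summand)
    also have "(\<Sum>g\<in>carrier ?W. D * (\<Prod>i<n. irr_char (b i) (t (snd g i)))) =
        (\<Sum>s\<in>?E. \<Sum>\<tau>\<in>?P. D * (\<Prod>i<n. irr_char (b i) (t (\<tau> i))))"
      unfolding wreath_carrier sum.cartesian_product by (simp only: split_def)
    also have "\<dots> / of_nat (card ?S) = K * (\<Sum>\<tau>\<in>?P. \<Prod>i<n. irr_char (b i) (t (\<tau> i)))"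
      by (simp add: K_def sum_distrib_left[symmetric])
    finally show ?thesis .
  qed
  show ?thesis by (rule that[of b K]) (use bI b(2) K main in auto)
qed

text \<open>
  Every permutation \<open>\<tau>\<close> contributes the product of the dimensions, with the one at position
  \<open>\<tau>\<^sup>-\<^sup>1 p\<close> replaced by the character value at \<open>h\<close>. Averaged over \<open>\<tau>\<close>, position \<open>\<tau>\<^sup>-\<^sup>1 p\<close> is
  uniform, and a fraction \<open>|\<lambda>\<^sup>\<zeta>| / n\<close> of the positions carries \<open>\<zeta>\<close>.
\<close>

lemma normalized_wreath_char_one_point:
  assumes T: "group T" "finite (carrier T)" and \<Lambda>: "\<Lambda> \<in> young_families (irr_classes T) n"
    and p: "p < n" and h: "h \<in> carrier T"
  shows "wreath_char T n \<Lambda> (\<lambda>i\<in>{..<n}. if i = p then h else \<one>\<^bsub>T\<^esub>, id) / wreath_dim T n \<Lambda> =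
     (\<Sum>\<zeta>\<in>irr_classes T. of_real (real (sum_list (\<Lambda> \<zeta>)) / real n) * (irr_char \<zeta> h
         / of_nat (irr_dim \<zeta>)))"
proof -
  interpret T: group T by (rule T(1))
  let ?I = "irr_classes T" and ?P = "{\<tau>. \<tau> permutes {..<n}}"
  obtain b K where bI: "\<And>i. i < n \<Longrightarrow> b i \<in> ?I"
    and bc: "\<And>\<zeta>. \<zeta> \<in> ?I \<Longrightarrow> card {i. i < n \<and> b i = \<zeta>} = sum_list (\<Lambda> \<zeta>)"
    and K: "K \<noteq> 0" and ch: "\<And>t. t \<in> {..<n} \<rightarrow>\<^sub>E carrier T \<Longrightarrow>
       wreath_char T n \<Lambda> (t, id) = K * (\<Sum>\<tau>\<in>?P. \<Prod>i<n. irr_char (b i) (t (\<tau> i)))"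
    using wreath_char_base[OF T \<Lambda>] by blast
  define d where "d i = complex_of_nat (irr_dim (b i))" for i
  have d0: "d i \<noteq> 0" if "i < n" for i using irr_dim_pos[OF bI[OF that]] by (simp add: d_def)
  have one: "irr_char (b i) \<one>\<^bsub>T\<^esub> = d i" if "i < n" for i using irr_char_one[OF bI[OF that]]
    by (simp add: d_def)
  let ?D = "\<Prod>i<n. d i"
  have D: "?D \<noteq> 0" using d0 by simp
  have dim: "wreath_dim T n \<Lambda> = K * (of_nat (fact n) * ?D)"
  proof -
    have "wreath_dim T n \<Lambda> = K * (\<Sum>\<tau>\<in>?P. \<Prod>i<n. irr_char (b i) ((\<lambda>i\<in>{..<n}. \<one>\<^bsub>T\<^esub>) (\<tau> i)))"
      unfolding wreath_dim_def wreath_one by (rule ch) auto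
    also have "(\<Sum>\<tau>\<in>?P. \<Prod>i<n. irr_char (b i) ((\<lambda>i\<in>{..<n}. \<one>\<^bsub>T\<^esub>) (\<tau> i))) = (\<Sum>\<tau>\<in>?P. ?D)"
      by (intro sum.cong prod.cong refl) (use one permutes_lessThan in auto)
    finally show ?thesis by (simp add: card_permutations)
  qed
  define \<phi> where "\<phi> i = irr_char (b i) h / d i" for i
  let ?t = "\<lambda>i\<in>{..<n}. if i = p then h else \<one>\<^bsub>T\<^esub>"
  have "wreath_char T n \<Lambda> (?t, id) = K * (\<Sum>\<tau>\<in>?P. \<Prod>i<n. irr_char (b i) (?t (\<tau> i)))"
    by (rule ch) (use h in auto)
  also have "(\<Sum>\<tau>\<in>?P. \<Prod>i<n. irr_char (b i) (?t (\<tau> i))) = (\<Sum>\<tau>\<in>?P. ?D * \<phi> (inv_into UNIV \<tau> p))"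
  proof (rule sum.cong[OF refl])
    fix \<tau> assume "\<tau> \<in> ?P"
    then have \<tau>: "\<tau> permutes {..<n}" by simp
    let ?q = "inv_into UNIV \<tau> p"
    have q: "?q < n" using permutes_inv_lessThan[OF \<tau> p] .
    have iff: "\<tau> i = p \<longleftrightarrow> i = ?q" for i using permutes_inverses[OF \<tau>] by metis
    have "(\<Prod>i<n. irr_char (b i) (?t (\<tau> i))) = (\<Prod>i<n. d i * (if i = ?q then \<phi> i else 1))"
    proof (intro prod.cong refl)
      fix i assume "i \<in> {..<n}"
      then show "irr_char (b i) (?t (\<tau> i)) = d i * (if i = ?q then \<phi> i else 1)"
        using permutes_lessThan[OF \<tau>, of i] iff[of i] d0[of i] one[of i] by (auto simp: \<phi>_def)
    qed
    also have "\<dots> = ?D * (\<Prod>i<n. if i = ?q then \<phi> i else 1)" by (rule prod.distrib)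
    also have "(\<Prod>i<n. if i = ?q then \<phi> i else 1) = \<phi> ?q" using q by simp
    finally show "(\<Prod>i<n. irr_char (b i) (?t (\<tau> i))) = ?D * \<phi> ?q" .
  qed
  also have "\<dots> = ?D * (\<Sum>\<tau>\<in>?P. \<phi> (inv_into UNIV \<tau> p))" by (simp only: sum_distrib_left)
  also have "(\<Sum>\<tau>\<in>?P. \<phi> (inv_into UNIV \<tau> p)) = of_nat (fact n) * (\<Sum>i<n. \<phi> i) / of_nat n"
    using sum_permutations_inv[OF p, of \<phi>] p by (simp add: field_simps)
  finally have num: "wreath_char T n \<Lambda> (?t, id)
    = K * (?D * (of_nat (fact n) * (\<Sum>i<n. \<phi> i) / of_nat n))" .
  have "wreath_char T n \<Lambda> (?t, id) / wreath_dim T n \<Lambda> = (\<Sum>i<n. \<phi> i) / of_nat n"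
    unfolding num dim using K D by simp
  also have "(\<Sum>i<n. \<phi> i) = (\<Sum>\<zeta>\<in>?I. \<Sum>i | i \<in> {..<n} \<and> b i = \<zeta>. \<phi> i)"
    by (rule sum.group[symmetric]) (use bI finite_irr_classes[OF T] in auto)
  also have "\<dots> = (\<Sum>\<zeta>\<in>?I. of_nat (sum_list (\<Lambda> \<zeta>)) * (irr_char \<zeta> h / of_nat (irr_dim \<zeta>)))"
  proof (rule sum.cong[OF refl])
    fix \<zeta> assume \<zeta>: "\<zeta> \<in> ?I"
    have "(\<Sum>i | i \<in> {..<n} \<and> b i = \<zeta>. \<phi> i) = (\<Sum>i | i \<in> {..<n} \<and> b i
      = \<zeta>. irr_char \<zeta> h / of_nat (irr_dim \<zeta>))"
      by (rule sum.cong) (auto simp: \<phi>_def d_def)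
    then show "(\<Sum>i | i \<in> {..<n} \<and> b i = \<zeta>. \<phi> i)
      = of_nat (sum_list (\<Lambda> \<zeta>)) * (irr_char \<zeta> h / of_nat (irr_dim \<zeta>))"
      using bc[OF \<zeta>] by simp
  qed
  also have "\<dots> / of_nat n = (\<Sum>\<zeta>\<in>?I. of_real (real (sum_list (\<Lambda> \<zeta>)) / real n) * (irr_char \<zeta> h
    / of_nat (irr_dim \<zeta>)))"
    by (simp add: sum_divide_distrib mult.commute)
  finally show ?thesis .
qed

section \<open>Mean proportions and the evolved laws\<close>

lemma wreath_type_base:
  assumes T: "group T" and t: "t \<in> {..<n} \<rightarrow>\<^sub>E carrier T"
  shows "wreath_type T n (t, id) = (\<lambda>\<theta>\<in>conj_classes T. replicate (card {i. i < n \<and> t i \<in> \<theta>}) 1)"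
proof -
  interpret group T by (rule T)
  have orb: "orbit id i = {i}" for i :: nat by (simp add: orbit_eq_singleton_iff)
  have cyc: "cycle_product T t id i = t i" if "i < n" for i
  proof -
    have "t i \<in> carrier T" using that t by auto
    then show ?thesis by (simp add: cycle_product_def orb)
  qed
  have "rev (sorted_list_of_multiset (image_mset card (mset_set {orbit id i | i. i < n \<and>
    cycle_product T t id i \<in> \<theta>}))) =
     replicate (card {i. i < n \<and> t i \<in> \<theta>}) 1" for \<theta>
  proof -
    let ?A = "{i. i < n \<and> t i \<in> \<theta>}"
    have S: "{orbit id i | i. i < n \<and> cycle_product T t id i \<in> \<theta>} = (\<lambda>i. {i}) ` ?A"
      using cyc by (auto simp: orb)
    have "image_mset card (mset_set ((\<lambda>i. {i}) ` ?A))
      = image_mset (\<lambda>_. 1) (mset_set ((\<lambda>i. {i}) ` ?A))"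
      by (rule image_mset_cong) auto
    also have "\<dots> = replicate_mset (card ?A) 1"
      by (simp add: image_mset_const_eq card_image)
    also have "\<dots> = mset (replicate (card ?A) 1)" by simp
    finally have "sorted_list_of_multiset (image_mset card (mset_set ((\<lambda>i. {i}) ` ?A)))
      = sort (replicate (card ?A) 1)"
      by (simp only: sorted_list_of_multiset_mset)
    also have "\<dots> = replicate (card ?A) 1" by (rule sort_key_id_if_sorted) simp
    finally show ?thesis unfolding S by simp
  qed
  then show ?thesis by (simp add: wreath_type_def)
qed

text \<open>
  Every cycle product lies in some conjugacy class, so every cycle length is recorded in the
  type.
\<close>

lemma wreath_type_ones_imp_base:
  assumes T: "group T" and x: "(t, \<sigma>) \<in> carrier (wreath T n)"
    and ones: "\<And>\<theta>. \<theta> \<in> conj_classes T \<Longrightarrow> set (wreath_type T n (t, \<sigma>) \<theta>) \<subseteq> {1}"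
  shows "\<sigma> = id"
proof -
  interpret group T by (rule T)
  have p: "\<sigma> permutes {..<n}" and t: "\<And>i. i < n \<Longrightarrow> t i \<in> carrier T" using x
    by (auto simp: wreath_carrier)
  have fixp: "\<sigma> i = i" if i: "i < n" for i
  proof -
    have it: "(inv_into UNIV \<sigma> ^^ k) i < n" for k
      by (induction k) (use i permutes_inv_lessThan[OF p] in auto)
    have "foldr (\<lambda>k y. t ((inv_into UNIV \<sigma> ^^ k) i) \<otimes>\<^bsub>T\<^esub> y) ks \<one>\<^bsub>T\<^esub> \<in> carrier T" for ks
      by (induction ks) (use t it in auto)
    then have "cycle_product T t \<sigma> i \<in> carrier T" by (simp add: cycle_product_def)
    then obtain \<theta> where \<theta>: "\<theta> \<in> conj_classes T" "cycle_product T t \<sigma> i \<in> \<theta>"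
      using conj_classes_partition(1)[OF T] by blast
    let ?S = "{orbit \<sigma> i | i. i < n \<and> cycle_product T t \<sigma> i \<in> \<theta>}"
    have "finite ?S" by simp
    moreover have "orbit \<sigma> i \<in> ?S" using i \<theta> by blast
    ultimately have "card (orbit \<sigma> i) \<in> set (wreath_type T n (t, \<sigma>) \<theta>)"
      using \<theta>(1) by (auto simp: wreath_type_def)
    then have "card (orbit \<sigma> i) = 1" using ones[OF \<theta>(1)] by auto
    moreover have "i \<in> orbit \<sigma> i"
      by (rule permutation_self_in_orbit) (use p in \<open>auto simp: permutation_permutes\<close>)
    ultimately have "orbit \<sigma> i = {i}" by (metis card_1_singletonE singletonD)
    then show ?thesis by (simp add: orbit_eq_singleton_iff)
  qed
  show ?thesis
  proof
    fix i show "\<sigma> i = id i" by (cases "i < n") (use fixp p in \<open>auto simp: permutes_def\<close>)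
  qed
qed

lemma conj_class_one: "group T \<Longrightarrow> conj_class T \<one>\<^bsub>T\<^esub> = {\<one>\<^bsub>T\<^esub>}"
proof -
  assume "group T"
  then interpret group T .
  show ?thesis by (auto simp: conj_class_def intro!: exI[of _ "\<one>\<^bsub>T\<^esub>"])
qed

definition one_point :: "('a, 'b) monoid_scheme \<Rightarrow> nat \<Rightarrow> nat \<Rightarrow> 'a \<Rightarrow> (nat \<Rightarrow> 'a) \<times> (nat \<Rightarrow> nat)" where
  "one_point T n p h = (\<lambda>i\<in>{..<n}. if i = p then h else \<one>\<^bsub>T\<^esub>, id)"

text \<open>
  All rows of this type have length \<open>1\<close>, so its elements lie in the base group. Counting
  coordinates by conjugacy class then leaves one coordinate in \<open>\<theta>\<close> and \<open>n - 1\<close> identities (if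
  \<open>\<theta>\<close> is the class of the identity, \<open>n\<close> identities). The position and the representative
  depend on the choice made by \<open>class_value\<close>.
\<close>

lemma class_value_one_row:
  assumes T: "group T" and n: "n \<ge> 1" and \<theta>: "\<theta> \<in> conj_classes T"
  obtains p h where "p < n" "h \<in> \<theta>" "class_value T n f (iota T n 1 (one_row T 1 \<theta>))
    = f (one_point T n p h)"
proof -
  interpret group T by (rule T)
  note C = conj_classes_partition[OF T]
  let ?E = "{\<one>\<^bsub>T\<^esub>}" and ?\<rho> = "iota T n 1 (one_row T 1 \<theta>)"
  have E: "?E \<in> conj_classes T" using conj_class_one[OF T] unfolding conj_classes_def
    by (metis image_eqI one_closed)
  have \<theta>E: "\<one>\<^bsub>T\<^esub> \<in> \<theta> \<longleftrightarrow> \<theta> = ?E" using C(3)[OF \<theta>] conj_class_one[OF T] by auto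
  have \<rho>: "?\<rho> \<theta>' = replicate ((if \<theta>' = \<theta> then 1 else 0) + (if \<theta>' = ?E then n - 1 else 0)) 1"
    if "\<theta>' \<in> conj_classes T" for \<theta>'
    using that E by (auto simp: iota_def one_row_def conj_class_one[OF T] replicate_app_Cons_same)
  have \<rho>u: "?\<rho> \<theta>' = undefined" if "\<theta>' \<notin> conj_classes T" for \<theta>'
    using that E by (auto simp: iota_def one_row_def conj_class_one[OF T])
  let ?Q = "\<lambda>x. x \<in> carrier (wreath T n) \<and> wreath_type T n x = ?\<rho>"
  define h0 where "h0 = (SOME g. g \<in> \<theta>)"
  have h0: "h0 \<in> \<theta>" unfolding h0_def by (rule C(4)[OF \<theta>])
  have h0c: "h0 \<in> carrier T" using C(3)[OF \<theta> h0] by simp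
  have "?Q (one_point T n 0 h0)"
  proof
    let ?t = "\<lambda>i\<in>{..<n}. if i = 0 then h0 else \<one>\<^bsub>T\<^esub>"
    have t: "?t \<in> {..<n} \<rightarrow>\<^sub>E carrier T" using h0c by auto
    then show "one_point T n 0 h0 \<in> carrier (wreath T n)"
      by (simp add: one_point_def wreath_carrier permutes_id)
    have cnt: "card {i. i < n \<and> ?t i \<in> \<theta>'} = (if \<theta>' = \<theta> then 1 else 0) + (if \<theta>'
      = ?E then n - 1 else 0)"
      if \<theta>': "\<theta>' \<in> conj_classes T" for \<theta>'
    proof -
      have "{i. i < n \<and> ?t i \<in> \<theta>'} = (if \<theta>' = \<theta> then {0} else {}) \<union> (if \<theta>'
        = ?E then {1..<n} else {})"
      proof -
        have "h0 \<in> \<theta>' \<longleftrightarrow> \<theta>' = \<theta>" using C(3)[OF \<theta>' ] C(3)[OF \<theta> h0] h0 by auto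
        moreover have "\<one>\<^bsub>T\<^esub> \<in> \<theta>' \<longleftrightarrow> \<theta>' = ?E" using C(3)[OF \<theta>'] conj_class_one[OF T] by auto
        ultimately show ?thesis using n by auto
      qed
      then show ?thesis by (auto simp: card_insert_if)
    qed
    show "wreath_type T n (one_point T n 0 h0) = ?\<rho>"
      unfolding one_point_def wreath_type_base[OF T t]
    proof
      fix \<theta>' show "(\<lambda>\<theta>\<in>conj_classes T. replicate (card {i. i < n \<and> ?t i \<in> \<theta>}) 1) \<theta>' = ?\<rho> \<theta>'"
        using cnt[of \<theta>'] \<rho>[of \<theta>'] \<rho>u[of \<theta>'] by (cases "\<theta>' \<in> conj_classes T") simp_all
    qed
  qed
  then have Q: "?Q (SOME x. ?Q x)" by (rule someI)
  obtain t \<sigma> where x: "(SOME x. ?Q x) = (t, \<sigma>)" by (rule prod.exhaust)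
  have car: "(t, \<sigma>) \<in> carrier (wreath T n)" using Q unfolding x by (rule conjunct1)
  have ty: "wreath_type T n (t, \<sigma>) = ?\<rho>" using Q unfolding x by (rule conjunct2)
  have id: "\<sigma> = id"
    by (rule wreath_type_ones_imp_base[OF T car]) (unfold ty, subst \<rho>, auto split: if_splits)
  have t: "t \<in> {..<n} \<rightarrow>\<^sub>E carrier T" using car by (simp add: wreath_carrier)
  have cnt: "card {i. i < n \<and> t i \<in> \<theta>'} = (if \<theta>' = \<theta> then 1 else 0) + (if \<theta>'
    = ?E then n - 1 else 0)"
    if \<theta>': "\<theta>' \<in> conj_classes T" for \<theta>'
  proof -
    have "replicate (card {i. i < n \<and> t i \<in> \<theta>'}) (1::nat) = ?\<rho> \<theta>'"
      using fun_cong[OF ty, of \<theta>'] \<theta>' unfolding id wreath_type_base[OF T t] by simp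
    then show ?thesis unfolding \<rho>[OF \<theta>'] by (metis length_replicate)
  qed
  have "\<exists>p<n. t p \<in> \<theta> \<and> (\<forall>i<n. i \<noteq> p \<longrightarrow> t i = \<one>\<^bsub>T\<^esub>)"
  proof -
    have "card {i. i < n \<and> t i \<in> \<theta>} \<noteq> 0" unfolding cnt[OF \<theta>] by simp
    then have "{i. i < n \<and> t i \<in> \<theta>} \<noteq> {}" by (rule contrapos_nn) (simp only: card.empty)
    then obtain p where p: "p < n" "t p \<in> \<theta>" by blast
    have all: "t i = \<one>\<^bsub>T\<^esub>" if i: "i < n" "i \<noteq> p" for i
    proof (cases "\<theta> = ?E")
      case True
      then have "card {i. i < n \<and> t i \<in> \<theta>} = card {..<n}" using cnt[OF \<theta>] n by simp
      then have "{i. i < n \<and> t i \<in> \<theta>} = {..<n}" by (intro card_subset_eq) auto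
      then show ?thesis using i True by blast
    next
      case False
      have "p \<notin> {i. i < n \<and> t i \<in> ?E}" using p \<theta>E False by auto
      then have "{i. i < n \<and> t i \<in> ?E} \<subseteq> {..<n} - {p}" by auto
      moreover have "card {i. i < n \<and> t i \<in> ?E} = card ({..<n} - {p})" using cnt[OF E] False p
        by auto
      ultimately have "{i. i < n \<and> t i \<in> ?E} = {..<n} - {p}" by (intro card_subset_eq) auto
      then show ?thesis using i by blast
    qed
    then show ?thesis using p by blast
  qed
  then obtain p where p: "p < n" "t p \<in> \<theta>" "\<And>i. i < n \<Longrightarrow> i \<noteq> p \<Longrightarrow> t i = \<one>\<^bsub>T\<^esub>" by blast
  have "t = (\<lambda>i\<in>{..<n}. if i = p then t p else \<one>\<^bsub>T\<^esub>)"
    using t p by (auto simp: fun_eq_iff PiE_def extensional_def)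
  then have "(SOME x. ?Q x) = one_point T n p (t p)" unfolding x id one_point_def by simp
  then have "class_value T n f ?\<rho> = f (one_point T n p (t p))" by (simp add: class_value_def)
  then show ?thesis using that p by blast
qed

lemma finite_young_families:
  assumes "finite I" shows "finite (young_families I n)"
proof (rule finite_subset)
  show "young_families I n \<subseteq> (I \<rightarrow>\<^sub>E {xs. set xs \<subseteq> {..n} \<and> length xs \<le> n})"
  proof
    fix \<Lambda> assume \<Lambda>: "\<Lambda> \<in> young_families I n"
    have "\<Lambda> i \<in> {xs. set xs \<subseteq> {..n} \<and> length xs \<le> n}" if i: "i \<in> I" for i
    proof -
      have y: "0 \<notin> set (\<Lambda> i)" using \<Lambda> i by (auto simp: young_families_def young_def)
      have "sum_list (\<Lambda> i) \<le> (\<Sum>i\<in>I. sum_list (\<Lambda> i))"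
        by (rule member_le_sum[OF i]) (use assms in auto)
      then have s: "sum_list (\<Lambda> i) \<le> n" using \<Lambda> by (simp add: young_families_def)
      have "length xs \<le> sum_list xs" if "0 \<notin> set xs" for xs :: "nat list"
        using that by (induction xs) (auto simp: Suc_le_eq)
      moreover have "x \<le> sum_list (\<Lambda> i)" if "x \<in> set (\<Lambda> i)" for x using that
        by (intro member_le_sum_list) auto
      ultimately show ?thesis using y s by (force intro: order_trans)
    qed
    then show "\<Lambda> \<in> (I \<rightarrow>\<^sub>E {xs. set xs \<subseteq> {..n} \<and> length xs \<le> n})"
      using \<Lambda> by (auto simp: young_families_def PiE_def)
  qed
qed (intro finite_PiE assms, auto intro: finite_lists_length_le)

lemma associated_function_one_row:
  assumes T: "group T" "finite (carrier T)" and n: "n \<ge> 1" and \<theta>: "\<theta> \<in> conj_classes T"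
    and M: "set_pmf M \<subseteq> young_families (irr_classes T) n"
  shows "class_value T n (associated_function T n M) (iota T n 1 (one_row T 1 \<theta>)) =
    (\<Sum>\<zeta>\<in>irr_classes T. of_real (measure_pmf.expectation M (\<lambda>\<Lambda>. real (sum_list (\<Lambda> \<zeta>)) / real n)) *
       (irr_char_class \<zeta> \<theta> / of_nat (irr_dim \<zeta>)))"
proof -
  let ?I = "irr_classes T" and ?Y = "young_families (irr_classes T) n"
  have finY: "finite ?Y" by (rule finite_young_families[OF finite_irr_classes[OF T]])
  obtain p h where ph: "p < n" "h \<in> \<theta>" and cv:
    "class_value T n (associated_function T n M) (iota T n 1 (one_row T 1 \<theta>)) =
      associated_function T n M (one_point T n p h)" using class_value_one_row[OF T(1) n \<theta>] by blast
  have hc: "h \<in> carrier T" using conj_classes_partition(3)[OF T(1) \<theta> ph(2)] by simp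
  let ?c = "\<lambda>\<zeta>. irr_char_class \<zeta> \<theta> / of_nat (irr_dim \<zeta>)"
  have "associated_function T n M (one_point T n p h) =
     (\<Sum>\<Lambda>\<in>?Y. of_real (pmf M \<Lambda>) * (\<Sum>\<zeta>\<in>?I. of_real (real (sum_list (\<Lambda> \<zeta>)) / real n) * ?c \<zeta>))"
    unfolding associated_function_def
  proof (intro sum.cong refl arg_cong2[where f = "(*)"])
    fix \<Lambda> assume "\<Lambda> \<in> ?Y"
    then show "wreath_char T n \<Lambda> (one_point T n p h) / wreath_dim T n \<Lambda> =
        (\<Sum>\<zeta>\<in>?I. of_real (real (sum_list (\<Lambda> \<zeta>)) / real n) * ?c \<zeta>)"
      unfolding one_point_def normalized_wreath_char_one_point[OF T \<open>\<Lambda> \<in> ?Y\<close> ph(1) hc]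
      by (intro sum.cong refl) (simp add: irr_char_class_const[OF T(1) _ \<theta> ph(2)])
  qed
  also have "\<dots> = (\<Sum>\<Lambda>\<in>?Y. \<Sum>\<zeta>\<in>?I. of_real (pmf M \<Lambda> * (real (sum_list (\<Lambda> \<zeta>)) / real n)) * ?c \<zeta>)"
    by (simp add: sum_distrib_left mult.assoc)
  also have "\<dots> = (\<Sum>\<zeta>\<in>?I. \<Sum>\<Lambda>\<in>?Y. of_real (pmf M \<Lambda> * (real (sum_list (\<Lambda> \<zeta>)) / real n)) * ?c \<zeta>)"
    by (rule sum.swap)
  also have "\<dots> = (\<Sum>\<zeta>\<in>?I. of_real (\<Sum>\<Lambda>\<in>?Y. pmf M \<Lambda> * (real (sum_list (\<Lambda> \<zeta>)) / real n)) * ?c \<zeta>)"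
    by (simp only: of_real_sum sum_distrib_right)
  also have "\<dots> = (\<Sum>\<zeta>\<in>?I. of_real (measure_pmf.expectation M (\<lambda>\<Lambda>. real (sum_list (\<Lambda> \<zeta>)) / real n))
    * ?c \<zeta>)"
    by (subst integral_measure_pmf[OF finY]) (use M in auto)
  finally show ?thesis unfolding cv .
qed

text \<open>
  The values on the types \<open>(1)\<^sub>\<theta>\<close> are a linear combination of the irreducible characters with
  coefficients \<open>E(|\<lambda>\<^sup>\<zeta>| / n) / dim \<zeta>\<close>, and orthogonality extracts the coefficient of \<open>\<eta>\<close>.
\<close>

lemma expected_proportion_eq:
  assumes T: "group T" "finite (carrier T)" and n: "n \<ge> 1" and \<eta>: "\<eta> \<in> irr_classes T"
    and M: "set_pmf M \<subseteq> young_families (irr_classes T) n"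
  shows "complex_of_real (measure_pmf.expectation M (\<lambda>\<Lambda>. real (sum_list (\<Lambda> \<eta>)) / real n)) =
    (\<Sum>\<theta>\<in>conj_classes T. class_value T n (associated_function T n M) (iota T n 1 (one_row T 1 \<theta>)) *
       (of_nat (card \<theta>) / of_nat (card (carrier T))) * cnj (irr_char_class \<eta> \<theta>)
           * of_nat (irr_dim \<eta>))"
    (is "?E \<eta> = _")
proof -
  interpret group T by (rule T(1))
  let ?I = "irr_classes T" and ?N = "complex_of_nat (card (carrier T))" and ?d
    = "\<lambda>\<zeta>. complex_of_nat (irr_dim \<zeta>)"
  have N: "?N \<noteq> 0" using T(2) one_closed by (auto simp: card_eq_0_iff)
  have d: "?d \<eta> \<noteq> 0" using irr_dim_pos[OF \<eta>] by simp
  have "(\<Sum>\<theta>\<in>conj_classes T. class_value T n (associated_function T n M) (iota T n 1 (one_row T 1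
    \<theta>)) *
       (of_nat (card \<theta>) / ?N) * cnj (irr_char_class \<eta> \<theta>) * ?d \<eta>) =
     (\<Sum>\<theta>\<in>conj_classes T. \<Sum>\<zeta>\<in>?I. ?E \<zeta> / ?d \<zeta> * ?d \<eta> / ?N * (of_nat (card \<theta>) * (irr_char_class \<zeta> \<theta>
         * cnj (irr_char_class \<eta> \<theta>))))"
  proof (rule sum.cong[OF refl])
    fix \<theta> assume \<theta>: "\<theta> \<in> conj_classes T"
    show "class_value T n (associated_function T n M) (iota T n 1 (one_row T 1 \<theta>)) *
       (of_nat (card \<theta>) / ?N) * cnj (irr_char_class \<eta> \<theta>) * ?d \<eta> =
      (\<Sum>\<zeta>\<in>?I. ?E \<zeta> / ?d \<zeta> * ?d \<eta> / ?N * (of_nat (card \<theta>) * (irr_char_class \<zeta> \<theta>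
          * cnj (irr_char_class \<eta> \<theta>))))"
      unfolding associated_function_one_row[OF T n \<theta> M] sum_distrib_right
      by (intro sum.cong refl) (simp only: divide_inverse mult_ac)
  qed
  also have "\<dots> = (\<Sum>\<zeta>\<in>?I. ?E \<zeta> / ?d \<zeta> * ?d \<eta> / ?N * (\<Sum>\<theta>\<in>conj_classes T. of_nat (card \<theta>)
    * (irr_char_class \<zeta> \<theta> * cnj (irr_char_class \<eta> \<theta>))))"
    unfolding sum_distrib_left by (rule sum.swap)
  also have "\<dots> = (\<Sum>\<zeta>\<in>?I. ?E \<zeta> / ?d \<zeta> * ?d \<eta> / ?N * (if \<eta> = \<zeta> then ?N else 0))"
    by (intro sum.cong refl arg_cong2[where f = "(*)"] irr_char_class_orthogonal[OF T \<eta>])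
  also have "\<dots> = (\<Sum>\<zeta>\<in>?I. if \<eta> = \<zeta> then ?E \<eta> else 0)"
    using N d by (intro sum.cong refl) auto
  also have "\<dots> = ?E \<eta>" using \<eta> finite_irr_classes[OF T] by simp
  finally show ?thesis ..
qed

theorem proposition4p4:
  fixes T :: "('a, 'b) monoid_scheme"
    and M :: "nat \<Rightarrow> ('a irrep_class \<Rightarrow> nat list) pmf"
    and \<gamma> :: "'a set \<Rightarrow> nat \<Rightarrow> complex"
  assumes "group T" and "finite (carrier T)"
    and "\<And>n. n \<ge> 1 \<Longrightarrow> set_pmf (M n) \<subseteq> young_families (irr_classes T) n"
    and "\<And>k \<theta>. k \<ge> 1 \<Longrightarrow> \<theta> \<in> conj_classes T \<Longrightarrow>
      (\<lambda>n. of_real (real n powr ((real k - 1) / 2)) *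
            class_value T n (associated_function T n (M n)) (iota T n k (one_row T k \<theta>)))
        \<longlonglongrightarrow> \<gamma> \<theta> (k + 1)"
  shows "\<forall>\<zeta>\<in>irr_classes T.
    ((\<lambda>n. complex_of_real (measure_pmf.expectation (M n) (\<lambda>\<Lambda>. real (sum_list (\<Lambda> \<zeta>)) / real n)))
       \<longlonglongrightarrow> initial_cumulant T \<gamma> \<zeta> 2) \<and>
    (\<forall>m. compactly_supported_prob m \<and> freely_infinitely_divisible m \<and>
         (\<forall>j\<ge>1. initial_cumulant T \<gamma> \<zeta> j = of_real (free_cumulant m j)) \<longrightarrow>
       (\<forall>t\<ge>0. \<exists>m\<^sub>t.
          compactly_supported_prob m\<^sub>t \<and> freely_infinitely_divisible m\<^sub>t \<and>
          (\<forall>j\<ge>1. evolved_cumulant T \<gamma> \<zeta> t j = of_real (free_cumulant m\<^sub>t j)) \<and>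
          (\<forall>\<^sub>F w in nhds 0.
             summable (\<lambda>k. of_real (free_cumulant m\<^sub>t (k + 1)) * w ^ k) \<and>
             (let F = (\<lambda>u::real. of_real (1 / sqrt (2 * pi) * exp (- u\<^sup>2 / 2)) *
                        (of_real ((1 - exp (- sqrt t * \<bar>u\<bar>)) *
                            (real (irr_dim \<zeta>))\<^sup>2 / real (card (carrier T))) * w +
                         R_transform m (of_real (exp (- sqrt t * \<bar>u\<bar>)) * w)))
              in integrable lborel F \<and> R_transform m\<^sub>t w = integral\<^sup>L lborel F))))"
proof (intro ballI conjI allI impI)
  fix \<zeta> assume \<zeta>: "\<zeta> \<in> irr_classes T"
  let ?v = "\<lambda>\<theta> n. class_value T n (associated_function T n (M n)) (iota T n 1 (one_row T 1 \<theta>))"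
  let ?f = "\<lambda>x \<theta>. x * (of_nat (card \<theta>) / of_nat (card (carrier T))) * cnj (irr_char_class \<zeta> \<theta>)
    * of_nat (irr_dim \<zeta>)"
  have v: "?v \<theta> \<longlonglongrightarrow> \<gamma> \<theta> 2" if "\<theta> \<in> conj_classes T" for \<theta>
  proof (rule Lim_transform_eventually)
    show "(\<lambda>n. of_real (real n powr ((real 1 - 1) / 2)) * ?v \<theta> n) \<longlonglongrightarrow> \<gamma> \<theta> 2"
      using assms(4)[OF order_refl that] by (simp only: one_add_one)
    show "\<forall>\<^sub>F n in sequentially. of_real (real n powr ((real 1 - 1) / 2)) * ?v \<theta> n = ?v \<theta> n"
      using eventually_ge_at_top[of 1] by eventually_elim simp
  qed
  have "(\<lambda>n. \<Sum>\<theta>\<in>conj_classes T. ?f (?v \<theta> n) \<theta>) \<longlonglongrightarrow> (\<Sum>\<theta>\<in>conj_classes T. ?f (\<gamma> \<theta> 2) \<theta>)"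
    by (intro tendsto_intros v)
  also have "(\<Sum>\<theta>\<in>conj_classes T. ?f (\<gamma> \<theta> 2) \<theta>) = initial_cumulant T \<gamma> \<zeta> 2"
    by (simp add: initial_cumulant_def)
  finally show "(\<lambda>n. complex_of_real (measure_pmf.expectation (M n) (\<lambda>\<Lambda>. real (sum_list (\<Lambda> \<zeta>))
    / real n)))
       \<longlonglongrightarrow> initial_cumulant T \<gamma> \<zeta> 2"
  proof (rule Lim_transform_eventually)
    show "\<forall>\<^sub>F n in sequentially. (\<Sum>\<theta>\<in>conj_classes T. ?f (?v \<theta> n) \<theta>) =
       complex_of_real (measure_pmf.expectation (M n) (\<lambda>\<Lambda>. real (sum_list (\<Lambda> \<zeta>)) / real n))"
      using eventually_ge_at_top[of 1]
      by eventually_elim (rule expected_proportion_eq[symmetric], use assms \<zeta> in auto)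
  qed
next
  fix \<zeta> m and t :: real
  assume \<zeta>: "\<zeta> \<in> irr_classes T" and m: "compactly_supported_prob m \<and> freely_infinitely_divisible m \<and>
         (\<forall>j\<ge>1. initial_cumulant T \<gamma> \<zeta> j = of_real (free_cumulant m j))" and t: "0 \<le> t"
  define D where "D = (real (irr_dim \<zeta>))\<^sup>2 / real (card (carrier T))"
  have D: "D \<ge> 0" by (simp add: D_def)
  have "complex_of_real (free_cumulant m 1) = 0" using m by (metis initial_cumulant_def order_refl)
  then have cum1: "free_cumulant m 1 = 0" by simp
  obtain mt where mt: "compactly_supported_prob mt" "freely_infinitely_divisible mt"
    and cum: "\<And>j. j \<ge> 1 \<Longrightarrow> free_cumulant mt j =
        a_coeff (j - 1) t * free_cumulant m j + (if j = 2 then (1 - a_coeff 1 t) * D else 0)"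
    and R: "\<forall>\<^sub>F w in nhds 0. summable (\<lambda>k. of_real (free_cumulant mt (k + 1)) * w ^ k) \<and>
       integrable lborel (\<lambda>u. of_real (std_normal_density u) * (of_real ((1 - exp (- sqrt t
         * \<bar>u\<bar>)) * D) * w +
          R_transform m (of_real (exp (- sqrt t * \<bar>u\<bar>)) * w))) \<and>
       R_transform mt w = (LINT u|lborel. of_real (std_normal_density u) * (of_real ((1
         - exp (- sqrt t * \<bar>u\<bar>)) * D) * w +
          R_transform m (of_real (exp (- sqrt t * \<bar>u\<bar>)) * w)))"
    using evolved_law[of m t D] m cum1 t D by blast
  have "evolved_cumulant T \<gamma> \<zeta> t j = of_real (free_cumulant mt j)" if j: "j \<ge> 1" for j
  proof -
    have i: "initial_cumulant T \<gamma> \<zeta> j = of_real (free_cumulant m j)" using m j by blast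
    \<comment> \<open>the factor \<open>a_coeff 0\<close> for \<open>j = 1\<close> multiplies \<open>free_cumulant m 1 = 0\<close>\<close>
    consider "j = 1" | "j = 2" | "j > 2" using j by linarith
    then show ?thesis
    proof cases
      case 1
      then show ?thesis using cum[of 1] cum1 by (simp add: evolved_cumulant_def)
    next
      case 2
      then show ?thesis using cum[of 2] i by (simp add: evolved_cumulant_def D_def)
    next
      case 3
      then show ?thesis using cum[of j] i by (simp add: evolved_cumulant_def)
    qed
  qed
  with mt R show "\<exists>m\<^sub>t.
          compactly_supported_prob m\<^sub>t \<and> freely_infinitely_divisible m\<^sub>t \<and>
          (\<forall>j\<ge>1. evolved_cumulant T \<gamma> \<zeta> t j = of_real (free_cumulant m\<^sub>t j)) \<and>
          (\<forall>\<^sub>F w in nhds 0.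
             summable (\<lambda>k. of_real (free_cumulant m\<^sub>t (k + 1)) * w ^ k) \<and>
             (let F = (\<lambda>u::real. of_real (1 / sqrt (2 * pi) * exp (- u\<^sup>2 / 2)) *
                        (of_real ((1 - exp (- sqrt t * \<bar>u\<bar>)) *
                            (real (irr_dim \<zeta>))\<^sup>2 / real (card (carrier T))) * w +
                         R_transform m (of_real (exp (- sqrt t * \<bar>u\<bar>)) * w)))
              in integrable lborel F \<and> R_transform m\<^sub>t w = integral\<^sup>L lborel F))"
    by (intro exI[of _ mt] conjI allI impI) (simp_all only: D_def std_normal_density_def Let_def
      times_divide_eq_right)
qed

end
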